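(* Let $\bar A=(A_0,A_1)$ be a compatible couple of (quasi-)Banach spaces with $A_0\cap A_1\neq\{0\}$. Let $0<q_1,r_1\le\infty$ and $a_1,b_1\in SV$ be such that $\|s^{-1/r_1}b_1(s)\|_{r_1,(1,\infty)}<\infty$ and $\left\|s^{-1/r_1}b_1(s)\|u^{-1/q_1}a_1(u)\|_{q_1,(0,s)}\right\|_{r_1,(0,1)}<\infty$, and put $$\chi_1(t)=\left\|s^{-1/r_1}b_1(s)\|u^{-1/q_1}a_1(u)\|_{q_1,(0,s)}\right\|_{r_1,(0,t)}+\|s^{-1/r_1}b_1(s)\|_{r_1,(t,\infty)}\|u^{-1/q_1}a_1(u)\|_{q_1,(0,t)}.$$ Let $0<r_0\le\infty$, $b_0\in SV$, and $\|s^{-1/r_0}b_0(s)\|_{r_0,(1,\infty)}<\infty$. Put $\chi_0(t)=\|s^{-1/r_0}b_0(s)\|_{r_0,(t,\infty)}$ and $\rho(t)=t\frac{\chi_0(t)}{\chi_1(t)}$. Then, for all $f\in\bar A_{0,r_0,b_0}+\bar A^{\mathcal L}_{1,r_1,b_1,q_1,a_1}$ and $t>0$, $$K\left(\rho(t),f;\bar A_{0,r_0,b_0},\bar A^{\mathcal L}_{1,r_1,b_1,q_1,a_1}\right)\approx\|u^{-1/r_0}b_0(u)K(u,f)\|_{r_0,(0,t)}+\rho(t)\left\|s^{-1/r_1}b_1(s)\|u^{-1-1/q_1}a_1(u)K(u,f)\|_{q_1,(t,s)}\right\|_{r_1,(t,\infty)}+\chi_0(t)K(t,f),$$ with equivalence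 constants independent of $f$ and $t$.
   Context: Conventions: $1/\infty=0$; $\|\cdot\|_{q,(a,b)}$ is the usual (quasi-)norm of $L_q$ on the interval $(a,b)$, $0<q\le\infty$. $F\approx G$ means $C^{-1}G\le F\le CG$ for some constant $C>0$ independent of all significant quantities. $b\in SV$ (slowly varying) means that $b$ is a positive Lebesgue measurable function on $(0,\infty)$ such that for each $\varepsilon>0$ the function $t^{\varepsilon}b(t)$ is equivalent ($\approx$) to an increasing function and $t^{-\varepsilon}b(t)$ is equivalent to a decreasing function. For a compatible couple $(X_0,X_1)$ of (quasi-)normed spaces, $K(t,f;X_0,X_1)=\inf\{\|f_0\|_{X_0}+t\|f_1\|_{X_1}: f=f_0+f_1,\ f_i\in X_i\}$ for $f\in X_0+X_1$, $t>0$; $K(t,f):=K(t,f;A_0,A_1)$. For $0\le\theta\le1$, $0<r,q\le\infty$, $a,b\in SV$, the following are the spaces of all $f\in A_0+A_1$ with finite (quasi-)norm: $\bar A_{\theta,q,b}$: $\|u^{-\theta-1/q}b(u)K(u,f)\|_{q,(0,\infty)}$; $\bar A^{\mathcal L}_{\theta,r,b,q,a}$: $\left\|t^{-1/r}b(t)\|u^{-\theta-1/q}a(u)K(u,f)\|_{q,(0,t)}\right\|_{r,(0,\infty)}$. Standing assumption: none of the spaces under consideration is $\{0\}$. *)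

theory Defs
  imports "HOL-Analysis.Analysis" "HOL-Probability.Essential_Supremum"
begin

subsection \<open>Equivalence up to constants, and Lebesgue (quasi-)norms\<close>

definition approx_on :: "'a set \<Rightarrow> ('a \<Rightarrow> ennreal) \<Rightarrow> ('a \<Rightarrow> ennreal) \<Rightarrow> bool" where
  "approx_on S F G \<longleftrightarrow>
     (\<exists>C::real. 0 < C \<and> (\<forall>x\<in>S. ennreal (1 / C) * G x \<le> F x \<and> F x \<le> ennreal C * G x))"

definition enn_powr :: "ennreal \<Rightarrow> real \<Rightarrow> ennreal" where
  "enn_powr x p = (if x = \<infinity> then \<infinity> else ennreal (enn2real x powr p))"

text \<open>The real number \<open>1/q\<close> for \<open>0 < q \<le> \<infinity>\<close>, with \<open>1/\<infinity> = 0\<close>.\<close>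

definition rcp :: "ennreal \<Rightarrow> real" where
  "rcp q = enn2real (1 / q)"

text \<open>Exponents \<open>q\<close> lie in \<open>(0, \<infinity>]\<close>. The argument takes values in \<open>[0, \<infinity>]\<close>, since iterated
  norms of nonnegative functions may be infinite.\<close>

definition Lq_norm :: "ennreal \<Rightarrow> real set \<Rightarrow> (real \<Rightarrow> ennreal) \<Rightarrow> ennreal" where
  "Lq_norm q I h =
     (if q = \<infinity> then esssup (lebesgue_on I) h
      else enn_powr (\<integral>\<^sup>+ u. enn_powr (h u) (enn2real q) \<partial>(lebesgue_on I)) (rcp q))"


subsection \<open>Slowly varying functions\<close>

definition slowly_varying :: "(real \<Rightarrow> real) \<Rightarrow> bool" where
  "slowly_varying b \<longleftrightarrow>
     (\<forall>t>0. 0 < b t) \<and> b \<in> borel_measurable (lebesgue_on {0<..}) \<and>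
     (\<forall>\<epsilon>>0.
        (\<exists>g::real \<Rightarrow> real. mono_on {0<..} g \<and>
           approx_on {0<..} (\<lambda>t. ennreal (t powr \<epsilon> * b t)) (\<lambda>t. ennreal (g t))) \<and>
        (\<exists>h::real \<Rightarrow> real. antimono_on {0<..} h \<and>
           approx_on {0<..} (\<lambda>t. ennreal (t powr (- \<epsilon>) * b t)) (\<lambda>t. ennreal (h t))))"


subsection \<open>Compatible couples and the K-functional\<close>

record 'v qspace =
  qcarrier :: "'v set"
  qnorm :: "'v \<Rightarrow> real"

definition quasi_normed :: "'v::real_vector qspace \<Rightarrow> bool" where
  "quasi_normed X \<longleftrightarrow>
     subspace (qcarrier X) \<and>
     (\<forall>x\<in>qcarrier X. 0 \<le> qnorm X x \<and> (qnorm X x = 0 \<longleftrightarrow> x = 0)) \<and>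
     (\<forall>c. \<forall>x\<in>qcarrier X. qnorm X (c *\<^sub>R x) = \<bar>c\<bar> * qnorm X x) \<and>
     (\<exists>C. \<forall>x\<in>qcarrier X. \<forall>y\<in>qcarrier X. qnorm X (x + y) \<le> C * (qnorm X x + qnorm X y))"

definition quasi_Banach :: "'v::real_vector qspace \<Rightarrow> bool" where
  "quasi_Banach X \<longleftrightarrow>
     quasi_normed X \<and>
     (\<forall>x::nat \<Rightarrow> 'v. (\<forall>n. x n \<in> qcarrier X) \<and>
        (\<forall>e>0. \<exists>N. \<forall>m\<ge>N. \<forall>n\<ge>N. qnorm X (x m - x n) < e) \<longrightarrow>
        (\<exists>l\<in>qcarrier X. (\<lambda>n. qnorm X (x n - l)) \<longlonglongrightarrow> 0))"

text \<open>Both spaces are continuously embedded in a common Hausdorff topological vector space, the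
  type \<open>'v\<close>. There is no type class for real topological vector spaces, so continuity of the scalar
  multiplication of \<open>'v\<close> is part of the definition. Complex couples are covered as well,
  by restriction of scalars.\<close>

definition continuously_embedded ::
    "'v::{real_vector, topological_group_add, t2_space} qspace \<Rightarrow> bool" where
  "continuously_embedded X \<longleftrightarrow>
     (\<forall>x\<in>qcarrier X. \<forall>U. open U \<and> x \<in> U \<longrightarrow>
        (\<exists>\<delta>>0. \<forall>y\<in>qcarrier X. qnorm X (y - x) < \<delta> \<longrightarrow> y \<in> U))"

definition compatible_couple ::
    "'v::{real_vector, topological_group_add, t2_space} qspace \<Rightarrow> 'v qspace \<Rightarrow> bool" where
  "compatible_couple X0 X1 \<longleftrightarrow>
     continuous_on UNIV (\<lambda>(c::real, v::'v). c *\<^sub>R v) \<and>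
     quasi_normed X0 \<and> quasi_normed X1 \<and>
     continuously_embedded X0 \<and> continuously_embedded X1"

definition sum_set :: "'v::real_vector qspace \<Rightarrow> 'v qspace \<Rightarrow> 'v set" where
  "sum_set X0 X1 = {f0 + f1 | f0 f1. f0 \<in> qcarrier X0 \<and> f1 \<in> qcarrier X1}"

text \<open>Only meaningful for \<open>f \<in> sum_set X0 X1\<close> and \<open>t > 0\<close>.\<close>

definition K_fun :: "'v::real_vector qspace \<Rightarrow> 'v qspace \<Rightarrow> real \<Rightarrow> 'v \<Rightarrow> real" where
  "K_fun X0 X1 t f =
     Inf {qnorm X0 f0 + t * qnorm X1 f1 | f0 f1.
            f0 \<in> qcarrier X0 \<and> f1 \<in> qcarrier X1 \<and> f = f0 + f1}"


subsection \<open>Interpolation spaces\<close>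

definition interp_norm ::
    "'v::real_vector qspace \<Rightarrow> 'v qspace \<Rightarrow> real \<Rightarrow> ennreal \<Rightarrow> (real \<Rightarrow> real) \<Rightarrow> 'v \<Rightarrow> ennreal" where
  "interp_norm A0 A1 \<theta> q b f =
     Lq_norm q {0<..} (\<lambda>u. ennreal (u powr (- \<theta> - rcp q) * b u * K_fun A0 A1 u f))"

definition interp_space ::
    "'v::real_vector qspace \<Rightarrow> 'v qspace \<Rightarrow> real \<Rightarrow> ennreal \<Rightarrow> (real \<Rightarrow> real) \<Rightarrow> 'v qspace" where
  "interp_space A0 A1 \<theta> q b =
     \<lparr>qcarrier = {f \<in> sum_set A0 A1. interp_norm A0 A1 \<theta> q b f < \<infinity>},
      qnorm = (\<lambda>f. enn2real (interp_norm A0 A1 \<theta> q b f))\<rparr>"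

definition L_norm ::
    "'v::real_vector qspace \<Rightarrow> 'v qspace \<Rightarrow> real \<Rightarrow> ennreal \<Rightarrow> (real \<Rightarrow> real) \<Rightarrow>
       ennreal \<Rightarrow> (real \<Rightarrow> real) \<Rightarrow> 'v \<Rightarrow> ennreal" where
  "L_norm A0 A1 \<theta> r b q a f =
     Lq_norm r {0<..} (\<lambda>t. ennreal (t powr (- rcp r) * b t) *
       Lq_norm q {0<..<t} (\<lambda>u. ennreal (u powr (- \<theta> - rcp q) * a u * K_fun A0 A1 u f)))"

definition L_space ::
    "'v::real_vector qspace \<Rightarrow> 'v qspace \<Rightarrow> real \<Rightarrow> ennreal \<Rightarrow> (real \<Rightarrow> real) \<Rightarrow>
       ennreal \<Rightarrow> (real \<Rightarrow> real) \<Rightarrow> 'v qspace" where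
  "L_space A0 A1 \<theta> r b q a =
     \<lparr>qcarrier = {f \<in> sum_set A0 A1. L_norm A0 A1 \<theta> r b q a f < \<infinity>},
      qnorm = (\<lambda>f. enn2real (L_norm A0 A1 \<theta> r b q a f))\<rparr>"


subsection \<open>The functions \<open>\<chi>\<^sub>0\<close>, \<open>\<chi>\<^sub>1\<close> and \<open>\<rho>\<close>\<close>

definition chi0 :: "ennreal \<Rightarrow> (real \<Rightarrow> real) \<Rightarrow> real \<Rightarrow> ennreal" where
  "chi0 r0 b0 t = Lq_norm r0 {t<..} (\<lambda>s. ennreal (s powr (- rcp r0) * b0 s))"

definition chi1 ::
    "ennreal \<Rightarrow> (real \<Rightarrow> real) \<Rightarrow> ennreal \<Rightarrow> (real \<Rightarrow> real) \<Rightarrow> real \<Rightarrow> ennreal" where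
  "chi1 r1 b1 q1 a1 t =
     Lq_norm r1 {0<..<t} (\<lambda>s. ennreal (s powr (- rcp r1) * b1 s) *
       Lq_norm q1 {0<..<s} (\<lambda>u. ennreal (u powr (- rcp q1) * a1 u))) +
     Lq_norm r1 {t<..} (\<lambda>s. ennreal (s powr (- rcp r1) * b1 s)) *
       Lq_norm q1 {0<..<t} (\<lambda>u. ennreal (u powr (- rcp q1) * a1 u))"

text \<open>Under the integrability conditions imposed on the parameters, \<open>\<chi>\<^sub>0(t)\<close> and \<open>\<chi>\<^sub>1(t)\<close> are
  positive and finite for all \<open>t > 0\<close>, so that passing to real values loses nothing.\<close>

definition rho ::
    "ennreal \<Rightarrow> (real \<Rightarrow> real) \<Rightarrow> ennreal \<Rightarrow> (real \<Rightarrow> real) \<Rightarrow> ennreal \<Rightarrow> (real \<Rightarrow> real) \<Rightarrow>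
       real \<Rightarrow> real" where
  "rho r0 b0 r1 b1 q1 a1 t = t * (enn2real (chi0 r0 b0 t) / enn2real (chi1 r1 b1 q1 a1 t))"

end

theory Submission
  imports Defs
begin

text \<open>
  The formula is a Holmstedt-type formula, and it holds for the usual reason: a decomposition of \<open>f\<close>
  that is nearly optimal for \<open>K(t, f)\<close> in the original couple is nearly optimal for \<open>K(\<rho>(t), f)\<close> in the
  couple of interpolation spaces.

  For the upper bound, take \<open>f = f\<^sub>0 + f\<^sub>1\<close> with \<open>\<parallel>f\<^sub>0\<parallel> + t \<parallel>f\<^sub>1\<parallel> \<le> \<kappa>\<close>, where \<open>\<kappa>\<close> is slightly larger than
  \<open>K(t, f)\<close>. Then \<open>K(u, f\<^sub>0) \<le> \<kappa>\<close> and \<open>K(u, f\<^sub>1) \<le> \<kappa> u/t\<close>, while each of \<open>K(u, f\<^sub>0)\<close> and \<open>K(u, f\<^sub>1)\<close> is controlled by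
  \<open>K(u, f)\<close> plus the other one. Using for each function the better of its two bounds on either side of \<open>t\<close>,
  the norm of \<open>f\<^sub>0\<close> plus \<open>\<rho>(t)\<close> times the norm of \<open>f\<^sub>1\<close> is dominated by the right-hand side with \<open>\<kappa>\<close> in
  place of \<open>K(t, f)\<close> (lemma \<open>norms_le_parts\<close>), and \<open>\<kappa>\<close> is arbitrary.

  For the lower bound, let \<open>f = f\<^sub>0 + f\<^sub>1\<close> with \<open>f\<^sub>0\<close>, \<open>f\<^sub>1\<close> in the two interpolation spaces, of norms \<open>n\<^sub>0\<close> and \<open>n\<^sub>1\<close>.
  Because \<open>K\<close> is increasing and \<open>K(u)/u\<close> is decreasing, the norms control point values:
  \<open>\<chi>\<^sub>0(u) K(u, f\<^sub>0) \<le> n\<^sub>0\<close> and \<open>\<chi>\<^sub>1(u) K(u, f\<^sub>1) \<le> 2 u n\<^sub>1\<close>. The quantities \<open>\<chi>\<^sub>0\<close> and \<open>\<chi>\<^sub>1\<close> change by less than a power when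
  \<open>u\<close> is dilated, so these point values can be integrated over \<open>(t, \<infinity>)\<close>, respectively \<open>(0, t)\<close>, and yield
  the cross terms \<open>head_part_le_norm1\<close> and \<open>tail_part_le_norm0\<close>; lemma \<open>parts_le_norms\<close> collects the pieces.

  Two devices keep the computations short. All norms are taken with respect to the dilation-invariant
  measure \<open>du/u\<close>, restricted by indicator functions; a finite exponent and the exponent \<open>\<infinity>\<close> are then
  treated alike once monotonicity, homogeneity, subadditivity up to a constant and dilation invariance
  are known. Slow variation is used only through the inequality \<open>b(x) \<le> M max(x/y, y/x)\<^sup>1\<^sup>/\<^sup>4 b(y)\<close>. Together
  with the dilation invariance it reduces every integral of a weight to one of two power integrals.
\<close>

section \<open>Quasi-norms on an arbitrary measure space\<close>

text \<open>
  The same formula as \<^const>\<open>Lq_norm\<close>, for an arbitrary measure: the weights \<open>u\<^sup>-\<^sup>1\<^sup>/\<^sup>q\<close> of the interpolation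
  norms will be absorbed into the measure.
\<close>

definition Lq :: "ennreal \<Rightarrow> 'a measure \<Rightarrow> ('a \<Rightarrow> ennreal) \<Rightarrow> ennreal" where
  "Lq q M h =
     (if q = \<infinity> then esssup M h
      else enn_powr (\<integral>\<^sup>+ x. enn_powr (h x) (enn2real q) \<partial>M) (rcp q))"

lemma rcp_inverse:
  assumes "0 < q" "q \<noteq> \<infinity>"
  shows "0 < rcp q" "0 < enn2real q" "rcp q = 1 / enn2real q" 
proof -
  obtain r where r: "q = ennreal r" "0 < r"
    using assms by (cases q) (auto simp: ennreal_less_zero_iff)
  have "1 / q = ennreal (1 / r)"
    using r divide_ennreal[of 1 r] by simp
  then show "0 < rcp q" "0 < enn2real q" "rcp q = 1 / enn2real q"
    using r by (auto simp: rcp_def)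
qed

lemma rcp_top [simp]: "rcp top = 0"
  by (simp add: rcp_def)

lemma enn_powr_mono: "0 < p \<Longrightarrow> x \<le> y \<Longrightarrow> enn_powr x p \<le> enn_powr y p"
  by (auto simp: enn_powr_def intro!: ennreal_leI powr_mono2 enn2real_mono simp: top.not_eq_extremum top_unique)

lemma enn_powr_mult: "0 < p \<Longrightarrow> enn_powr (x * y) p = enn_powr x p * enn_powr y p"
proof -
  assume p: "0 < p"
  show ?thesis
  proof (cases "x = 0 \<or> y = 0")
    case True then show ?thesis using p by (auto simp: enn_powr_def)
  next
    case False
    then show ?thesis using p
      by (auto simp: enn_powr_def ennreal_mult_eq_top_iff ennreal_top_mult ennreal_mult_top 
        enn2real_mult powr_mult ennreal_mult ennreal_eq_0_iff enn2real_eq_0_iff)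
  qed
qed

lemma enn_powr_powr:
  assumes "0 < p" "0 < r" "p * r = 1" shows "enn_powr (enn_powr x p) r = x"
  using assms by (auto simp: enn_powr_def powr_powr less_top)

lemma enn_powr_0 [simp]: "enn_powr 0 p = 0"
  by (simp add: enn_powr_def)

lemma enn_powr_eq_0: "enn_powr x p = 0 \<Longrightarrow> x = 0"
  by (auto simp: enn_powr_def enn2real_eq_0_iff powr_def ennreal_eq_0_iff split: if_splits)

lemma enn_powr_less_top: "x < top \<Longrightarrow> enn_powr x p < top"
  by (auto simp: enn_powr_def)

lemma enn_powr_ennreal: "0 \<le> x \<Longrightarrow> enn_powr (ennreal x) p = ennreal (x powr p)"
  by (auto simp: enn_powr_def)

lemma enn_powr_1 [simp]: "enn_powr 1 p = 1"
  using enn_powr_ennreal[of 1 p] by simp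

lemma enn_powr_measurable [measurable]:
  assumes [measurable]: "h \<in> borel_measurable M"
  shows "(\<lambda>x. enn_powr (h x) p) \<in> borel_measurable M"
  unfolding enn_powr_def by measurable

lemma enn_powr_add_le:
  assumes "0 < p"
  shows "enn_powr (x + y) p \<le> enn_powr 2 p * (enn_powr x p + enn_powr y p)"
proof -
  have "x + y \<le> 2 * max x y"
    by (metis add_mono max.cobounded1 max.cobounded2 mult_2)
  then have "enn_powr (x + y) p \<le> enn_powr 2 p * enn_powr (max x y) p"
    using enn_powr_mono[OF assms] by (simp add: enn_powr_mult[OF assms, symmetric])
  also have "enn_powr (max x y) p \<le> enn_powr x p + enn_powr y p"
    by (simp add: max_def)
  finally show ?thesis by (simp add: mult_left_mono)
qed

lemma Lq_mono_AE:
  assumes "0 < q" "h \<in> borel_measurable M" "AE x in M. h x \<le> g x"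
  shows "Lq q M h \<le> Lq q M g"
proof (cases "q = \<infinity>")
  case True
  with assms show ?thesis by (auto simp: Lq_def intro!: esssup_AE_mono)
next
  case False
  have "AE x in M. enn_powr (h x) (enn2real q) \<le> enn_powr (g x) (enn2real q)"
    using assms(3) by eventually_elim (rule enn_powr_mono[OF rcp_inverse(2)[OF assms(1) False]])
  with False show ?thesis
    by (auto simp: Lq_def intro!: enn_powr_mono rcp_inverse assms(1) nn_integral_mono_AE)
qed

lemma Lq_mono:
  assumes "0 < q" "h \<in> borel_measurable M" "\<And>x. x \<in> space M \<Longrightarrow> h x \<le> g x"
  shows "Lq q M h \<le> Lq q M g"
  using assms by (intro Lq_mono_AE AE_I2)

lemma Lq_cong:
  assumes "\<And>x. x \<in> space M \<Longrightarrow> h x = g x"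
  shows "Lq q M h = Lq q M g"
proof -
  have "esssup M h = esssup M g"
  proof -
    have "h \<in> borel_measurable M \<longleftrightarrow> g \<in> borel_measurable M"
      using assms by (rule measurable_cong)
    then show ?thesis using assms 
      by (cases "h \<in> borel_measurable M") (auto intro!: esssup_AE_cong simp: esssup_non_measurable)
  qed
  moreover have "(\<integral>\<^sup>+ x. enn_powr (h x) p \<partial>M) = (\<integral>\<^sup>+ x. enn_powr (g x) p \<partial>M)" for p
    using assms by (auto intro: nn_integral_cong)
  ultimately show ?thesis by (simp add: Lq_def)
qed

text \<open>
  The factor may be infinite. This matters when an inner norm of a weight has to be shown finite:
  the outer norm of an infinite constant multiple of a weight is computed by this rule.
\<close>

lemma Lq_cmult:
  assumes "0 < q" and [measurable]: "h \<in> borel_measurable M"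
  shows "Lq q M (\<lambda>x. c * h x) = c * Lq q M h"
proof (cases "q = \<infinity>")
  case False
  define p r where "p = enn2real q" and "r = rcp q"
  then have pr: "0 < p" "0 < r" "p * r = 1" "p = enn2real q" "r = rcp q"
    using rcp_inverse[OF assms(1) False] by auto
  have eq: "Lq q M h = enn_powr (\<integral>\<^sup>+ x. enn_powr (h x) p \<partial>M) r" for M and h :: "'a \<Rightarrow> ennreal"
    using False by (simp add: Lq_def pr)
  show ?thesis
    unfolding eq by (simp add: enn_powr_mult pr(1-3) nn_integral_cmult enn_powr_powr)
next
  case True
  show ?thesis
  proof (rule antisym)
    have "AE x in M. h x \<le> esssup M h" by (rule esssup_AE)
    then have "AE x in M. c * h x \<le> c * esssup M h"
      by eventually_elim (rule mult_left_mono, auto)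
    with True show "Lq q M (\<lambda>x. c * h x) \<le> c * Lq q M h"
      by (auto simp: Lq_def intro!: esssup_I)
    have *: "AE x in M. c * h x \<le> esssup M (\<lambda>x. c * h x)" by (rule esssup_AE)
    consider "c = 0" | "c = top" | "c \<noteq> 0" "c \<noteq> top" by blast
    then have "c * esssup M h \<le> esssup M (\<lambda>x. c * h x)"
    proof cases
      case 2
      show ?thesis
      proof (cases "esssup M (\<lambda>x. c * h x) = top")
        case False
        from * have "AE x in M. h x \<le> 0"
          by eventually_elim (use False 2 in \<open>auto simp: ennreal_top_mult top_unique split: if_splits\<close>)
        then have "esssup M h \<le> 0" by (intro esssup_I) auto
        then show ?thesis by auto
      qed auto
    next
      case 3
      from * have "AE x in M. h x \<le> esssup M (\<lambda>x. c * h x) / c"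
        proof eventually_elim
        case (elim x)
        also have "esssup M (\<lambda>x. c * h x) = c * (esssup M (\<lambda>x. c * h x) / c)"
          using ennreal_mult_divide_eq[of c "esssup M (\<lambda>x. c * h x)"] 3
          by (simp add: ennreal_times_divide mult.commute[of c])
        finally show ?case
          using 3 by (simp add: ennreal_mult_le_mult_iff)
      qed
      then have "esssup M h \<le> esssup M (\<lambda>x. c * h x) / c" by (intro esssup_I) auto
      then have "c * esssup M h \<le> c * (esssup M (\<lambda>x. c * h x) / c)" by (rule mult_left_mono) auto
      also have "\<dots> = esssup M (\<lambda>x. c * h x)"
        using ennreal_mult_divide_eq[of c "esssup M (\<lambda>x. c * h x)"] 3
        by (simp add: ennreal_times_divide mult.commute[of c])
      finally show ?thesis .
    qed auto
    with True show "c * Lq q M h \<le> Lq q M (\<lambda>x. c * h x)" by (simp add: Lq_def)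
  qed
qed

lemma Lq_eq_0_AE:
  assumes "0 < q" and [measurable]: "h \<in> borel_measurable M" and 0: "Lq q M h = 0"
  shows "AE x in M. h x = 0"
proof (cases "q = \<infinity>")
  case True
  with 0 esssup_AE[of h M] show ?thesis by (auto simp: Lq_def)
next
  case False
  then have "(\<integral>\<^sup>+ x. enn_powr (h x) (enn2real q) \<partial>M) = 0"
    using 0 by (auto simp: Lq_def dest: enn_powr_eq_0)
  then have "AE x in M. enn_powr (h x) (enn2real q) = 0"
    by (simp add: nn_integral_0_iff_AE)
  then show ?thesis by eventually_elim (rule enn_powr_eq_0)
qed

text \<open>
  The quasi-triangle inequality; for \<open>q < \<infinity>\<close> it follows from
  \<open>(x + y)\<^sup>q \<le> 2\<^sup>q (x\<^sup>q + y\<^sup>q)\<close> applied twice, inside the integral with \<open>q\<close> and outside with \<open>1/q\<close>.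
  The constant depends on \<open>q\<close> alone, which makes it uniform in the cut-off points later.
\<close>

lemma Lq_add:
  assumes q: "0 < q"
  shows "\<exists>C<top. \<forall>M (h :: 'a \<Rightarrow> ennreal) g. h \<in> borel_measurable M \<longrightarrow> g \<in> borel_measurable M \<longrightarrow>
           Lq q M (\<lambda>x. h x + g x) \<le> C * (Lq q M h + Lq q M g)"
proof (cases "q = \<infinity>")
  case True
  have "Lq q M (\<lambda>x. h x + g x) \<le> 1 * (Lq q M h + Lq q M g)"
    if [measurable]: "h \<in> borel_measurable M" "g \<in> borel_measurable M" for M and h g :: "'a \<Rightarrow> ennreal"
  proof -
    have "AE x in M. h x + g x \<le> esssup M h + esssup M g"
      using esssup_AE[of h M] esssup_AE[of g M] by eventually_elim (rule add_mono)
    then show ?thesis using True by (auto simp: Lq_def intro!: esssup_I)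
  qed
  then show ?thesis by (intro exI[of _ 1]) auto
next
  case False
  define p r where "p = enn2real q" and "r = rcp q"
  then have pr: "0 < p" "0 < r" "p * r = 1" "p = enn2real q" "r = rcp q"
    using rcp_inverse[OF q False] by auto
  have eq: "Lq q M h = enn_powr (\<integral>\<^sup>+ x. enn_powr (h x) p \<partial>M) r" for M and h :: "'a \<Rightarrow> ennreal"
    using False by (simp add: Lq_def pr)
  have "Lq q M (\<lambda>x. h x + g x) \<le> (2 * enn_powr 2 r) * (Lq q M h + Lq q M g)"
    if [measurable]: "h \<in> borel_measurable M" "g \<in> borel_measurable M" for M and h g :: "'a \<Rightarrow> ennreal"
  proof -
    have "(\<integral>\<^sup>+ x. enn_powr (h x + g x) p \<partial>M)
        \<le> (\<integral>\<^sup>+ x. enn_powr 2 p * (enn_powr (h x) p + enn_powr (g x) p) \<partial>M)"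
      by (intro nn_integral_mono enn_powr_add_le pr)
    also have "\<dots> = enn_powr 2 p * ((\<integral>\<^sup>+ x. enn_powr (h x) p \<partial>M) + (\<integral>\<^sup>+ x. enn_powr (g x) p \<partial>M))"
      by (simp add: nn_integral_cmult nn_integral_add)
    finally have "Lq q M (\<lambda>x. h x + g x) \<le>
        enn_powr (enn_powr 2 p * ((\<integral>\<^sup>+ x. enn_powr (h x) p \<partial>M) + (\<integral>\<^sup>+ x. enn_powr (g x) p \<partial>M))) r"
      unfolding eq by (rule enn_powr_mono[OF pr(2)])
    also have "\<dots> = 2 * enn_powr ((\<integral>\<^sup>+ x. enn_powr (h x) p \<partial>M) + (\<integral>\<^sup>+ x. enn_powr (g x) p \<partial>M)) r"
      using pr by (simp add: enn_powr_mult enn_powr_powr)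
    also have "\<dots> \<le> 2 * (enn_powr 2 r * (Lq q M h + Lq q M g))"
      unfolding eq by (intro mult_left_mono enn_powr_add_le pr) auto
    finally show ?thesis by (simp add: mult.assoc)
  qed
  moreover have "2 * enn_powr 2 r < top"
    by (auto simp: ennreal_mult_less_top intro!: enn_powr_less_top)
  ultimately show ?thesis by blast
qed

section \<open>The multiplicative Haar measure\<close>

text \<open>
  The measure \<open>du/u\<close> on the half-line. The factor \<open>u\<^sup>-\<^sup>1\<^sup>/\<^sup>q\<close> in the norms is exactly the density of this
  measure raised to the power \<open>1/q\<close>, so that it disappears from all formulas, for \<open>q = \<infinity>\<close> as well.
  What is gained is invariance under dilations \<open>u \<mapsto> t u\<close>: estimates at the point \<open>t\<close> can be read off
  from estimates at the point \<open>1\<close>.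
\<close>

definition haar :: "real measure" where
  "haar = density (lebesgue_on {0<..}) (\<lambda>u. ennreal (1 / u))"

lemma space_haar [simp]: "space haar = {0<..}"
  by (simp add: haar_def space_restrict_space)

lemma sets_haar: "sets haar = sets (lebesgue_on {0<..})"
  by (simp add: haar_def)

lemma measurable_haar: "measurable haar N = measurable (lebesgue_on {0<..}) N"
  by (rule measurable_cong_sets) (simp_all add: sets_haar)

lemma borel_measurable_haar:
  assumes "h \<in> borel_measurable borel"
  shows "h \<in> borel_measurable haar"
proof -
  have "h \<in> borel_measurable lebesgue"
    using assms by (simp add: measurable_completion)
  then show ?thesis
    unfolding measurable_haar by (rule measurable_restrict_space1)
qed

text \<open>
  The \<open>K\<close>-functional and the inner norms are measurable because they are monotone in the variable
  \<open>u\<close>, respectively in the end point of their interval.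
\<close>

lemma mono_borel_measurable_haar:
  fixes h :: "real \<Rightarrow> ennreal"
  assumes "mono_on {0<..} h"
  shows "h \<in> borel_measurable haar"
proof (rule borel_measurableI_greater)
  fix y
  have "0 < x \<and> y < h x" if "0 < a" "y < h a" "a \<le> x" for a x
  proof -
    have "h a \<le> h x"
      using assms that by (auto simp: mono_on_def)
    with that show ?thesis by auto
  qed
  note up = this
  have "is_interval {x \<in> {0<..}. y < h x}"
    unfolding is_interval_1
  proof (intro ballI allI impI)
    fix a b x assume "a \<in> {x \<in> {0<..}. y < h x}" "a \<le> x \<and> x \<le> b"
    then show "x \<in> {x \<in> {0<..}. y < h x}" using up[of a x] by simp
  qed
  then have "{x \<in> {0<..}. y < h x} \<in> sets borel"
    by (rule real_interval_borel_measurable)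
  then have "{x \<in> {0<..}. y < h x} \<in> sets lebesgue"
    by (intro sets_completionI_sets) (simp only: sets_lborel)
  then show "{x \<in> space haar. y < h x} \<in> sets haar"
    unfolding sets_haar space_haar by (subst sets_restrict_space_iff) auto
qed

lemma nn_integral_haar:
  assumes "h \<in> borel_measurable haar"
  shows "(\<integral>\<^sup>+ u. h u \<partial>haar) = (\<integral>\<^sup>+ u. ennreal (1 / u) * h u \<partial>lebesgue_on {0<..})"
proof -
  have "(\<lambda>u::real. ennreal (1 / u)) \<in> borel_measurable haar"
    by (rule borel_measurable_haar) measurable
  with assms show ?thesis
    unfolding measurable_haar unfolding haar_def by (intro nn_integral_density)
qed

lemma AE_haar_iff: "(AE u in haar. P u) \<longleftrightarrow> (AE u in lebesgue_on {0<..}. P u)"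
proof -
  have "(\<lambda>u::real. ennreal (1 / u)) \<in> borel_measurable (lebesgue_on {0<..})"
    unfolding measurable_haar[symmetric] by (rule borel_measurable_haar) measurable
  then have "(AE u in haar. P u) \<longleftrightarrow> (AE u in lebesgue_on {0<..}. 0 < ennreal (1 / u) \<longrightarrow> P u)"
    unfolding haar_def by (rule AE_density)
  also have "\<dots> \<longleftrightarrow> (AE u in lebesgue_on {0<..}. P u)"
    by (rule AE_cong) (auto simp: space_restrict_space)
  finally show ?thesis .
qed

text \<open>
  The intervals of integration turn into indicator functions on the fixed space \<^const>\<open>haar\<close>, so that
  enlarging or splitting an interval is only monotonicity or subadditivity of one functional.
\<close>

lemma Lq_norm_eq_Lq_haar:
  assumes q: "0 < q" and I: "I \<in> sets lebesgue" "I \<subseteq> {0<..}"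
    and h: "(\<lambda>u. indicator I u * h u) \<in> borel_measurable haar"
  shows "Lq_norm q I (\<lambda>u. ennreal (u powr (- rcp q)) * h u) = Lq q haar (\<lambda>u. indicator I u * h u)"
proof (cases "q = \<infinity>")
  case True
  let ?f = "\<lambda>u. indicator I u * h u"
  have m: "f \<in> borel_measurable (lebesgue_on I) \<longleftrightarrow> (\<lambda>u. indicator I u * f u) \<in> borel_measurable haar"
    for f :: "real \<Rightarrow> ennreal"
  proof -
    have "(\<lambda>u. f u * indicator I u) = (\<lambda>u. indicator I u * f u * indicator {0<..} u)"
      using I(2) by (auto simp: fun_eq_iff indicator_def)
    note eq = this
    have "f \<in> borel_measurable (lebesgue_on I) \<longleftrightarrow> (\<lambda>u. f u * indicator I u) \<in> borel_measurable lebesgue"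
      by (rule borel_measurable_restrict_space_iff_ennreal) (use I(1) in simp)
    also have "\<dots> \<longleftrightarrow> (\<lambda>u. indicator I u * f u * indicator {0<..} u) \<in> borel_measurable lebesgue"
      by (simp only: eq)
    also have "\<dots> \<longleftrightarrow> (\<lambda>u. indicator I u * f u) \<in> borel_measurable haar"
      unfolding measurable_haar by (rule borel_measurable_restrict_space_iff_ennreal[symmetric]) simp
    finally show ?thesis .
  qed
  have hm: "h \<in> borel_measurable (lebesgue_on I)"
    using h m by blast
  have AE: "(AE u in lebesgue_on I. h u \<le> z) \<longleftrightarrow> (AE u in haar. ?f u \<le> z)" for z
  proof -
    have "(AE u in lebesgue_on I. h u \<le> z) \<longleftrightarrow> (AE u in lebesgue. u \<in> I \<longrightarrow> h u \<le> z)"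
      using I by (simp add: AE_restrict_space_iff)
    also have "\<dots> \<longleftrightarrow> (AE u in lebesgue. u \<in> {0<..} \<longrightarrow> ?f u \<le> z)"
      using I(2) by (intro AE_cong) (auto simp: indicator_def)
    also have "\<dots> \<longleftrightarrow> (AE u in haar. ?f u \<le> z)"
      by (simp add: AE_haar_iff AE_restrict_space_iff)
    finally show ?thesis .
  qed
  have "Lq_norm q I (\<lambda>u. ennreal (u powr (- rcp q)) * h u) = esssup (lebesgue_on I) h"
  proof -
    have *: "ennreal (u powr (- rcp q)) * h u = h u" if "u \<in> space (lebesgue_on I)" for u
      using that I(2) True by (auto simp: space_restrict_space)
    have "Lq q (lebesgue_on I) (\<lambda>u. ennreal (u powr (- rcp q)) * h u) = Lq q (lebesgue_on I) h"
      by (rule Lq_cong) (rule *)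
    then show ?thesis using True by (simp add: Lq_def Lq_norm_def)
  qed
  also have "\<dots> = esssup haar ?f"
    by (simp add: esssup_eq_AE[OF hm] esssup_eq_AE[OF h] AE)
  finally show ?thesis using True by (simp add: Lq_def)
next
  case False
  define p r where "p = enn2real q" and "r = rcp q"
  then have pr: "0 < p" "0 < r" "p * r = 1" "p = enn2real q" "r = rcp q"
    using rcp_inverse[OF q False] by auto
  have eq: "Lq q M h = enn_powr (\<integral>\<^sup>+ x. enn_powr (h x) p \<partial>M) r" for M and h :: "real \<Rightarrow> ennreal"
    using False by (simp add: Lq_def pr)
  have *: "enn_powr (ennreal (u powr - r)) p = ennreal (1 / u)" if "0 < u" for u
  proof -
    have "(u powr - r) powr p = u powr - (p * r)"
      by (simp add: powr_powr mult.commute)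
    also have "\<dots> = 1 / u"
      unfolding pr(3) using that by (simp add: powr_minus_divide)
    finally show ?thesis by (simp add: enn_powr_ennreal)
  qed
  have "(\<integral>\<^sup>+ u. enn_powr (ennreal (u powr - r) * h u) p \<partial>lebesgue_on I)
      = (\<integral>\<^sup>+ u. enn_powr (ennreal (u powr - r) * h u) p * indicator I u \<partial>lebesgue)"
    using I by (subst nn_integral_restrict_space) auto
  also have "\<dots> = (\<integral>\<^sup>+ u. ennreal (1 / u) * enn_powr (indicator I u * h u) p * indicator {0<..} u \<partial>lebesgue)"
    using I pr * by (intro nn_integral_cong) (auto simp: enn_powr_mult indicator_def)
  also have "\<dots> = (\<integral>\<^sup>+ u. ennreal (1 / u) * enn_powr (indicator I u * h u) p \<partial>lebesgue_on {0<..})"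
    by (subst nn_integral_restrict_space) auto
  also have "\<dots> = (\<integral>\<^sup>+ u. enn_powr (indicator I u * h u) p \<partial>haar)"
    using h by (intro nn_integral_haar[symmetric] enn_powr_measurable)
  finally show ?thesis
    using False unfolding eq Lq_norm_def pr(4,5)[symmetric] by simp
qed

lemma haar_dilation:
  assumes "0 < t"
  shows "distr haar haar (\<lambda>u. t * u) = haar" and "(\<lambda>u. t * u) \<in> measurable haar haar"
proof -
  have "(*\<^sub>R) t = (\<lambda>u::real. t * u)"
    by (rule ext) simp
  then have 0: "(\<lambda>u. t * u) \<in> lebesgue \<rightarrow>\<^sub>M lebesgue"
    using lebesgue_measurable_scaling[of t, where 'a = real] by metis
  from 0 show 1: "(\<lambda>u. t * u) \<in> measurable haar haar"
    unfolding measurable_haar measurable_cong_sets[OF refl sets_haar]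
    using assms by (intro measurable_restrict_space3) auto
  show "distr haar haar (\<lambda>u. t * u) = haar"
  proof (rule measure_eqI)
    fix A assume "A \<in> sets (distr haar haar (\<lambda>u. t * u))"
    then have A: "A \<in> sets haar" by simp
    then have A': "A \<in> sets lebesgue" "A \<subseteq> {0<..}"
      by (auto simp: sets_haar sets_restrict_space_iff)
    have inv: "(\<integral>\<^sup>+ u. F u \<partial>lebesgue) = (\<integral>\<^sup>+ u. ennreal t * F (t * u) \<partial>lebesgue)"
      if [measurable]: "F \<in> borel_measurable lebesgue" for F :: "real \<Rightarrow> ennreal"
    proof -
      have "(\<lambda>u. F (t * u)) \<in> borel_measurable lebesgue"
        using measurable_compose[OF 0 that] .
      then have "(\<integral>\<^sup>+ u. ennreal t * F (t * u) \<partial>lebesgue) = ennreal t * (\<integral>\<^sup>+ u. F (t * u) \<partial>lebesgue)"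
        by (rule nn_integral_cmult)
      then show ?thesis
        using nn_integral_real_affine_lebesgue[OF that, of t 0] assms by simp
    qed
    have AE: "emeasure haar B = (\<integral>\<^sup>+ u. ennreal (1 / u) * indicator B u \<partial>lebesgue)" if "B \<in> sets haar" for B
    proof -
      have "emeasure haar B = (\<integral>\<^sup>+ u. indicator B u \<partial>haar)" using that by simp
      also have "\<dots> = (\<integral>\<^sup>+ u. ennreal (1 / u) * indicator B u \<partial>lebesgue_on {0<..})"
        using that by (intro nn_integral_haar) auto
      also have "\<dots> = (\<integral>\<^sup>+ u. ennreal (1 / u) * indicator B u \<partial>lebesgue)"
      proof -
        have "B \<subseteq> {0<..}" using that sets.sets_into_space[OF that] by simp
        then have "ennreal (1 / u) * indicator B u * indicator {0<..} u = ennreal (1 / u) * indicator B u" for u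
          by (auto simp: indicator_def)
        then show ?thesis by (simp add: nn_integral_restrict_space)
      qed
      finally show ?thesis .
    qed
    have "emeasure (distr haar haar (\<lambda>u. t * u)) A = emeasure haar ((\<lambda>u. t * u) -` A \<inter> space haar)"
      using 1 A by (rule emeasure_distr)
    also have "\<dots> = (\<integral>\<^sup>+ u. ennreal (1 / u) * indicator ((\<lambda>u. t * u) -` A \<inter> space haar) u \<partial>lebesgue)"
      using 1 A by (intro AE measurable_sets)
    also have "\<dots> = (\<integral>\<^sup>+ u. ennreal t * (ennreal (1 / (t * u)) * indicator A (t * u)) \<partial>lebesgue)"
      using assms A' by (intro nn_integral_cong)
        (auto simp: indicator_def ennreal_mult[symmetric] mult.assoc[symmetric] zero_less_mult_iff)
    also have "\<dots> = (\<integral>\<^sup>+ u. ennreal (1 / u) * indicator A u \<partial>lebesgue)"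
    proof (rule inv[symmetric], intro borel_measurable_times_ennreal)
      show "(\<lambda>u::real. ennreal (1 / u)) \<in> borel_measurable lebesgue"
        by (rule measurable_completion) measurable
    qed (use A' in simp)
    also have "\<dots> = emeasure haar A" using AE[OF A] by simp
    finally show "emeasure (distr haar haar (\<lambda>u. t * u)) A = emeasure haar A" .
  qed simp
qed

lemma Lq_haar_dilation:
  assumes "0 < q" "0 < t" and h[measurable]: "h \<in> borel_measurable haar"
  shows "Lq q haar (\<lambda>v. h (t * v)) = Lq q haar h" and "(\<lambda>v. h (t * v)) \<in> borel_measurable haar"
proof -
  note T[measurable] = haar_dilation(2)[OF \<open>0 < t\<close>]
  show m: "(\<lambda>v. h (t * v)) \<in> borel_measurable haar"
    using measurable_compose[OF T h] .
  show "Lq q haar (\<lambda>v. h (t * v)) = Lq q haar h"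
  proof (cases "q = \<infinity>")
    case True
    have "(AE v in haar. h v \<le> z) \<longleftrightarrow> (AE v in haar. h (t * v) \<le> z)" for z
    proof -
      have "(AE v in distr haar haar (\<lambda>u. t * u). h v \<le> z) \<longleftrightarrow> (AE v in haar. h (t * v) \<le> z)"
        using T borel_measurable_le[OF h borel_measurable_const] by (rule AE_distr_iff)
      then show ?thesis by (simp only: haar_dilation(1)[OF \<open>0 < t\<close>])
    qed
    then show ?thesis using True by (simp add: Lq_def esssup_eq_AE[OF h] esssup_eq_AE[OF m])
  next
    case False
    have "(\<integral>\<^sup>+ v. enn_powr (h v) (enn2real q) \<partial>haar) = (\<integral>\<^sup>+ v. enn_powr (h (t * v)) (enn2real q) \<partial>haar)"
    proof -
      have "(\<integral>\<^sup>+ v. enn_powr (h v) (enn2real q) \<partial>distr haar haar (\<lambda>u. t * u))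
          = (\<integral>\<^sup>+ v. enn_powr (h (t * v)) (enn2real q) \<partial>haar)"
        using T by (rule nn_integral_distr) (use h in \<open>simp add: enn_powr_measurable\<close>)
      then show ?thesis by (simp only: haar_dilation(1)[OF \<open>0 < t\<close>])
    qed
    with False show ?thesis by (simp add: Lq_def)
  qed
qed

section \<open>Norms cut off at a point\<close>

definition head_norm :: "ennreal \<Rightarrow> (real \<Rightarrow> ennreal) \<Rightarrow> real \<Rightarrow> ennreal" where
  "head_norm q h t = Lq q haar (\<lambda>u. indicator {0<..<t} u * h u)"

definition tail_norm :: "ennreal \<Rightarrow> (real \<Rightarrow> ennreal) \<Rightarrow> real \<Rightarrow> ennreal" where
  "tail_norm q h t = Lq q haar (\<lambda>u. indicator {t<..} u * h u)"

lemma indicator_borel_haar: "S \<in> sets borel \<Longrightarrow> (indicator S :: real \<Rightarrow> ennreal) \<in> borel_measurable haar"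
  by (rule borel_measurable_haar) simp

lemma cutoff_measurable [measurable]:
  assumes "S \<in> sets borel" "h \<in> borel_measurable haar"
  shows "(\<lambda>u. indicator S u * h u :: ennreal) \<in> borel_measurable haar"
  using indicator_borel_haar[OF assms(1)] assms(2) by (rule borel_measurable_times_ennreal)

lemma head_norm_mono:
  assumes "0 < q" "h \<in> borel_measurable haar" "\<And>u. 0 < u \<Longrightarrow> u < t \<Longrightarrow> h u \<le> g u"
  shows "head_norm q h t \<le> head_norm q g t"
  unfolding head_norm_def
  by (rule Lq_mono[OF assms(1)], rule cutoff_measurable) (auto simp: indicator_def assms)

lemma tail_norm_mono:
  assumes "0 < q" "h \<in> borel_measurable haar" "\<And>u. 0 < u \<Longrightarrow> t < u \<Longrightarrow> h u \<le> g u"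
  shows "tail_norm q h t \<le> tail_norm q g t"
  unfolding tail_norm_def
  by (rule Lq_mono[OF assms(1)], rule cutoff_measurable) (auto simp: indicator_def assms)

lemma head_norm_cmult:
  assumes "0 < q" "h \<in> borel_measurable haar"
  shows "head_norm q (\<lambda>u. c * h u) t = c * head_norm q h t"
  unfolding head_norm_def
  using Lq_cmult[OF assms(1) cutoff_measurable[OF _ assms(2)], of "{0<..<t}" c]
  by (simp add: mult.left_commute)

lemma tail_norm_cmult:
  assumes "0 < q" "h \<in> borel_measurable haar"
  shows "tail_norm q (\<lambda>u. c * h u) t = c * tail_norm q h t"
  unfolding tail_norm_def
  using Lq_cmult[OF assms(1) cutoff_measurable[OF _ assms(2)], of "{t<..}" c]
  by (simp add: mult.left_commute)

lemma head_norm_le_Lq: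
  assumes "0 < q" "h \<in> borel_measurable haar"
  shows "head_norm q h t \<le> Lq q haar h"
  unfolding head_norm_def using assms
  by (intro Lq_mono cutoff_measurable) (auto simp: indicator_def)

lemma tail_norm_le_Lq:
  assumes "0 < q" "h \<in> borel_measurable haar"
  shows "tail_norm q h t \<le> Lq q haar h"
  unfolding tail_norm_def using assms
  by (intro Lq_mono cutoff_measurable) (auto simp: indicator_def)

lemma head_norm_mono_interval:
  assumes "0 < q" "h \<in> borel_measurable haar" "s \<le> t"
  shows "head_norm q h s \<le> head_norm q h t"
  unfolding head_norm_def using assms
  by (intro Lq_mono cutoff_measurable) (auto simp: indicator_def)

lemma AE_haar_neq: "AE u in haar. u \<noteq> t"
  unfolding AE_haar_iff
  by (subst AE_restrict_space_iff) (auto intro: eventually_mono[OF AE_not_in[of "{t}"]])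

lemma cutoff_add:
  assumes "0 < q"
  obtains C where "C < top" "\<And>S h g. S \<in> sets borel \<Longrightarrow> h \<in> borel_measurable haar \<Longrightarrow> g \<in> borel_measurable haar \<Longrightarrow>
    Lq q haar (\<lambda>u. indicator S u * (h u + g u))
      \<le> C * (Lq q haar (\<lambda>u. indicator S u * h u) + Lq q haar (\<lambda>u. indicator S u * g u))"
proof -
  obtain C where C: "C < top" "\<forall>M (h :: real \<Rightarrow> ennreal) g. h \<in> borel_measurable M \<longrightarrow> g \<in> borel_measurable M \<longrightarrow>
      Lq q M (\<lambda>x. h x + g x) \<le> C * (Lq q M h + Lq q M g)"
    using Lq_add[OF assms] by blast
  show ?thesis
  proof (rule that[OF C(1)])
    fix S :: "real set" and h g :: "real \<Rightarrow> ennreal"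
    assume m: "S \<in> sets borel" "h \<in> borel_measurable haar" "g \<in> borel_measurable haar"
    show "Lq q haar (\<lambda>u. indicator S u * (h u + g u))
      \<le> C * (Lq q haar (\<lambda>u. indicator S u * h u) + Lq q haar (\<lambda>u. indicator S u * g u))"
      unfolding distrib_left[of "indicator _ _"] by (intro C(2)[rule_format] cutoff_measurable m)
  qed
qed

lemma head_norm_add:
  assumes "0 < q"
  obtains C where "C < top" "\<And>h g t. h \<in> borel_measurable haar \<Longrightarrow> g \<in> borel_measurable haar \<Longrightarrow>
    head_norm q (\<lambda>u. h u + g u) t \<le> C * (head_norm q h t + head_norm q g t)"
proof -
  obtain C where C: "C < top" "\<And>S h g. S \<in> sets borel \<Longrightarrow> h \<in> borel_measurable haar \<Longrightarrow> g \<in> borel_measurable haar \<Longrightarrow>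
    Lq q haar (\<lambda>u. indicator S u * (h u + g u))
      \<le> C * (Lq q haar (\<lambda>u. indicator S u * h u) + Lq q haar (\<lambda>u. indicator S u * g u))"
    using cutoff_add[OF assms] by blast
  show ?thesis
    by (rule that[OF C(1)], unfold head_norm_def, rule C(2)) auto
qed

lemma tail_norm_add:
  assumes "0 < q"
  obtains C where "C < top" "\<And>h g t. h \<in> borel_measurable haar \<Longrightarrow> g \<in> borel_measurable haar \<Longrightarrow>
    tail_norm q (\<lambda>u. h u + g u) t \<le> C * (tail_norm q h t + tail_norm q g t)"
proof -
  obtain C where C: "C < top" "\<And>S h g. S \<in> sets borel \<Longrightarrow> h \<in> borel_measurable haar \<Longrightarrow> g \<in> borel_measurable haar \<Longrightarrow>
    Lq q haar (\<lambda>u. indicator S u * (h u + g u))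
      \<le> C * (Lq q haar (\<lambda>u. indicator S u * h u) + Lq q haar (\<lambda>u. indicator S u * g u))"
    using cutoff_add[OF assms] by blast
  show ?thesis
    by (rule that[OF C(1)], unfold tail_norm_def, rule C(2)) auto
qed

lemma Lq_haar_split:
  assumes "0 < q"
  obtains C where "C < top" "\<And>h t. h \<in> borel_measurable haar \<Longrightarrow>
    Lq q haar h \<le> C * (head_norm q h t + tail_norm q h t)"
proof -
  obtain C where C: "C < top" "\<forall>M (h :: real \<Rightarrow> ennreal) g. h \<in> borel_measurable M \<longrightarrow> g \<in> borel_measurable M \<longrightarrow>
      Lq q M (\<lambda>x. h x + g x) \<le> C * (Lq q M h + Lq q M g)"
    using Lq_add[OF assms] by blast
  show ?thesis
  proof (rule that[OF C(1)])
    fix h :: "real \<Rightarrow> ennreal" and t assume m: "h \<in> borel_measurable haar"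
    have "AE u in haar. h u \<le> indicator {0<..<t} u * h u + indicator {t<..} u * h u"
      using AE_haar_neq[of t] AE_space by eventually_elim (auto simp: indicator_def)
    then have "Lq q haar h \<le> Lq q haar (\<lambda>u. indicator {0<..<t} u * h u + indicator {t<..} u * h u)"
      by (rule Lq_mono_AE[OF assms m])
    also have "\<dots> \<le> C * (head_norm q h t + tail_norm q h t)"
      unfolding head_norm_def tail_norm_def
      by (intro C(2)[rule_format] cutoff_measurable m) auto
    finally show "Lq q haar h \<le> C * (head_norm q h t + tail_norm q h t)" .
  qed
qed

lemma head_norm_measurable [measurable]:
  assumes "0 < q" "h \<in> borel_measurable haar"
  shows "head_norm q h \<in> borel_measurable haar"
  by (rule mono_borel_measurable_haar) (auto simp: mono_on_def intro!: head_norm_mono_interval assms)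

definition mid_norm :: "ennreal \<Rightarrow> (real \<Rightarrow> ennreal) \<Rightarrow> real \<Rightarrow> real \<Rightarrow> ennreal" where
  "mid_norm q h t s = Lq q haar (\<lambda>u. indicator {t<..<s} u * h u)"

lemma mid_norm_measurable:
  assumes "0 < q" "h \<in> borel_measurable haar"
  shows "mid_norm q h t \<in> borel_measurable haar"
  unfolding mid_norm_def
proof (rule mono_borel_measurable_haar, rule mono_onI)
  fix r s :: real assume "r \<le> s"
  then show "Lq q haar (\<lambda>u. indicator {t<..<r} u * h u) \<le> Lq q haar (\<lambda>u. indicator {t<..<s} u * h u)"
    using assms by (intro Lq_mono cutoff_measurable) (auto simp: indicator_def)
qed

lemma mid_norm_mono:
  assumes "0 < q" "h \<in> borel_measurable haar" "\<And>u. 0 < u \<Longrightarrow> t < u \<Longrightarrow> u < s \<Longrightarrow> h u \<le> g u"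
  shows "mid_norm q h t s \<le> mid_norm q g t s"
  unfolding mid_norm_def
  by (rule Lq_mono[OF assms(1)], rule cutoff_measurable) (auto simp: indicator_def assms)

lemma mid_norm_cmult:
  assumes "0 < q" "h \<in> borel_measurable haar"
  shows "mid_norm q (\<lambda>u. c * h u) t s = c * mid_norm q h t s"
  unfolding mid_norm_def
  using Lq_cmult[OF assms(1) cutoff_measurable[OF _ assms(2)], of "{t<..<s}" c]
  by (simp add: mult.left_commute)

lemma mid_norm_le_head_norm:
  assumes "0 < q" "h \<in> borel_measurable haar"
  shows "mid_norm q h t s \<le> head_norm q h s"
  unfolding mid_norm_def head_norm_def using assms
  by (intro Lq_mono cutoff_measurable) (auto simp: indicator_def)

lemma mid_norm_le_tail_norm:
  assumes "0 < q" "h \<in> borel_measurable haar"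
  shows "mid_norm q h t s \<le> tail_norm q h t"
  unfolding mid_norm_def tail_norm_def using assms
  by (intro Lq_mono cutoff_measurable) (auto simp: indicator_def)

lemma mid_norm_add:
  assumes "0 < q"
  obtains C where "C < top" "\<And>h g t s. h \<in> borel_measurable haar \<Longrightarrow> g \<in> borel_measurable haar \<Longrightarrow>
    mid_norm q (\<lambda>u. h u + g u) t s \<le> C * (mid_norm q h t s + mid_norm q g t s)"
proof -
  obtain C where C: "C < top" "\<And>S h g. S \<in> sets borel \<Longrightarrow> h \<in> borel_measurable haar \<Longrightarrow> g \<in> borel_measurable haar \<Longrightarrow>
    Lq q haar (\<lambda>u. indicator S u * (h u + g u))
      \<le> C * (Lq q haar (\<lambda>u. indicator S u * h u) + Lq q haar (\<lambda>u. indicator S u * g u))"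
    using cutoff_add[OF assms] by blast
  show ?thesis
    by (rule that[OF C(1)], unfold mid_norm_def, rule C(2)) auto
qed

lemma head_norm_split:
  assumes "0 < q"
  obtains C where "C < top" "\<And>h t s. h \<in> borel_measurable haar \<Longrightarrow> t \<le> s \<Longrightarrow>
    head_norm q h s \<le> C * (head_norm q h t + mid_norm q h t s)"
proof -
  obtain C where C: "C < top" "\<And>h t. h \<in> borel_measurable haar \<Longrightarrow>
    Lq q haar h \<le> C * (head_norm q h t + tail_norm q h t)"
    using Lq_haar_split[OF assms] by blast
  show ?thesis
  proof (rule that[OF C(1)])
    fix h :: "real \<Rightarrow> ennreal" and t s :: real assume m: "h \<in> borel_measurable haar" and ts: "t \<le> s"
    have "head_norm q (\<lambda>u. indicator {0<..<s} u * h u) t \<le> head_norm q h t"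
      using m by (intro head_norm_mono assms cutoff_measurable) (auto simp: indicator_def)
    moreover have "tail_norm q (\<lambda>u. indicator {0<..<s} u * h u) t = mid_norm q h t s"
      unfolding tail_norm_def mid_norm_def by (intro Lq_cong) (auto simp: indicator_def)
    ultimately have "C * (head_norm q (\<lambda>u. indicator {0<..<s} u * h u) t + tail_norm q (\<lambda>u. indicator {0<..<s} u * h u) t)
       \<le> C * (head_norm q h t + mid_norm q h t s)"
      by (intro mult_left_mono add_mono) auto
    moreover have "head_norm q h s \<le> C * (head_norm q (\<lambda>u. indicator {0<..<s} u * h u) t + tail_norm q (\<lambda>u. indicator {0<..<s} u * h u) t)"
      unfolding head_norm_def[of q h s] using m by (intro C(2) cutoff_measurable) auto
    ultimately show "head_norm q h s \<le> C * (head_norm q h t + mid_norm q h t s)"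
      by (rule order_trans[rotated])
  qed
qed

text \<open>
  Replacing the variable by a multiple moves the cut-off point, so a comparison of \<open>h\<close> at proportional
  points gives a comparison of the cut-off norms of \<open>h\<close> at two different points.
\<close>

lemma cutoff_dilation_le:
  assumes q: "0 < q" and tu: "0 < t" "0 < u" and h: "h \<in> borel_measurable haar"
    and S: "S \<in> sets borel" "T \<in> sets borel" "\<And>v. 0 < v \<Longrightarrow> t * v \<in> S \<longleftrightarrow> u * v \<in> T"
    and le: "\<And>v. 0 < v \<Longrightarrow> h (t * v) \<le> c * h (u * v)"
  shows "Lq q haar (\<lambda>x. indicator S x * h x) \<le> c * Lq q haar (\<lambda>x. indicator T x * h x)"
proof -
  let ?f = "\<lambda>S x. indicator S x * h x"
  note m = cutoff_measurable[OF S(1) h] cutoff_measurable[OF S(2) h]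
  have "Lq q haar (?f S) = Lq q haar (\<lambda>v. ?f S (t * v))"
    using q tu m by (intro Lq_haar_dilation(1)[symmetric])
  also have "\<dots> \<le> Lq q haar (\<lambda>v. c * ?f T (u * v))"
    using q tu m S(3) le by (intro Lq_mono Lq_haar_dilation(2)) (auto simp: indicator_def)
  also have "\<dots> = c * Lq q haar (?f T)"
    by (simp only: Lq_cmult[OF q Lq_haar_dilation(2)[OF q tu(2) m(2)]] Lq_haar_dilation(1)[OF q tu(2) m(2)])
  finally show ?thesis .
qed

lemma head_norm_dilation_le:
  assumes "0 < q" "0 < t" "0 < u" "h \<in> borel_measurable haar"
    and "\<And>v. 0 < v \<Longrightarrow> h (t * v) \<le> c * h (u * v)"
  shows "head_norm q h t \<le> c * head_norm q h u"
  unfolding head_norm_def using assms by (intro cutoff_dilation_le[where t = t and u = u]) auto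

lemma tail_norm_dilation_le:
  assumes "0 < q" "0 < t" "0 < u" "h \<in> borel_measurable haar"
    and "\<And>v. 0 < v \<Longrightarrow> h (t * v) \<le> c * h (u * v)"
  shows "tail_norm q h t \<le> c * tail_norm q h u"
  unfolding tail_norm_def using assms by (intro cutoff_dilation_le[where t = t and u = u]) auto

section \<open>Norms of powers\<close>

lemma powr_measurable_haar: "(\<lambda>u. ennreal (u powr c)) \<in> borel_measurable haar"
  by (rule borel_measurable_haar) measurable

lemma Lq_power_finite:
  assumes q: "0 < q" and S: "S \<in> sets borel"
    and bounded: "\<And>u. u \<in> S \<Longrightarrow> 0 < u \<Longrightarrow> u powr c \<le> 1"
    and int: "\<And>p. 0 < p \<Longrightarrow> (\<lambda>u. u powr (c * p - 1)) integrable_on S'"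
    and S': "S \<inter> {0<..} \<subseteq> S'"
  shows "Lq q haar (\<lambda>u. indicator S u * ennreal (u powr c)) < top"
proof (cases "q = \<infinity>")
  case True
  have "Lq q haar (\<lambda>u. indicator S u * ennreal (u powr c)) \<le> 1"
    unfolding Lq_def if_P[OF True]
    using bounded S by (intro esssup_I AE_I2 cutoff_measurable powr_measurable_haar)
       (auto simp: indicator_def intro!: ennreal_leI[of _ 1, simplified])
  then show ?thesis by (rule le_less_trans) simp
next
  case False
  define p r where "p = enn2real q" and "r = rcp q"
  then have pr: "0 < p" "0 < r" "p * r = 1" "p = enn2real q" "r = rcp q"
    using rcp_inverse[OF q False] by auto
  obtain J where J: "((\<lambda>u. u powr (c * p - 1)) has_integral J) S'"
    using int[OF pr(1)] by (auto simp: integrable_on_def)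
  have "(\<integral>\<^sup>+ u. enn_powr (indicator S u * ennreal (u powr c)) p \<partial>haar)
      = (\<integral>\<^sup>+ u. ennreal (1 / u) * enn_powr (indicator S u * ennreal (u powr c)) p \<partial>lebesgue_on {0<..})"
    using S by (intro nn_integral_haar enn_powr_measurable cutoff_measurable powr_measurable_haar)
  also have "\<dots> = (\<integral>\<^sup>+ u. ennreal (1 / u) * enn_powr (indicator S u * ennreal (u powr c)) p * indicator {0<..} u \<partial>lebesgue)"
    by (subst nn_integral_restrict_space) auto
  also have "\<dots> \<le> (\<integral>\<^sup>+ u. ennreal (u powr (c * p - 1)) * indicator S' u \<partial>lebesgue)"
  proof (rule nn_integral_mono)
    fix u :: real
    show "ennreal (1 / u) * enn_powr (indicator S u * ennreal (u powr c)) p * indicator {0<..} u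
        \<le> ennreal (u powr (c * p - 1)) * indicator S' u"
    proof (cases "u \<in> S \<inter> {0<..}")
      case True
      with S' have "u \<in> S'" "u \<in> S" "0 < u" by auto
      moreover from this have "1 / u * (u powr c) powr p = u powr (c * p - 1)"
        by (simp add: powr_powr powr_diff)
      ultimately show ?thesis
        by (simp add: enn_powr_ennreal ennreal_mult[symmetric])
    qed (auto simp: indicator_def)
  qed
  also have "\<dots> = (\<integral>\<^sup>+ u. ennreal (u powr (c * p - 1)) * indicator S' u \<partial>lborel)"
    by (rule nn_integral_completion)
  also have "\<dots> = ennreal J"
    using J by (intro nn_integral_has_integral_lebesgue') auto
  finally have "(\<integral>\<^sup>+ u. enn_powr (indicator S u * ennreal (u powr c)) p \<partial>haar) < top"
    by (rule le_less_trans) simp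
  then show ?thesis
    using False by (auto simp: Lq_def pr intro!: enn_powr_less_top)
qed

lemma Lq_power_pos:
  assumes q: "0 < q" and S: "S \<in> sets borel" "{a<..<b} \<subseteq> S" "0 \<le> a" "a < b"
  shows "0 < Lq q haar (\<lambda>u. indicator S u * ennreal (u powr c))"
proof (rule ccontr)
  assume "\<not> ?thesis"
  then have "AE u in haar. indicator S u * ennreal (u powr c) = 0"
    using q S by (intro Lq_eq_0_AE[OF q] cutoff_measurable powr_measurable_haar) auto
  then have "AE u in lebesgue. u \<notin> {a<..<b}"
    unfolding AE_haar_iff
    by (subst (asm) AE_restrict_space_iff, simp, elim eventually_mono) (use S in \<open>auto simp: indicator_def split: if_splits\<close>)
  then have "emeasure lebesgue {a<..<b} = 0"
    by (subst (asm) AE_iff_measurable[of "{a<..<b}"]) auto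
  then show False using S by simp
qed

text \<open>
  Slowly varying weights will be compared with the powers \<open>u\<^sup>\<plusminus>\<^sup>1\<^sup>/\<^sup>4\<close>. That the norms of
  these powers over the two sides of \<open>1\<close> are positive and finite is the only computation of integrals in
  the whole argument.
\<close>

definition head_const :: "ennreal \<Rightarrow> ennreal" where
  "head_const q = head_norm q (\<lambda>u. ennreal (u powr (1/4))) 1"
definition tail_const :: "ennreal \<Rightarrow> ennreal" where
  "tail_const q = tail_norm q (\<lambda>u. ennreal (u powr (-1/4))) 1"

lemma head_const: assumes "0 < q" shows "0 < head_const q" "head_const q < top"
proof -
  show "0 < head_const q"
    unfolding head_const_def head_norm_def by (rule Lq_power_pos[OF assms, of _ 0 1]) auto
  have "(\<lambda>u. u powr (1/4 * p - 1)) integrable_on {0..1}" if "0 < p" for p :: real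
    using has_integral_powr_from_0[of "1/4 * p - 1" 1] that by (auto simp: integrable_on_def)
  then show "head_const q < top"
    unfolding head_const_def head_norm_def
    by (intro Lq_power_finite[OF assms, where S' = "{0..1}"]) (auto intro: powr_le1)
qed

lemma tail_const: assumes "0 < q" shows "0 < tail_const q" "tail_const q < top"
proof -
  show "0 < tail_const q"
    unfolding tail_const_def tail_norm_def by (rule Lq_power_pos[OF assms, of _ 1 2]) auto
  have "(\<lambda>u. u powr (-1/4 * p - 1)) integrable_on {1..}" if "0 < p" for p :: real
    using has_integral_powr_to_inf[of "-1/4 * p - 1" 1] that by (auto simp: integrable_on_def)
  moreover have "u powr (-1/4) \<le> 1" if "1 < u" for u :: real
    using powr_mono[of "-1/4" 0 u] that by simp
  ultimately show "tail_const q < top"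
    unfolding tail_const_def tail_norm_def
    by (intro Lq_power_finite[OF assms, where S' = "{1..}"]) auto
qed

section \<open>Slowly varying weights\<close>

definition dil_factor :: "real \<Rightarrow> real \<Rightarrow> ennreal" where
  "dil_factor x y = ennreal (max (x / y) (y / x) powr (1/4))"

lemma dil_factor_finite [simp]: "dil_factor x y < top" "dil_factor x y \<noteq> top"
  by (auto simp: dil_factor_def)

lemma dil_factor_scale: "0 < v \<Longrightarrow> dil_factor (x * v) (y * v) = dil_factor x y"
  by (simp add: dil_factor_def)

lemma dil_factor_le:
  assumes "0 < x" "x \<le> y"
  shows "dil_factor x y = ennreal ((y / x) powr (1/4))" "dil_factor y x = ennreal ((y / x) powr (1/4))"
proof -
  have "x / y \<le> 1" "1 \<le> y / x" using assms by auto
  then have "x / y \<le> y / x" by linarith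
  then show "dil_factor x y = ennreal ((y / x) powr (1/4))" "dil_factor y x = ennreal ((y / x) powr (1/4))"
    by (auto simp: dil_factor_def max_absorb1 max_absorb2)
qed

text \<open>
  The Potter-type bound \<open>b x \<le> M max (x/y) (y/x)\<^sup>\<epsilon> b y\<close> for the single exponent \<open>\<epsilon> = 1/4\<close>, which is all that
  is used of slow variation. The exponent is small enough for two such factors (one from each of \<open>a\<^sub>1\<close>
  and \<open>b\<^sub>1\<close>) to amount to the exponent \<open>1/2\<close>, still smaller than the exponent \<open>1\<close> by which the
  \<open>K\<close>-functional can grow.
\<close>

definition weight :: "ennreal \<Rightarrow> (real \<Rightarrow> ennreal) \<Rightarrow> bool" where
  "weight M b \<longleftrightarrow> M < top \<and> b \<in> borel_measurable haar \<and> (\<forall>u>0. 0 < b u \<and> b u < top) \<and>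
     (\<forall>x>0. \<forall>y>0. b x \<le> M * dil_factor x y * b y)"

lemma approx_on_mono_le:
  assumes "approx_on S F G" shows "\<exists>C. 0 < C \<and> (\<forall>x\<in>S. \<forall>y\<in>S. G x \<le> G y \<longrightarrow> F x \<le> ennreal C * F y)"
proof -
  obtain C where C: "0 < C" "\<And>x. x \<in> S \<Longrightarrow> ennreal (1 / C) * G x \<le> F x \<and> F x \<le> ennreal C * G x"
    using assms by (auto simp: approx_on_def)
  have "F x \<le> ennreal (C * C) * F y" if "x \<in> S" "y \<in> S" "G x \<le> G y" for x y
  proof -
    have "F x \<le> ennreal C * G y"
      using C(2)[OF that(1)] mult_left_mono[OF that(3), of "ennreal C"] by auto
    also have "G y = ennreal C * (ennreal (1 / C) * G y)"
      using C(1) by (simp add: mult.assoc[symmetric] ennreal_mult[symmetric])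
    also have "\<dots> \<le> ennreal C * F y"
      using C(2)[OF that(2)] by (intro mult_left_mono) auto
    finally show ?thesis
      using C(1) by (simp add: ennreal_mult mult.assoc mult_left_mono)
  qed
  then show ?thesis using C(1) by (intro exI[of _ "C * C"]) auto
qed

text \<open>
  For \<open>x \<le> y\<close>, the increasing equivalent of \<open>u\<^sup>1\<^sup>/\<^sup>4 b u\<close> bounds \<open>b x\<close> by \<open>b y\<close>, and the decreasing equivalent of
  \<open>u\<^sup>-\<^sup>1\<^sup>/\<^sup>4 b u\<close> bounds \<open>b y\<close> by \<open>b x\<close>, both with the factor \<open>(y/x)\<^sup>1\<^sup>/\<^sup>4\<close>.
\<close>

lemma slowly_varying_weight:
  assumes "slowly_varying b"
  shows "\<exists>M. weight M (\<lambda>u. ennreal (b u))"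
proof -
  have pos: "0 < b t" if "0 < t" for t
    using assms that by (auto simp: slowly_varying_def)
  have meas: "b \<in> borel_measurable haar"
    using assms by (simp add: slowly_varying_def measurable_haar)
  from assms have "\<exists>g::real \<Rightarrow> real. mono_on {0<..} g \<and>
           approx_on {0<..} (\<lambda>t. ennreal (t powr (1/4) * b t)) (\<lambda>t. ennreal (g t))"
    "\<exists>h::real \<Rightarrow> real. antimono_on {0<..} h \<and>
           approx_on {0<..} (\<lambda>t. ennreal (t powr (-(1/4)) * b t)) (\<lambda>t. ennreal (h t))"
    unfolding slowly_varying_def by (auto dest!: spec[of _ "1/4"])
  then obtain g h where g: "mono_on {0<..} g"
      "approx_on {0<..} (\<lambda>t. ennreal (t powr (1/4) * b t)) (\<lambda>t. ennreal (g t))"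
    and h: "antimono_on {0<..} h"
      "approx_on {0<..} (\<lambda>t. ennreal (t powr (-(1/4)) * b t)) (\<lambda>t. ennreal (h t))"
    by blast
  obtain C1 where C1: "0 < C1" "\<And>x y. 0 < x \<Longrightarrow> x \<le> y \<Longrightarrow>
      ennreal (x powr (1/4) * b x) \<le> ennreal C1 * ennreal (y powr (1/4) * b y)"
  proof -
    obtain C where "0 < C" "\<forall>x\<in>{0<..}. \<forall>y\<in>{0<..}. ennreal (g x) \<le> ennreal (g y) \<longrightarrow>
        ennreal (x powr (1/4) * b x) \<le> ennreal C * ennreal (y powr (1/4) * b y)"
      using approx_on_mono_le[OF g(2)] by blast
    moreover have "ennreal (g x) \<le> ennreal (g y)" if "0 < x" "x \<le> y" for x y
      using g(1) that by (intro ennreal_leI) (auto simp: mono_on_def)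
    ultimately show ?thesis by (intro that[of C]) auto
  qed
  obtain C2 where C2: "0 < C2" "\<And>x y. 0 < x \<Longrightarrow> x \<le> y \<Longrightarrow>
      ennreal (y powr (-(1/4)) * b y) \<le> ennreal C2 * ennreal (x powr (-(1/4)) * b x)"
  proof -
    obtain C where "0 < C" "\<forall>x\<in>{0<..}. \<forall>y\<in>{0<..}. ennreal (h x) \<le> ennreal (h y) \<longrightarrow>
        ennreal (x powr (-(1/4)) * b x) \<le> ennreal C * ennreal (y powr (-(1/4)) * b y)"
      using approx_on_mono_le[OF h(2)] by blast
    moreover have "ennreal (h y) \<le> ennreal (h x)" if "0 < x" "x \<le> y" for x y
      using h(1) that by (intro ennreal_leI) (auto simp: monotone_on_def)
    ultimately show ?thesis by (intro that[of C]) auto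
  qed
  define M where "M = max C1 C2"
  have M: "0 < M" "C1 \<le> M" "C2 \<le> M" using C1 by (auto simp: M_def)
  have up: "b x \<le> M * (y / x) powr (1/4) * b y" "b y \<le> M * (y / x) powr (1/4) * b x"
    if xy: "0 < x" "x \<le> y" for x y
  proof -
    have p: "0 < b x" "0 < b y" using pos xy by auto
    have "x powr (1/4) * b x \<le> C1 * (y powr (1/4) * b y)"
      using C1(2)[OF xy] C1(1) p by (simp add: ennreal_mult[symmetric])
    also have "\<dots> \<le> M * (y powr (1/4) * b y)"
      using M p by (intro mult_right_mono) auto
    finally show "b x \<le> M * (y / x) powr (1/4) * b y"
      using xy by (simp add: powr_divide field_simps)
    have "y powr (-(1/4)) * b y \<le> C2 * (x powr (-(1/4)) * b x)"
      using C2(2)[OF xy] C2(1) p by (simp add: ennreal_mult[symmetric])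
    also have "\<dots> \<le> M * (x powr (-(1/4)) * b x)"
      using M p by (intro mult_right_mono) auto
    finally show "b y \<le> M * (y / x) powr (1/4) * b x"
      using xy by (simp add: powr_divide powr_minus field_simps)
  qed
  have "ennreal (b x) \<le> ennreal M * dil_factor x y * ennreal (b y)" if "0 < x" "0 < y" for x y
  proof (cases "x \<le> y")
    case True
    then show ?thesis
      using up(1)[OF that(1) True] M(1) pos[OF that(2)]
      by (simp add: dil_factor_le(1)[OF that(1) True] ennreal_mult[symmetric] ennreal_leI del: ennreal_le_iff)
  next
    case False
    then have yx: "y \<le> x" by simp
    show ?thesis
      using up(2)[OF that(2) yx] M(1) pos[OF that(2)]
      by (simp add: dil_factor_le(2)[OF that(2) yx] ennreal_mult[symmetric] ennreal_leI del: ennreal_le_iff)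
  qed
  then have "weight (ennreal M) (\<lambda>u. ennreal (b u))"
    unfolding weight_def using pos meas by auto
  then show ?thesis by blast
qed

context
  fixes M :: ennreal and b :: "real \<Rightarrow> ennreal" and q :: ennreal
  assumes w: "weight M b" and q: "0 < q"
begin

lemma weight_measurable: "b \<in> borel_measurable haar"
  and weight_finite_const: "M < top"
  and weight_pos: "0 < u \<Longrightarrow> 0 < b u"
  and weight_less_top: "0 < u \<Longrightarrow> b u < top"
  and weight_dil: "0 < x \<Longrightarrow> 0 < y \<Longrightarrow> b x \<le> M * dil_factor x y * b y"
  using w by (auto simp: weight_def)

lemma weight_dil_scaled:
  "0 < t \<Longrightarrow> 0 < u \<Longrightarrow> 0 < v \<Longrightarrow> b (t * v) \<le> M * dil_factor t u * b (u * v)"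
  using weight_dil[of "t * v" "u * v"] by (simp add: dil_factor_scale)

lemma tail_norm_weight_dil:
  "0 < t \<Longrightarrow> 0 < u \<Longrightarrow> tail_norm q b t \<le> M * dil_factor t u * tail_norm q b u"
  using q by (intro tail_norm_dilation_le weight_measurable weight_dil_scaled)

lemma head_norm_weight_dil:
  "0 < t \<Longrightarrow> 0 < u \<Longrightarrow> head_norm q b t \<le> M * dil_factor t u * head_norm q b u"
  using q by (intro head_norm_dilation_le weight_measurable weight_dil_scaled)

text \<open>
  After the dilation \<open>u = t v\<close> and the bound for \<open>b (t v) / b t\<close>, half of the exponent is used up and a
  power of \<open>v\<close> with exponent \<open>1/4\<close> remains, whose norm over the unit interval is finite. The next
  lemma is the same at infinity, with negative exponents.
\<close>

lemma head_norm_power_weight_le: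
  assumes t: "0 < t"
  shows "head_norm q (\<lambda>u. ennreal (u powr (1/2)) * b u) t \<le> M * head_const q * ennreal (t powr (1/2)) * b t"
proof -
  let ?f = "\<lambda>u. indicator {0<..<t} u * (ennreal (u powr (1/2)) * b u)"
  have m: "?f \<in> borel_measurable haar"
    by (intro cutoff_measurable borel_measurable_times_ennreal powr_measurable_haar weight_measurable) simp
  have le: "?f (t * v) \<le> (M * ennreal (t powr (1/2)) * b t) * (indicator {0<..<1} v * ennreal (v powr (1/4)))"
    if "0 < v" for v
  proof (cases "v < 1")
    case True
    have d: "dil_factor (t * v) t = ennreal (v powr (-(1/4)))"
      using dil_factor_le(1)[of "t * v" t] t that True by (simp add: powr_divide powr_minus divide_simps)
    have p: "(t * v) powr (1/2) * v powr (-(1/4)) = t powr (1/2) * v powr (1/4)"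
      using t that by (simp add: powr_mult powr_add[symmetric])
    have "?f (t * v) \<le> ennreal ((t * v) powr (1/2)) * (M * dil_factor (t * v) t * b t)"
      using t that weight_dil[of "t * v" t] by (auto simp: indicator_def intro!: mult_left_mono)
    also have "\<dots> = M * (ennreal ((t * v) powr (1/2)) * ennreal (v powr (-(1/4)))) * b t"
      unfolding d by (simp add: mult_ac)
    also have "ennreal ((t * v) powr (1/2)) * ennreal (v powr (-(1/4))) = ennreal (t powr (1/2)) * ennreal (v powr (1/4))"
      unfolding ennreal_mult[symmetric, OF powr_ge_zero powr_ge_zero] p ..
    finally show ?thesis using that True by (simp add: mult_ac)
  qed (use t that in \<open>auto simp: indicator_def\<close>)
  have "head_norm q (\<lambda>u. ennreal (u powr (1/2)) * b u) t = Lq q haar (\<lambda>v. ?f (t * v))"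
    unfolding head_norm_def using q t m by (intro Lq_haar_dilation(1)[symmetric])
  also have "\<dots> \<le> Lq q haar (\<lambda>v. (M * ennreal (t powr (1/2)) * b t) * (indicator {0<..<1} v * ennreal (v powr (1/4))))"
    using q t m le by (intro Lq_mono Lq_haar_dilation(2)) auto
  also have "\<dots> = (M * ennreal (t powr (1/2)) * b t) * head_const q"
    unfolding head_const_def head_norm_def
    using q by (intro Lq_cmult cutoff_measurable powr_measurable_haar) auto
  finally show ?thesis by (simp add: mult_ac)
qed

lemma tail_norm_power_weight_le:
  assumes t: "0 < t"
  shows "tail_norm q (\<lambda>u. ennreal (u powr (-1/2)) * b u) t \<le> M * tail_const q * ennreal (t powr (-1/2)) * b t"
proof -
  let ?f = "\<lambda>u. indicator {t<..} u * (ennreal (u powr (-1/2)) * b u)"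
  have m: "?f \<in> borel_measurable haar"
    by (intro cutoff_measurable borel_measurable_times_ennreal powr_measurable_haar weight_measurable) simp
  have le: "?f (t * v) \<le> (M * ennreal (t powr (-1/2)) * b t) * (indicator {1<..} v * ennreal (v powr (-1/4)))"
    if "0 < v" for v
  proof (cases "1 < v")
    case True
    have d: "dil_factor (t * v) t = ennreal (v powr (1/4))"
      using dil_factor_le(2)[of t "t * v"] t that True by simp
    have p: "(t * v) powr (-1/2) * v powr (1/4) = t powr (-1/2) * v powr (-1/4)"
      using t that by (simp add: powr_mult powr_add[symmetric])
    have "?f (t * v) \<le> ennreal ((t * v) powr (-1/2)) * (M * dil_factor (t * v) t * b t)"
      using t that weight_dil[of "t * v" t] by (auto simp: indicator_def intro!: mult_left_mono)
    also have "\<dots> = M * (ennreal ((t * v) powr (-1/2)) * ennreal (v powr (1/4))) * b t"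
      unfolding d by (simp add: mult_ac)
    also have "ennreal ((t * v) powr (-1/2)) * ennreal (v powr (1/4)) = ennreal (t powr (-1/2)) * ennreal (v powr (-1/4))"
      unfolding ennreal_mult[symmetric, OF powr_ge_zero powr_ge_zero] p ..
    finally show ?thesis using that True by (simp add: mult_ac)
  qed (use t that in \<open>auto simp: indicator_def\<close>)
  have "tail_norm q (\<lambda>u. ennreal (u powr (-1/2)) * b u) t = Lq q haar (\<lambda>v. ?f (t * v))"
    unfolding tail_norm_def using q t m by (intro Lq_haar_dilation(1)[symmetric])
  also have "\<dots> \<le> Lq q haar (\<lambda>v. (M * ennreal (t powr (-1/2)) * b t) * (indicator {1<..} v * ennreal (v powr (-1/4))))"
    using q t m le by (intro Lq_mono Lq_haar_dilation(2)) auto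
  also have "\<dots> = (M * ennreal (t powr (-1/2)) * b t) * tail_const q"
    unfolding tail_const_def tail_norm_def
    using q by (intro Lq_cmult cutoff_measurable powr_measurable_haar) auto
  finally show ?thesis by (simp add: mult_ac)
qed

text \<open>
  A weight is dominated by the norm of its restriction to either side of the point. This is how the
  pointwise values produced by the two preceding lemmas are turned into \<open>\<chi>\<^sub>0\<close> and \<open>\<chi>\<^sub>1\<close>.
\<close>

lemma weight_le_head_norm:
  assumes t: "0 < t"
  shows "b t \<le> M / head_const q * head_norm q b t"
proof -
  let ?f = "\<lambda>u. indicator {0<..<t} u * b u"
  have m: "?f \<in> borel_measurable haar"
    by (intro cutoff_measurable weight_measurable) simp
  have le: "b t * (indicator {0<..<1} v * ennreal (v powr (1/4))) \<le> M * ?f (t * v)" if "0 < v" for v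
  proof (cases "v < 1")
    case True
    have d: "dil_factor t (t * v) = ennreal (v powr (-(1/4)))"
      using dil_factor_le(2)[of "t * v" t] t that True by (simp add: powr_divide powr_minus divide_simps)
    have "b t * ennreal (v powr (1/4)) \<le> (M * dil_factor t (t * v) * b (t * v)) * ennreal (v powr (1/4))"
      using t that by (intro mult_right_mono weight_dil) auto
    also have "\<dots> = M * b (t * v) * (ennreal (v powr (-(1/4))) * ennreal (v powr (1/4)))"
      unfolding d by (simp add: mult_ac)
    also have "ennreal (v powr (-(1/4))) * ennreal (v powr (1/4)) = 1"
      unfolding ennreal_mult[symmetric, OF powr_ge_zero powr_ge_zero] using that by (simp add: powr_add[symmetric])
    finally show ?thesis using that True t by (simp add: mult_ac)
  qed simp
  have "b t * head_const q = Lq q haar (\<lambda>v. b t * (indicator {0<..<1} v * ennreal (v powr (1/4))))"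
    unfolding head_const_def head_norm_def
    using q by (intro Lq_cmult[symmetric] cutoff_measurable powr_measurable_haar) auto
  also have "\<dots> \<le> Lq q haar (\<lambda>v. M * ?f (t * v))"
    using q le by (intro Lq_mono borel_measurable_times_ennreal cutoff_measurable powr_measurable_haar) auto
  also have "\<dots> = M * head_norm q b t"
    unfolding head_norm_def by (simp only: Lq_cmult[OF q Lq_haar_dilation(2)[OF q t m]] Lq_haar_dilation(1)[OF q t m])
  finally have "b t * head_const q / head_const q \<le> M * head_norm q b t / head_const q"
    by (rule divide_right_mono_ennreal)
  moreover have "b t * head_const q / head_const q = b t"
    using head_const[OF q] by (intro ennreal_mult_divide_eq) auto
  ultimately show ?thesis
    by (simp add: ennreal_divide_times ennreal_times_divide)
qed

lemma weight_le_tail_norm: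
  assumes t: "0 < t"
  shows "b t \<le> M / tail_const q * tail_norm q b t"
proof -
  let ?f = "\<lambda>u. indicator {t<..} u * b u"
  have m: "?f \<in> borel_measurable haar"
    by (intro cutoff_measurable weight_measurable) simp
  have le: "b t * (indicator {1<..} v * ennreal (v powr (-1/4))) \<le> M * ?f (t * v)" if "0 < v" for v
  proof (cases "1 < v")
    case True
    have d: "dil_factor t (t * v) = ennreal (v powr (1/4))"
      using dil_factor_le(1)[of t "t * v"] t that True by simp
    have "b t * ennreal (v powr (-1/4)) \<le> (M * dil_factor t (t * v) * b (t * v)) * ennreal (v powr (-1/4))"
      using t that by (intro mult_right_mono weight_dil) auto
    also have "\<dots> = M * b (t * v) * (ennreal (v powr (1/4)) * ennreal (v powr (-1/4)))"
      unfolding d by (simp add: mult_ac)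
    also have "ennreal (v powr (1/4)) * ennreal (v powr (-1/4)) = 1"
      unfolding ennreal_mult[symmetric, OF powr_ge_zero powr_ge_zero] using that by (simp add: powr_add[symmetric])
    finally show ?thesis using that True t by (simp add: mult_ac)
  qed simp
  have "b t * tail_const q = Lq q haar (\<lambda>v. b t * (indicator {1<..} v * ennreal (v powr (-1/4))))"
    unfolding tail_const_def tail_norm_def
    using q by (intro Lq_cmult[symmetric] cutoff_measurable powr_measurable_haar) auto
  also have "\<dots> \<le> Lq q haar (\<lambda>v. M * ?f (t * v))"
    using q le by (intro Lq_mono borel_measurable_times_ennreal cutoff_measurable powr_measurable_haar) auto
  also have "\<dots> = M * tail_norm q b t"
    unfolding tail_norm_def by (simp only: Lq_cmult[OF q Lq_haar_dilation(2)[OF q t m]] Lq_haar_dilation(1)[OF q t m])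
  finally have "b t * tail_const q / tail_const q \<le> M * tail_norm q b t / tail_const q"
    by (rule divide_right_mono_ennreal)
  moreover have "b t * tail_const q / tail_const q = b t"
    using tail_const[OF q] by (intro ennreal_mult_divide_eq) auto
  ultimately show ?thesis
    by (simp add: ennreal_divide_times ennreal_times_divide)
qed

end

lemma weight_const_finite:
  assumes "weight M b" "0 < q"
  shows "M * head_const q < top" "M * tail_const q < top" "M / head_const q < top" "M / tail_const q < top"
  using assms(1) head_const[OF assms(2)] tail_const[OF assms(2)]
  by (auto simp: weight_def ennreal_mult_eq_top_iff top.not_eq_extremum[symmetric] ennreal_divide_eq_top_iff)

section \<open>The estimates for quasi-concave functions\<close>

text \<open>
  All that the norm estimates use of \<open>u \<mapsto> K(u, f)\<close>: it is increasing, and \<open>K(u, f)/u\<close> is decreasing.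
\<close>

definition quasi_concave :: "(real \<Rightarrow> ennreal) \<Rightarrow> bool" where
  "quasi_concave k \<longleftrightarrow> (\<forall>u>0. \<forall>v\<ge>u. k u \<le> k v \<and> k v \<le> ennreal (v / u) * k u)"

lemma quasi_concave_measurable: "quasi_concave k \<Longrightarrow> k \<in> borel_measurable haar"
  by (rule mono_borel_measurable_haar) (auto simp: quasi_concave_def mono_on_def)

text \<open>
  Functions \<open>k\<close> stand for \<open>u \<mapsto> K(u, f)\<close>. The constants below are \<open>\<chi>\<^sub>0\<close> (\<open>chi_tail\<close>), \<open>\<chi>\<^sub>1\<close> (\<open>chi_mixed\<close>), \<open>\<rho>\<close>
  (\<open>ratio\<close>), the norms of the two interpolation spaces (\<open>norm0\<close>, \<open>norm1\<close>) and the two integral terms of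
  the formula for the \<open>K\<close>-functional (\<open>head_part\<close>, \<open>tail_part\<close>), all with values in \<open>[0, \<infinity>]\<close>; \<open>slope\<close> is
  the integrand of the inner norm.
\<close>

locale interpolation_weights =
  fixes r0 q1 r1 M0 Ma Mb :: ennreal and b0 a1 b1 :: "real \<Rightarrow> ennreal"
  assumes r0: "0 < r0" and q1: "0 < q1" and r1: "0 < r1"
    and b0: "weight M0 b0" and a1: "weight Ma a1" and b1: "weight Mb b1"
    and tail0_finite: "tail_norm r0 b0 1 < top"
    and tail1_finite: "tail_norm r1 b1 1 < top"
    and head1_finite: "head_norm r1 (\<lambda>s. b1 s * head_norm q1 a1 s) 1 < top"
begin

definition chi_tail :: "real \<Rightarrow> ennreal" where "chi_tail t = tail_norm r0 b0 t"
definition chi_mixed :: "real \<Rightarrow> ennreal" where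
  "chi_mixed t = head_norm r1 (\<lambda>s. b1 s * head_norm q1 a1 s) t + tail_norm r1 b1 t * head_norm q1 a1 t"
definition ratio :: "real \<Rightarrow> ennreal" where "ratio t = ennreal t * chi_tail t / chi_mixed t"
definition slope :: "(real \<Rightarrow> ennreal) \<Rightarrow> real \<Rightarrow> ennreal" where "slope k u = ennreal (1 / u) * (a1 u * k u)"
definition norm0 :: "(real \<Rightarrow> ennreal) \<Rightarrow> ennreal" where "norm0 k = Lq r0 haar (\<lambda>u. b0 u * k u)"
definition norm1 :: "(real \<Rightarrow> ennreal) \<Rightarrow> ennreal" where
  "norm1 k = Lq r1 haar (\<lambda>s. b1 s * head_norm q1 (slope k) s)"
definition head_part :: "(real \<Rightarrow> ennreal) \<Rightarrow> real \<Rightarrow> ennreal" where "head_part k t = head_norm r0 (\<lambda>u. b0 u * k u) t"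
definition tail_part :: "(real \<Rightarrow> ennreal) \<Rightarrow> real \<Rightarrow> ennreal" where
  "tail_part k t = tail_norm r1 (\<lambda>s. b1 s * mid_norm q1 (slope k) t s) t"

lemmas b0_meas [simp] = weight_measurable[OF b0 r0]
lemmas a1_meas [simp] = weight_measurable[OF a1 q1]
lemmas b1_meas [simp] = weight_measurable[OF b1 r1]

lemma slope_measurable: "k \<in> borel_measurable haar \<Longrightarrow> slope k \<in> borel_measurable haar"
  unfolding slope_def
  by (intro borel_measurable_times_ennreal a1_meas, rule borel_measurable_haar) measurable

lemma inner_meas [simp]: "(\<lambda>s. b1 s * head_norm q1 a1 s) \<in> borel_measurable haar"
  by (intro borel_measurable_times_ennreal head_norm_measurable q1) auto

lemma chi_tail_mult_le_norm0:
  assumes "quasi_concave k" "0 < t"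
  shows "chi_tail t * k t \<le> norm0 k"
proof -
  have "chi_tail t * k t = tail_norm r0 (\<lambda>u. k t * b0 u) t"
    unfolding chi_tail_def by (subst tail_norm_cmult) (auto simp: r0 mult.commute)
  also have "\<dots> \<le> tail_norm r0 (\<lambda>u. b0 u * k u) t"
    using assms
    by (intro tail_norm_mono r0 borel_measurable_times_ennreal)
       (auto simp: quasi_concave_def mult.commute[of _ "b0 _"] intro!: mult_left_mono)
  also have "\<dots> \<le> norm0 k"
    unfolding norm0_def
    by (intro tail_norm_le_Lq r0 borel_measurable_times_ennreal b0_meas quasi_concave_measurable[OF assms(1)])
  finally show ?thesis .
qed

lemma inner_mult_le:
  assumes k: "quasi_concave k" and s: "0 < s" "s \<le> t"
  shows "head_norm q1 a1 s * k t \<le> ennreal t * head_norm q1 (slope k) s"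
proof -
  have "head_norm q1 a1 s * k t = head_norm q1 (\<lambda>u. k t * a1 u) s"
    by (subst head_norm_cmult) (auto simp: q1 mult.commute)
  also have "\<dots> \<le> head_norm q1 (\<lambda>u. ennreal t * slope k u) s"
  proof (intro head_norm_mono q1 borel_measurable_times_ennreal)
    fix u assume u: "0 < u" "u < s"
    have "k t \<le> ennreal (t / u) * k u"
      using k u s by (auto simp: quasi_concave_def)
    also have "ennreal (t / u) = ennreal t * ennreal (1 / u)"
      using u s by (simp add: ennreal_mult[symmetric])
    finally have "k t * a1 u \<le> (ennreal t * ennreal (1 / u) * k u) * a1 u"
      by (intro mult_right_mono) auto
    then show "k t * a1 u \<le> ennreal t * slope k u"
      by (simp add: slope_def mult_ac)
  qed auto
  also have "\<dots> = ennreal t * head_norm q1 (slope k) s"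
    using k by (intro head_norm_cmult q1 slope_measurable quasi_concave_measurable)
  finally show ?thesis .
qed

text \<open>
  The function \<open>\<chi>\<^sub>1(t)/t\<close> is made for this bound: it is the second norm of \<open>min(u, t)/t\<close>, up to constants,
  and \<open>k u \<ge> k t min(u, t)/t\<close>. Its two summands come from outer variables below and above \<open>t\<close>.
\<close>

lemma chi_mixed_mult_le_norm1:
  assumes k: "quasi_concave k" and t: "0 < t"
  shows "chi_mixed t * k t \<le> 2 * ennreal t * norm1 k"
proof -
  have Gm: "slope k \<in> borel_measurable haar"
    using k by (intro slope_measurable quasi_concave_measurable)
  then have m: "(\<lambda>s. b1 s * head_norm q1 (slope k) s) \<in> borel_measurable haar"
    by (intro borel_measurable_times_ennreal head_norm_measurable q1) auto
  have "head_norm r1 (\<lambda>s. b1 s * head_norm q1 a1 s) t * k t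
      = head_norm r1 (\<lambda>s. k t * (b1 s * head_norm q1 a1 s)) t"
    by (subst head_norm_cmult) (auto simp: r1 mult.commute)
  also have "\<dots> \<le> head_norm r1 (\<lambda>s. ennreal t * (b1 s * head_norm q1 (slope k) s)) t"
  proof (intro head_norm_mono r1 borel_measurable_times_ennreal[OF _ inner_meas])
    fix s assume "0 < s" "s < t"
    then have "b1 s * (head_norm q1 a1 s * k t) \<le> b1 s * (ennreal t * head_norm q1 (slope k) s)"
      by (intro mult_left_mono inner_mult_le k) auto
    then show "k t * (b1 s * head_norm q1 a1 s) \<le> ennreal t * (b1 s * head_norm q1 (slope k) s)"
      by (simp add: mult_ac)
  qed auto
  also have "\<dots> \<le> ennreal t * norm1 k"
    unfolding norm1_def head_norm_cmult[OF r1 m]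
    by (intro mult_left_mono head_norm_le_Lq r1 m) auto
  finally have 1: "head_norm r1 (\<lambda>s. b1 s * head_norm q1 a1 s) t * k t \<le> ennreal t * norm1 k" .
  have "tail_norm r1 b1 t * head_norm q1 a1 t * k t \<le> tail_norm r1 b1 t * (ennreal t * head_norm q1 (slope k) t)"
    unfolding mult.assoc by (intro mult_left_mono inner_mult_le k t) auto
  also have "\<dots> = ennreal t * tail_norm r1 (\<lambda>s. head_norm q1 (slope k) t * b1 s) t"
    by (subst tail_norm_cmult) (auto simp: r1 mult_ac)
  also have "tail_norm r1 (\<lambda>s. head_norm q1 (slope k) t * b1 s) t \<le> tail_norm r1 (\<lambda>s. b1 s * head_norm q1 (slope k) s) t"
    by (intro tail_norm_mono r1 borel_measurable_times_ennreal)
       (auto simp: mult.commute[of _ "b1 _"] intro!: mult_left_mono head_norm_mono_interval q1 Gm)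
  also have "\<dots> \<le> norm1 k"
    unfolding norm1_def by (intro tail_norm_le_Lq r1 m)
  finally have 2: "tail_norm r1 b1 t * head_norm q1 a1 t * k t \<le> ennreal t * norm1 k"
    by (simp add: mult_left_mono)
  have "chi_mixed t * k t \<le> ennreal t * norm1 k + ennreal t * norm1 k"
    unfolding chi_mixed_def distrib_right using 1 2 by (rule add_mono)
  then show ?thesis by (simp add: mult_2 distrib_right)
qed

lemma chi_tail_dil: "0 < t \<Longrightarrow> 0 < u \<Longrightarrow> chi_tail t \<le> M0 * dil_factor t u * chi_tail u"
  unfolding chi_tail_def by (rule tail_norm_weight_dil[OF b0 r0])

text \<open>
  The inner norm inherits the dilation bound of \<open>a\<^sub>1\<close>, so the function under the outer norm is a product
  of two functions with a dilation bound each. This is where the exponents add up to \<open>1/2\<close>.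
\<close>

lemma chi_mixed_dil:
  assumes tu: "0 < t" "0 < u"
  shows "chi_mixed t \<le> Ma * Mb * (dil_factor t u * dil_factor t u) * chi_mixed u"
proof -
  note a = head_norm_weight_dil[OF a1 q1]
  have "head_norm r1 (\<lambda>s. b1 s * head_norm q1 a1 s) t
     \<le> (Mb * dil_factor t u * (Ma * dil_factor t u)) * head_norm r1 (\<lambda>s. b1 s * head_norm q1 a1 s) u"
  proof (intro head_norm_dilation_le r1 tu inner_meas)
    fix v :: real assume v: "0 < v"
    have "b1 (t * v) * head_norm q1 a1 (t * v) \<le> (Mb * dil_factor t u * b1 (u * v)) * (Ma * dil_factor t u * head_norm q1 a1 (u * v))"
      using a[of "t * v" "u * v"] tu v
      by (intro mult_mono weight_dil_scaled[OF b1 r1]) (auto simp: dil_factor_scale)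
    then show "b1 (t * v) * head_norm q1 a1 (t * v) \<le> Mb * dil_factor t u * (Ma * dil_factor t u) * (b1 (u * v) * head_norm q1 a1 (u * v))"
      by (simp add: mult_ac)
  qed
  moreover have "tail_norm r1 b1 t * head_norm q1 a1 t \<le> (Mb * dil_factor t u * tail_norm r1 b1 u) * (Ma * dil_factor t u * head_norm q1 a1 u)"
    by (intro mult_mono tail_norm_weight_dil[OF b1 r1] a tu) auto
  ultimately have "chi_mixed t \<le> (Mb * dil_factor t u * (Ma * dil_factor t u)) * head_norm r1 (\<lambda>s. b1 s * head_norm q1 a1 s) u
     + (Mb * dil_factor t u * tail_norm r1 b1 u) * (Ma * dil_factor t u * head_norm q1 a1 u)"
    unfolding chi_mixed_def by (rule add_mono)
  then show ?thesis by (simp add: chi_mixed_def distrib_left mult_ac)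
qed

lemma chi_tail_bounds:
  assumes "0 < t" shows "0 < chi_tail t" "chi_tail t < top"
proof -
  have "b0 t \<le> M0 / tail_const r0 * chi_tail t"
    unfolding chi_tail_def by (rule weight_le_tail_norm[OF b0 r0 assms])
  moreover have "0 < b0 t" by (rule weight_pos[OF b0 r0 assms])
  ultimately show "0 < chi_tail t" by (cases "chi_tail t = 0") (auto simp: zero_less_iff_neq_zero)
  have "chi_tail t \<le> M0 * dil_factor t 1 * chi_tail 1"
    using assms by (intro chi_tail_dil) auto
  also have "\<dots> < top"
    using tail0_finite weight_finite_const[OF b0 r0] by (simp add: ennreal_mult_less_top chi_tail_def)
  finally show "chi_tail t < top" .
qed

lemma inner_pos: assumes "0 < t" shows "0 < head_norm q1 a1 t"
proof -
  have "a1 t \<le> Ma / head_const q1 * head_norm q1 a1 t"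
    by (rule weight_le_head_norm[OF a1 q1 assms])
  moreover have "0 < a1 t" by (rule weight_pos[OF a1 q1 assms])
  ultimately show ?thesis by (cases "head_norm q1 a1 t = 0") (auto simp: zero_less_iff_neq_zero)
qed

lemma tail1_pos: assumes "0 < t" shows "0 < tail_norm r1 b1 t"
proof -
  have "b1 t \<le> Mb / tail_const r1 * tail_norm r1 b1 t"
    by (rule weight_le_tail_norm[OF b1 r1 assms])
  moreover have "0 < b1 t" by (rule weight_pos[OF b1 r1 assms])
  ultimately show ?thesis by (cases "tail_norm r1 b1 t = 0") (auto simp: zero_less_iff_neq_zero)
qed

text \<open>
  If the inner norm were infinite at one point it would be infinite at every point, since its values at
  different points are comparable, and then the outer norm over \<open>(0, 1)\<close> would be infinite too.
\<close>

lemma inner_finite: "head_norm q1 a1 1 < top"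
proof (rule ccontr)
  assume "\<not> ?thesis"
  then have inf: "head_norm q1 a1 1 = top" using top.not_eq_extremum by blast
  have top: "head_norm q1 a1 s = top" if "0 < s" for s
  proof -
    have "head_norm q1 a1 1 \<le> Ma * dil_factor 1 s * head_norm q1 a1 s"
      using that by (intro head_norm_weight_dil[OF a1 q1]) auto
    then show ?thesis
      using inf weight_finite_const[OF a1 q1]
      by (auto simp: top_unique ennreal_mult_eq_top_iff)
  qed
  have "top * head_norm r1 b1 1 = head_norm r1 (\<lambda>s. top * b1 s) 1"
    by (intro head_norm_cmult[symmetric] r1 b1_meas)
  also have "\<dots> \<le> head_norm r1 (\<lambda>s. b1 s * head_norm q1 a1 s) 1"
    by (intro head_norm_mono r1 borel_measurable_times_ennreal) (auto simp: top mult.commute)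
  finally have "top * head_norm r1 b1 1 < top"
    using head1_finite by (rule le_less_trans)
  then have "head_norm r1 b1 1 = 0"
    by (auto simp: ennreal_top_mult split: if_splits)
  moreover have "b1 1 \<le> Mb / head_const r1 * head_norm r1 b1 1"
    by (rule weight_le_head_norm[OF b1 r1]) simp
  ultimately show False using weight_pos[OF b1 r1, of 1] by auto
qed

lemma chi_mixed_bounds:
  assumes "0 < t" shows "0 < chi_mixed t" "chi_mixed t < top"
proof -
  show "0 < chi_mixed t"
    using inner_pos[OF assms] tail1_pos[OF assms] by (auto simp: chi_mixed_def zero_less_iff_neq_zero)
  have "chi_mixed t \<le> Ma * Mb * (dil_factor t 1 * dil_factor t 1) * chi_mixed 1"
    using assms by (intro chi_mixed_dil) auto
  also have "\<dots> < top"
    using tail1_finite head1_finite inner_finite weight_finite_const[OF a1 q1] weight_finite_const[OF b1 r1]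
    by (simp add: ennreal_mult_less_top chi_mixed_def)
  finally show "chi_mixed t < top" .
qed

lemma ratio_mult_chi_mixed: "0 < t \<Longrightarrow> ratio t * chi_mixed t = ennreal t * chi_tail t"
  using chi_mixed_bounds[of t] ennreal_mult_divide_eq[of "chi_mixed t" "ennreal t * chi_tail t"]
  by (simp add: ratio_def ennreal_divide_times ennreal_times_divide mult.commute[of "chi_mixed t"])

text \<open>
  The first of the two essential estimates. A bound \<open>k u \<le> 2 u norm1 k / \<chi>\<^sub>1 u\<close> is available at every point;
  since \<open>u\<^sup>1\<^sup>/\<^sup>2/\<chi>\<^sub>1 u\<close> is almost increasing, \<open>\<chi>\<^sub>1 u\<close> may be replaced by \<open>\<chi>\<^sub>1 t\<close> at the price of a factor
  \<open>(t/u)\<^sup>1\<^sup>/\<^sup>2\<close>, and what remains is the norm of \<open>u\<^sup>1\<^sup>/\<^sup>2 b\<^sub>0 u\<close> over \<open>(0, t)\<close>. Everything is multiplied by \<open>\<chi>\<^sub>1 t\<close>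
  to avoid divisions.
\<close>

lemma head_part_le_norm1:
  obtains C where "C < top" "\<And>k t. quasi_concave k \<Longrightarrow> 0 < t \<Longrightarrow> head_part k t \<le> C * (ratio t * norm1 k)"
proof
  let ?C = "2 * (Ma * Mb) * (M0 * head_const r0) * (M0 / tail_const r0)"
  show "?C < top"
    using weight_const_finite[OF b0 r0] weight_finite_const[OF a1 q1] weight_finite_const[OF b1 r1]
    by (simp add: ennreal_mult_less_top)
  fix k t assume k: "quasi_concave k" and t: "0 < (t::real)"
  let ?c = "2 * (Ma * Mb) * ennreal (t powr (1/2)) * norm1 k"
  have m: "(\<lambda>u. b0 u * k u) \<in> borel_measurable haar"
    by (intro borel_measurable_times_ennreal b0_meas quasi_concave_measurable[OF k])
  have m2: "(\<lambda>u. ennreal (u powr (1/2)) * b0 u) \<in> borel_measurable haar"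
    by (intro borel_measurable_times_ennreal powr_measurable_haar) auto
  have "chi_mixed t * head_part k t = head_norm r0 (\<lambda>u. chi_mixed t * (b0 u * k u)) t"
    unfolding head_part_def by (intro head_norm_cmult[symmetric] r0 m)
  also have "\<dots> \<le> head_norm r0 (\<lambda>u. ?c * (ennreal (u powr (1/2)) * b0 u)) t"
  proof (intro head_norm_mono r0 borel_measurable_times_ennreal[OF _ m])
    fix u assume u: "0 < u" "u < t"
    have d: "dil_factor t u * dil_factor t u * ennreal u = ennreal (t powr (1/2)) * ennreal (u powr (1/2))"
    proof -
      have "(t / u) powr (1/4) * (t / u) powr (1/4) * u = (t / u) powr (1/2) * u"
        using u t by (simp add: powr_add[symmetric])
      also have "\<dots> = t powr (1/2) * (u powr (- (1/2)) * u powr 1)"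
        using u t by (simp add: powr_divide powr_minus_divide)
      also have "u powr (- (1/2)) * u powr 1 = u powr (1/2)"
        unfolding powr_add[symmetric] by simp
      finally show ?thesis
        using u by (simp add: dil_factor_le(2)[of u t] ennreal_mult[symmetric])
    qed
    have "chi_mixed t * (b0 u * k u) \<le> (Ma * Mb * (dil_factor t u * dil_factor t u) * chi_mixed u) * (b0 u * k u)"
      using u t by (intro mult_right_mono chi_mixed_dil) auto
    also have "\<dots> = Ma * Mb * (dil_factor t u * dil_factor t u) * b0 u * (chi_mixed u * k u)"
      by (simp add: mult_ac)
    also have "\<dots> \<le> Ma * Mb * (dil_factor t u * dil_factor t u) * b0 u * (2 * ennreal u * norm1 k)"
      using u k by (intro mult_left_mono chi_mixed_mult_le_norm1) auto
    also have "\<dots> = 2 * (Ma * Mb) * (dil_factor t u * dil_factor t u * ennreal u) * norm1 k * b0 u"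
      by (simp add: mult_ac)
    also have "\<dots> = ?c * (ennreal (u powr (1/2)) * b0 u)"
      unfolding d by (simp add: mult_ac)
    finally show "chi_mixed t * (b0 u * k u) \<le> ?c * (ennreal (u powr (1/2)) * b0 u)" .
  qed auto
  also have "\<dots> = ?c * head_norm r0 (\<lambda>u. ennreal (u powr (1/2)) * b0 u) t"
    by (intro head_norm_cmult r0 m2)
  also have "\<dots> \<le> ?c * (M0 * head_const r0 * ennreal (t powr (1/2)) * b0 t)"
    by (intro mult_left_mono head_norm_power_weight_le[OF b0 r0 t]) auto
  also have "\<dots> \<le> ?c * (M0 * head_const r0 * ennreal (t powr (1/2)) * (M0 / tail_const r0 * chi_tail t))"
    unfolding chi_tail_def by (intro mult_left_mono weight_le_tail_norm[OF b0 r0 t]) auto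
  also have "\<dots> = ?C * ((ennreal (t powr (1/2)) * ennreal (t powr (1/2))) * chi_tail t) * norm1 k"
    by (simp add: mult_ac)
  also have "ennreal (t powr (1/2)) * ennreal (t powr (1/2)) = ennreal t"
    using t unfolding ennreal_mult[symmetric, OF powr_ge_zero powr_ge_zero] by (simp add: powr_add[symmetric])
  also have "?C * (ennreal t * chi_tail t) * norm1 k = chi_mixed t * (?C * (ratio t * norm1 k))"
    unfolding ratio_mult_chi_mixed[OF t, symmetric] by (simp add: mult_ac)
  finally show "head_part k t \<le> ?C * (ratio t * norm1 k)"
    using chi_mixed_bounds[OF t] by (simp add: ennreal_mult_le_mult_iff)
qed

text \<open>
  The mirror image: \<open>k u \<le> norm0 k / \<chi>\<^sub>0 u\<close>, where \<open>u\<^sup>-\<^sup>1\<^sup>/\<^sup>2/\<chi>\<^sub>0 u\<close> is almost decreasing, so that the inner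
  norm over \<open>(t, s)\<close> is bounded independently of \<open>s\<close>, by a multiple of
  \<open>norm0 k a\<^sub>1 t / (t \<chi>\<^sub>0 t)\<close>.
\<close>

lemma tail_part_le_norm0:
  obtains C where "C < top" "\<And>k t. quasi_concave k \<Longrightarrow> 0 < t \<Longrightarrow> ratio t * tail_part k t \<le> C * norm0 k"
proof
  let ?C = "M0 * (Ma * tail_const q1) * (Ma / head_const q1)"
  show "?C < top"
    using weight_const_finite[OF a1 q1] weight_finite_const[OF b0 r0]
    by (simp add: ennreal_mult_less_top)
  fix k t assume k: "quasi_concave k" and t: "0 < (t::real)"
  let ?c = "M0 * ennreal (t powr (-1/2)) * norm0 k"
  let ?d = "?c * (Ma * tail_const q1 * ennreal (t powr (-1/2)) * (Ma / head_const q1 * head_norm q1 a1 t))"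
  have Gm: "slope k \<in> borel_measurable haar"
    using k by (intro slope_measurable quasi_concave_measurable)
  have m2: "(\<lambda>u. ennreal (u powr (-1/2)) * a1 u) \<in> borel_measurable haar"
    by (intro borel_measurable_times_ennreal powr_measurable_haar) auto
  have mid: "chi_tail t * mid_norm q1 (slope k) t s \<le> ?d" for s
  proof -
    have "chi_tail t * mid_norm q1 (slope k) t s = mid_norm q1 (\<lambda>u. chi_tail t * slope k u) t s"
      by (intro mid_norm_cmult[symmetric] q1 Gm)
    also have "\<dots> \<le> mid_norm q1 (\<lambda>u. ?c * (ennreal (u powr (-1/2)) * a1 u)) t s"
    proof (intro mid_norm_mono q1 borel_measurable_times_ennreal[OF _ Gm])
      fix u assume u: "0 < u" "t < u"
      have d: "dil_factor t u * ennreal (1 / u) \<le> ennreal (t powr (-1/2)) * ennreal (u powr (-1/2))"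
      proof -
        have "(u / t) powr (1/4) \<le> (u / t) powr (1/2)"
          using u t by (intro powr_mono) auto
        then have "(u / t) powr (1/4) * (1 / u) \<le> (u / t) powr (1/2) * (1 / u)"
          using u by (intro mult_right_mono) auto
        also have "\<dots> = t powr (-1/2) * (u powr (1/2) * u powr (-1))"
          using u t by (simp add: powr_divide powr_minus_divide)
        also have "u powr (1/2) * u powr (-1) = u powr (-1/2)"
          unfolding powr_add[symmetric] by simp
        finally show ?thesis
          using u t by (simp add: dil_factor_le(1)[of t u] ennreal_mult[symmetric] ennreal_leI)
      qed
      have "chi_tail t * slope k u \<le> (M0 * dil_factor t u * chi_tail u) * slope k u"
        using u t by (intro mult_right_mono chi_tail_dil) auto
      also have "\<dots> = M0 * (dil_factor t u * ennreal (1 / u)) * a1 u * (chi_tail u * k u)"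
        by (simp add: slope_def mult_ac)
      also have "\<dots> \<le> M0 * (ennreal (t powr (-1/2)) * ennreal (u powr (-1/2))) * a1 u * norm0 k"
        using u k by (intro mult_mono chi_tail_mult_le_norm0 d) auto
      finally show "chi_tail t * slope k u \<le> ?c * (ennreal (u powr (-1/2)) * a1 u)"
        by (simp add: mult_ac)
    qed auto
    also have "\<dots> = ?c * mid_norm q1 (\<lambda>u. ennreal (u powr (-1/2)) * a1 u) t s"
      by (intro mid_norm_cmult q1 m2)
    also have "\<dots> \<le> ?c * tail_norm q1 (\<lambda>u. ennreal (u powr (-1/2)) * a1 u) t"
      by (intro mult_left_mono mid_norm_le_tail_norm q1 m2) auto
    also have "\<dots> \<le> ?c * (Ma * tail_const q1 * ennreal (t powr (-1/2)) * a1 t)"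
      by (intro mult_left_mono tail_norm_power_weight_le[OF a1 q1 t]) auto
    also have "\<dots> \<le> ?d"
      by (intro mult_left_mono weight_le_head_norm[OF a1 q1 t]) auto
    finally show ?thesis .
  qed
  have "chi_tail t * tail_part k t = tail_norm r1 (\<lambda>s. chi_tail t * (b1 s * mid_norm q1 (slope k) t s)) t"
    unfolding tail_part_def
    by (intro tail_norm_cmult[symmetric] r1 borel_measurable_times_ennreal mid_norm_measurable q1 Gm b1_meas)
  also have "\<dots> \<le> tail_norm r1 (\<lambda>s. ?d * b1 s) t"
  proof (intro tail_norm_mono r1)
    show "(\<lambda>s. chi_tail t * (b1 s * mid_norm q1 (slope k) t s)) \<in> borel_measurable haar"
      by (intro borel_measurable_times_ennreal mid_norm_measurable q1 Gm b1_meas) auto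
    fix s
    have "b1 s * (chi_tail t * mid_norm q1 (slope k) t s) \<le> b1 s * ?d"
      using mid by (rule mult_left_mono) auto
    then show "chi_tail t * (b1 s * mid_norm q1 (slope k) t s) \<le> ?d * b1 s"
      by (simp add: mult_ac)
  qed
  also have "\<dots> = ?d * tail_norm r1 b1 t"
    by (intro tail_norm_cmult r1 b1_meas)
  also have "\<dots> = ?C * (ennreal (t powr (-1/2)) * ennreal (t powr (-1/2))) * norm0 k * (tail_norm r1 b1 t * head_norm q1 a1 t)"
    by (simp add: mult_ac)
  also have "ennreal (t powr (-1/2)) * ennreal (t powr (-1/2)) = ennreal (1 / t)"
    using t unfolding ennreal_mult[symmetric, OF powr_ge_zero powr_ge_zero]
    by (simp add: powr_add[symmetric] powr_minus_divide)
  also have "?C * ennreal (1 / t) * norm0 k * (tail_norm r1 b1 t * head_norm q1 a1 t) \<le> ?C * ennreal (1 / t) * norm0 k * chi_mixed t"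
    unfolding chi_mixed_def by (intro mult_left_mono) auto
  finally have "ennreal t * (chi_tail t * tail_part k t) \<le> ennreal t * (?C * ennreal (1 / t) * norm0 k * chi_mixed t)"
    by (rule mult_left_mono) auto
  also have "\<dots> = (ennreal t * ennreal (1 / t)) * chi_mixed t * (?C * norm0 k)"
    by (simp add: mult_ac)
  also have "ennreal t * ennreal (1 / t) = 1"
    using t by (simp add: ennreal_mult[symmetric])
  also have "ennreal t * (chi_tail t * tail_part k t) = (ratio t * chi_mixed t) * tail_part k t"
    unfolding ratio_mult_chi_mixed[OF t] by (simp add: mult.assoc)
  also have "\<dots> = chi_mixed t * (ratio t * tail_part k t)"
    by (simp add: mult_ac)
  finally show "ratio t * tail_part k t \<le> ?C * norm0 k"
    using chi_mixed_bounds[OF t] by (simp add: ennreal_mult_le_mult_iff)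
qed

text \<open>
  This is the lower bound for the \<open>K\<close>-functional: \<open>k\<close>, \<open>k0\<close>, \<open>k1\<close> belong to \<open>f = f\<^sub>0 + f\<^sub>1\<close> with \<open>f\<^sub>0\<close>, \<open>f\<^sub>1\<close> in the two
  interpolation spaces. Each of the three terms is quasi-additive, so there are six pieces. Two of them
  are parts of the norms, two are the point evaluations \<open>chi_tail_mult_le_norm0\<close> and
  \<open>chi_mixed_mult_le_norm1\<close>, and the remaining two are \<open>head_part_le_norm1\<close> and \<open>tail_part_le_norm0\<close>.
\<close>

lemma parts_le_norms:
  assumes c: "c < top"
  obtains C where "C < top"
    "\<And>k k0 k1 t. quasi_concave k \<Longrightarrow> quasi_concave k0 \<Longrightarrow> quasi_concave k1 \<Longrightarrow> 0 < t \<Longrightarrow>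
       (\<And>u. 0 < u \<Longrightarrow> k u \<le> c * (k0 u + k1 u)) \<Longrightarrow>
       head_part k t + ratio t * tail_part k t + chi_tail t * k t \<le> C * (norm0 k0 + ratio t * norm1 k1)"
proof -
  obtain Cp where Cp: "Cp < top" "\<And>h g t. h \<in> borel_measurable haar \<Longrightarrow> g \<in> borel_measurable haar \<Longrightarrow>
      head_norm r0 (\<lambda>u. h u + g u) t \<le> Cp * (head_norm r0 h t + head_norm r0 g t)"
    using head_norm_add[OF r0] by blast
  obtain Cm where Cm: "Cm < top" "\<And>h g t s. h \<in> borel_measurable haar \<Longrightarrow> g \<in> borel_measurable haar \<Longrightarrow>
      mid_norm q1 (\<lambda>u. h u + g u) t s \<le> Cm * (mid_norm q1 h t s + mid_norm q1 g t s)"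
    using mid_norm_add[OF q1] by blast
  obtain Ct where Ct: "Ct < top" "\<And>h g t. h \<in> borel_measurable haar \<Longrightarrow> g \<in> borel_measurable haar \<Longrightarrow>
      tail_norm r1 (\<lambda>u. h u + g u) t \<le> Ct * (tail_norm r1 h t + tail_norm r1 g t)"
    using tail_norm_add[OF r1] by blast
  obtain C1 where C1: "C1 < top" "\<And>k t. quasi_concave k \<Longrightarrow> 0 < t \<Longrightarrow> head_part k t \<le> C1 * (ratio t * norm1 k)"
    using head_part_le_norm1 by blast
  obtain C2 where C2: "C2 < top" "\<And>k t. quasi_concave k \<Longrightarrow> 0 < t \<Longrightarrow> ratio t * tail_part k t \<le> C2 * norm0 k"
    using tail_part_le_norm0 by blast
  let ?C = "c * (Cp * (1 + C1)) + c * (Cm * (Ct * (C2 + 1))) + c * (1 + 2)"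
  show ?thesis
  proof (rule that[of ?C])
    show "?C < top"
      using c Cp(1) Cm(1) Ct(1) C1(1) C2(1) by (simp add: ennreal_mult_less_top)
    fix k k0 k1 t
    assume k: "quasi_concave k" and k0: "quasi_concave k0" and k1: "quasi_concave k1" and t: "0 < (t::real)"
      and le: "\<And>u. 0 < u \<Longrightarrow> k u \<le> c * (k0 u + k1 u)"
    let ?S = "norm0 k0 + ratio t * norm1 k1"
    note m = quasi_concave_measurable[OF k] quasi_concave_measurable[OF k0] quasi_concave_measurable[OF k1]
    note bm = borel_measurable_times_ennreal[OF b0_meas m(1)] borel_measurable_times_ennreal[OF b0_meas m(2)]
      borel_measurable_times_ennreal[OF b0_meas m(3)]
    note gm = slope_measurable[OF m(1)] slope_measurable[OF m(2)] slope_measurable[OF m(3)]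
    have S0: "norm0 k0 \<le> 1 * ?S" and S1: "ratio t * norm1 k1 \<le> 1 * ?S" by auto
    have "head_part k t \<le> head_norm r0 (\<lambda>u. c * (b0 u * k0 u + b0 u * k1 u)) t"
      unfolding head_part_def
    proof (intro head_norm_mono r0 bm)
      fix u :: real assume "0 < u"
      then have "b0 u * k u \<le> b0 u * (c * (k0 u + k1 u))" by (intro mult_left_mono le) auto
      then show "b0 u * k u \<le> c * (b0 u * k0 u + b0 u * k1 u)" by (simp add: distrib_left mult_ac)
    qed
    also have "\<dots> = c * head_norm r0 (\<lambda>u. b0 u * k0 u + b0 u * k1 u) t"
      by (intro head_norm_cmult r0 borel_measurable_add bm)
    also have "\<dots> \<le> c * (Cp * (head_part k0 t + head_part k1 t))"
      unfolding head_part_def by (intro mult_left_mono Cp(2) bm) auto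
    also have "\<dots> \<le> c * (Cp * (1 * ?S + C1 * ?S))"
    proof (intro mult_left_mono add_mono)
      show "head_part k0 t \<le> 1 * ?S"
        unfolding head_part_def using head_norm_le_Lq[OF r0 bm(2), of t] S0 by (simp add: norm0_def order_trans)
      show "head_part k1 t \<le> C1 * ?S"
        using C1(2)[OF k1 t] mult_left_mono[OF S1, of C1] by simp
    qed auto
    finally have 1: "head_part k t \<le> c * (Cp * (1 + C1)) * ?S"
      by (simp add: distrib_right distrib_left mult_ac add_ac)
    have mid: "mid_norm q1 (slope k) t s \<le> c * (Cm * (mid_norm q1 (slope k0) t s + mid_norm q1 (slope k1) t s))" for s
    proof -
      have "mid_norm q1 (slope k) t s \<le> mid_norm q1 (\<lambda>u. c * (slope k0 u + slope k1 u)) t s"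
      proof (intro mid_norm_mono q1 gm)
        fix u :: real assume "0 < u"
        then have "ennreal (1 / u) * (a1 u * k u) \<le> ennreal (1 / u) * (a1 u * (c * (k0 u + k1 u)))"
          by (intro mult_left_mono le) auto
        then show "slope k u \<le> c * (slope k0 u + slope k1 u)"
          by (simp add: slope_def distrib_left mult_ac)
      qed
      also have "\<dots> = c * mid_norm q1 (\<lambda>u. slope k0 u + slope k1 u) t s"
        by (intro mid_norm_cmult q1 borel_measurable_add gm)
      also have "\<dots> \<le> c * (Cm * (mid_norm q1 (slope k0) t s + mid_norm q1 (slope k1) t s))"
        by (intro mult_left_mono Cm(2) gm) auto
      finally show ?thesis .
    qed
    note mm = borel_measurable_times_ennreal[OF b1_meas mid_norm_measurable[OF q1 gm(1)]]
      borel_measurable_times_ennreal[OF b1_meas mid_norm_measurable[OF q1 gm(2)]]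
      borel_measurable_times_ennreal[OF b1_meas mid_norm_measurable[OF q1 gm(3)]]
    have Q1: "tail_part k1 t \<le> norm1 k1"
    proof -
      have "tail_part k1 t \<le> tail_norm r1 (\<lambda>s. b1 s * head_norm q1 (slope k1) s) t"
        unfolding tail_part_def by (intro tail_norm_mono r1 mm mult_left_mono mid_norm_le_head_norm q1 gm) auto
      also have "\<dots> \<le> norm1 k1"
        unfolding norm1_def
        by (intro tail_norm_le_Lq r1 borel_measurable_times_ennreal b1_meas head_norm_measurable q1 gm)
      finally show ?thesis .
    qed
    have "tail_part k t \<le> tail_norm r1 (\<lambda>s. (c * Cm) * (b1 s * mid_norm q1 (slope k0) t s + b1 s * mid_norm q1 (slope k1) t s)) t"
      unfolding tail_part_def
    proof (intro tail_norm_mono r1 mm)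
      fix s
      have "b1 s * mid_norm q1 (slope k) t s \<le> b1 s * (c * (Cm * (mid_norm q1 (slope k0) t s + mid_norm q1 (slope k1) t s)))"
        by (intro mult_left_mono mid) auto
      then show "b1 s * mid_norm q1 (slope k) t s \<le> (c * Cm) * (b1 s * mid_norm q1 (slope k0) t s + b1 s * mid_norm q1 (slope k1) t s)"
        by (simp add: distrib_left mult_ac)
    qed
    also have "\<dots> = (c * Cm) * tail_norm r1 (\<lambda>s. b1 s * mid_norm q1 (slope k0) t s + b1 s * mid_norm q1 (slope k1) t s) t"
      by (intro tail_norm_cmult r1 borel_measurable_add mm)
    also have "\<dots> \<le> (c * Cm) * (Ct * (tail_part k0 t + tail_part k1 t))"
      unfolding tail_part_def by (intro mult_left_mono Ct(2) mm) auto
    finally have "ratio t * tail_part k t \<le> ratio t * ((c * Cm) * (Ct * (tail_part k0 t + tail_part k1 t)))"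
      by (rule mult_left_mono) auto
    also have "\<dots> = c * (Cm * (Ct * (ratio t * tail_part k0 t + ratio t * tail_part k1 t)))"
      by (simp add: distrib_left mult_ac)
    also have "\<dots> \<le> c * (Cm * (Ct * (C2 * ?S + 1 * ?S)))"
    proof (intro mult_left_mono add_mono)
      show "ratio t * tail_part k0 t \<le> C2 * ?S"
        using C2(2)[OF k0 t] mult_left_mono[OF S0, of C2] by simp
      show "ratio t * tail_part k1 t \<le> 1 * ?S"
        using mult_left_mono[OF Q1, of "ratio t"] S1 by (rule order_trans) simp
    qed auto
    finally have 2: "ratio t * tail_part k t \<le> c * (Cm * (Ct * (C2 + 1))) * ?S"
      by (simp add: distrib_right distrib_left mult_ac add_ac)
    have "chi_mixed t * (chi_tail t * k1 t) \<le> chi_mixed t * (2 * (ratio t * norm1 k1))"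
    proof -
      have "chi_tail t * (chi_mixed t * k1 t) \<le> chi_tail t * (2 * ennreal t * norm1 k1)"
        by (intro mult_left_mono chi_mixed_mult_le_norm1 k1 t) auto
      also have "\<dots> = 2 * (ennreal t * chi_tail t) * norm1 k1" by (simp add: mult_ac)
      also have "\<dots> = 2 * (ratio t * chi_mixed t) * norm1 k1" by (simp only: ratio_mult_chi_mixed[OF t])
      finally show ?thesis by (simp add: mult_ac)
    qed
    then have "chi_tail t * k1 t \<le> 2 * (ratio t * norm1 k1)"
      using chi_mixed_bounds[OF t] by (simp add: ennreal_mult_le_mult_iff)
    also have "\<dots> \<le> 2 * ?S" using mult_left_mono[OF S1, of 2] by simp
    finally have S2: "chi_tail t * k1 t \<le> 2 * ?S" .
    have "chi_tail t * k t \<le> chi_tail t * (c * (k0 t + k1 t))"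
      by (intro mult_left_mono le t) auto
    also have "\<dots> = c * (chi_tail t * k0 t + chi_tail t * k1 t)" by (simp add: distrib_left mult_ac)
    also have "\<dots> \<le> c * (1 * ?S + 2 * ?S)"
      by (intro mult_left_mono add_mono order_trans[OF chi_tail_mult_le_norm0[OF k0 t] S0] S2) auto
    finally have 3: "chi_tail t * k t \<le> c * (1 + 2) * ?S"
      by (simp only: distrib_right mult.assoc)
    show "head_part k t + ratio t * tail_part k t + chi_tail t * k t \<le> ?C * ?S"
      unfolding distrib_right[of _ _ ?S] by (intro add_mono 1 2 3)
  qed
qed

text \<open>
  This is the upper bound: \<open>f = f\<^sub>0 + f\<^sub>1\<close> is now a decomposition with \<open>\<parallel>f\<^sub>0\<parallel> + t \<parallel>f\<^sub>1\<parallel> \<le> \<kappa>\<close> in the original couple.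
  Where \<open>k0\<close> is bounded well by \<open>\<kappa>\<close> (above \<open>t\<close>), the norm sees only \<open>\<chi>\<^sub>0 t \<kappa>\<close>; below \<open>t\<close> one passes to
  \<open>k + k1\<close> and uses \<open>k1 u \<le> \<kappa> u/t\<close>. For \<open>k1\<close> the two sides of \<open>t\<close> exchange their parts, in the inner and in
  the outer norm. A variable \<open>\<kappa>\<close> in place of \<open>k t\<close> allows for near-optimal decompositions also when
  \<open>k t = 0\<close>.
\<close>

lemma norms_le_parts:
  assumes c: "c < top"
  obtains C where "C < top"
    "\<And>k k0 k1 t \<kappa>. quasi_concave k \<Longrightarrow> quasi_concave k0 \<Longrightarrow> quasi_concave k1 \<Longrightarrow> 0 < t \<Longrightarrow>
       (\<And>u. 0 < u \<Longrightarrow> k0 u \<le> c * (k u + k1 u)) \<Longrightarrow> (\<And>u. 0 < u \<Longrightarrow> k1 u \<le> c * (k u + k0 u)) \<Longrightarrow>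
       (\<And>u. 0 < u \<Longrightarrow> k0 u \<le> \<kappa>) \<Longrightarrow> (\<And>u. 0 < u \<Longrightarrow> k1 u \<le> ennreal (u / t) * \<kappa>) \<Longrightarrow>
       norm0 k0 + ratio t * norm1 k1 \<le> C * (head_part k t + ratio t * tail_part k t + chi_tail t * \<kappa>)"
proof -
  obtain Cs where Cs: "Cs < top" "\<And>h t. h \<in> borel_measurable haar \<Longrightarrow>
      Lq r0 haar h \<le> Cs * (head_norm r0 h t + tail_norm r0 h t)"
    using Lq_haar_split[OF r0] by blast
  obtain Cp where Cp: "Cp < top" "\<And>h g t. h \<in> borel_measurable haar \<Longrightarrow> g \<in> borel_measurable haar \<Longrightarrow>
      head_norm r0 (\<lambda>u. h u + g u) t \<le> Cp * (head_norm r0 h t + head_norm r0 g t)"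
    using head_norm_add[OF r0] by blast
  obtain Cr where Cr: "Cr < top" "\<And>h t. h \<in> borel_measurable haar \<Longrightarrow>
      Lq r1 haar h \<le> Cr * (head_norm r1 h t + tail_norm r1 h t)"
    using Lq_haar_split[OF r1] by blast
  obtain Ch where Ch: "Ch < top" "\<And>h t s. h \<in> borel_measurable haar \<Longrightarrow> t \<le> s \<Longrightarrow>
      head_norm q1 h s \<le> Ch * (head_norm q1 h t + mid_norm q1 h t s)"
    using head_norm_split[OF q1] by blast
  obtain Cm where Cm: "Cm < top" "\<And>h g t s. h \<in> borel_measurable haar \<Longrightarrow> g \<in> borel_measurable haar \<Longrightarrow>
      mid_norm q1 (\<lambda>u. h u + g u) t s \<le> Cm * (mid_norm q1 h t s + mid_norm q1 g t s)"
    using mid_norm_add[OF q1] by blast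
  obtain Ct where Ct: "Ct < top" "\<And>h g t. h \<in> borel_measurable haar \<Longrightarrow> g \<in> borel_measurable haar \<Longrightarrow>
      tail_norm r1 (\<lambda>u. h u + g u) t \<le> Ct * (tail_norm r1 h t + tail_norm r1 g t)"
    using tail_norm_add[OF r1] by blast
  let ?D = "(M0 * head_const r0) * (M0 / tail_const r0)"
  let ?Da = "(Ma * tail_const q1) * (Ma / head_const q1)"
  let ?E = "Ch * (1 + Cm * (c + c * ?Da))"
  let ?C0 = "Cs * (Cp * (c + c * ?D) + 1)"
  let ?C1 = "Cr * (1 + ?E * (Ct * (1 + 1)))"
  show ?thesis
  proof (rule that[of "?C0 + ?C1"])
    show "?C0 + ?C1 < top"
      using c Cs(1) Cp(1) Cr(1) Ch(1) Cm(1) Ct(1) weight_const_finite[OF b0 r0] weight_const_finite[OF a1 q1]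
      by (simp add: ennreal_mult_less_top)
    fix k k0 k1 t \<kappa>
    assume k: "quasi_concave k" and k0: "quasi_concave k0" and k1: "quasi_concave k1" and t: "0 < (t::real)"
      and le0: "\<And>u. 0 < u \<Longrightarrow> k0 u \<le> c * (k u + k1 u)" and le1: "\<And>u. 0 < u \<Longrightarrow> k1 u \<le> c * (k u + k0 u)"
      and \<kappa>0: "\<And>u. 0 < u \<Longrightarrow> k0 u \<le> \<kappa>" and \<kappa>1: "\<And>u. 0 < u \<Longrightarrow> k1 u \<le> ennreal (u / t) * \<kappa>"
    let ?S = "head_part k t + ratio t * tail_part k t + chi_tail t * \<kappa>"
    note m = quasi_concave_measurable[OF k] quasi_concave_measurable[OF k0] quasi_concave_measurable[OF k1]
    note bm = borel_measurable_times_ennreal[OF b0_meas m(1)] borel_measurable_times_ennreal[OF b0_meas m(2)]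
    note gm = slope_measurable[OF m(1)] slope_measurable[OF m(2)] slope_measurable[OF m(3)] 
    have SP: "head_part k t \<le> 1 * ?S" and SQ: "ratio t * tail_part k t \<le> 1 * ?S" and SX: "chi_tail t * \<kappa> \<le> 1 * ?S"
      by (auto simp: add.assoc add_increasing add_increasing2)
    have m2: "(\<lambda>u. ennreal (u powr (1/2)) * b0 u) \<in> borel_measurable haar"
      by (intro borel_measurable_times_ennreal powr_measurable_haar) auto

    have h0: "ennreal (t powr (-1/2)) * head_norm r0 (\<lambda>u. ennreal (u powr (1/2)) * b0 u) t \<le> ?D * chi_tail t"
    proof -
      have "ennreal (t powr (-1/2)) * head_norm r0 (\<lambda>u. ennreal (u powr (1/2)) * b0 u) t
         \<le> ennreal (t powr (-1/2)) * (M0 * head_const r0 * ennreal (t powr (1/2)) * b0 t)"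
        by (intro mult_left_mono head_norm_power_weight_le[OF b0 r0 t]) auto
      also have "\<dots> \<le> ennreal (t powr (-1/2)) * (M0 * head_const r0 * ennreal (t powr (1/2)) * (M0 / tail_const r0 * chi_tail t))"
        unfolding chi_tail_def by (intro mult_left_mono weight_le_tail_norm[OF b0 r0 t]) auto
      also have "\<dots> = (ennreal (t powr (-1/2)) * ennreal (t powr (1/2))) * (?D * chi_tail t)"
        by (simp only: mult_ac)
      also have "ennreal (t powr (-1/2)) * ennreal (t powr (1/2)) = 1"
        unfolding ennreal_mult[symmetric, OF powr_ge_zero powr_ge_zero] using t by (simp add: powr_add[symmetric])
      finally show ?thesis by simp
    qed
    have "head_part k0 t \<le> head_norm r0 (\<lambda>u. c * (b0 u * k u) + (c * (\<kappa> * ennreal (t powr (-1/2)))) * (ennreal (u powr (1/2)) * b0 u)) t"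
      unfolding head_part_def
    proof (intro head_norm_mono r0 bm)
      fix u :: real assume u: "0 < u" "u < t"
      \<comment> \<open>\<open>u / t \<le> 1\<close>, so lowering the exponent to the one handled for weights loses nothing.\<close>
      have "u / t \<le> (u / t) powr (1/2)"
        using powr_mono'[of "1/2" 1 "u / t"] u t by simp
      also have "\<dots> = t powr (-1/2) * u powr (1/2)"
        using u t by (simp add: powr_divide powr_minus_divide)
      finally have "ennreal (u / t) \<le> ennreal (t powr (-1/2)) * ennreal (u powr (1/2))"
        by (simp add: ennreal_mult[symmetric] ennreal_leI)
      then have "k1 u \<le> (ennreal (t powr (-1/2)) * ennreal (u powr (1/2))) * \<kappa>"
        using \<kappa>1[OF u(1)] by (meson mult_right_mono order_trans zero_le)
      then have "b0 u * k0 u \<le> b0 u * (c * (k u + (ennreal (t powr (-1/2)) * ennreal (u powr (1/2))) * \<kappa>))"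
        using le0[OF u(1)] by (meson add_left_mono mult_left_mono order_trans zero_le)
      then show "b0 u * k0 u \<le> c * (b0 u * k u) + (c * (\<kappa> * ennreal (t powr (-1/2)))) * (ennreal (u powr (1/2)) * b0 u)"
        by (simp add: distrib_left mult_ac)
    qed
    also have "\<dots> \<le> Cp * (c * head_part k t + (c * (\<kappa> * ennreal (t powr (-1/2)))) * head_norm r0 (\<lambda>u. ennreal (u powr (1/2)) * b0 u) t)"
      unfolding head_part_def head_norm_cmult[OF r0 bm(1), symmetric] head_norm_cmult[OF r0 m2, symmetric]
      by (intro Cp(2) borel_measurable_times_ennreal[OF _ bm(1)] borel_measurable_times_ennreal[OF _ m2]) auto
    also have "\<dots> \<le> Cp * (c * ?S + (c * ?D) * ?S)"
    proof (intro mult_left_mono add_mono)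
      show "head_part k t \<le> ?S" using SP by simp
      have "(c * (\<kappa> * ennreal (t powr (-1/2)))) * head_norm r0 (\<lambda>u. ennreal (u powr (1/2)) * b0 u) t
        = (c * \<kappa>) * (ennreal (t powr (-1/2)) * head_norm r0 (\<lambda>u. ennreal (u powr (1/2)) * b0 u) t)"
        by (simp only: mult_ac)
      also have "\<dots> \<le> (c * \<kappa>) * (?D * chi_tail t)"
        by (intro mult_left_mono h0) auto
      also have "\<dots> = (c * ?D) * (chi_tail t * \<kappa>)" by (simp only: mult_ac)
      also have "\<dots> \<le> (c * ?D) * ?S" using SX by (intro mult_left_mono) auto
      finally show "(c * (\<kappa> * ennreal (t powr (-1/2)))) * head_norm r0 (\<lambda>u. ennreal (u powr (1/2)) * b0 u) t \<le> (c * ?D) * ?S" .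
    qed auto
    finally have 1: "head_part k0 t \<le> Cp * (c + c * ?D) * ?S"
      by (simp only: distrib_right mult.assoc)
    have "tail_norm r0 (\<lambda>u. b0 u * k0 u) t \<le> tail_norm r0 (\<lambda>u. \<kappa> * b0 u) t"
      by (intro tail_norm_mono r0 bm) (auto simp: mult.commute[of _ "b0 _"] intro!: mult_left_mono \<kappa>0)
    also have "\<dots> = chi_tail t * \<kappa>"
      unfolding chi_tail_def by (subst tail_norm_cmult) (auto simp: r0 mult.commute)
    finally have 2: "tail_norm r0 (\<lambda>u. b0 u * k0 u) t \<le> 1 * ?S"
      using SX by (rule order_trans)
    have "norm0 k0 \<le> Cs * (head_part k0 t + tail_norm r0 (\<lambda>u. b0 u * k0 u) t)"
      unfolding norm0_def head_part_def by (intro Cs(2) bm)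
    also have "\<dots> \<le> Cs * (Cp * (c + c * ?D) * ?S + 1 * ?S)"
      by (intro mult_left_mono add_mono 1 2) auto
    finally have bound0: "norm0 k0 \<le> ?C0 * ?S"
      by (simp only: distrib_right mult.assoc)

    let ?\<kappa> = "\<kappa> * ennreal (1 / t)"
    have hG: "head_norm q1 (slope k1) s \<le> ?\<kappa> * head_norm q1 a1 s" for s
    proof -
      have "head_norm q1 (slope k1) s \<le> head_norm q1 (\<lambda>u. ?\<kappa> * a1 u) s"
      proof (intro head_norm_mono q1 gm)
        fix u :: real assume u: "0 < u"
        have "ennreal (1 / u) * (a1 u * k1 u) \<le> ennreal (1 / u) * (a1 u * (ennreal (u / t) * \<kappa>))"
          by (intro mult_left_mono \<kappa>1 u) auto
        also have "\<dots> = (ennreal (1 / u) * ennreal (u / t)) * \<kappa> * a1 u"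
          by (simp only: mult_ac)
        also have "ennreal (1 / u) * ennreal (u / t) = ennreal (1 / t)"
          using u t by (simp add: ennreal_mult[symmetric])
        finally show "slope k1 u \<le> ?\<kappa> * a1 u"
          by (simp add: slope_def mult_ac)
      qed
      then show ?thesis by (simp only: head_norm_cmult[OF q1 a1_meas])
    qed
    have m1: "(\<lambda>u. ennreal (u powr (-1/2)) * a1 u) \<in> borel_measurable haar"
      by (intro borel_measurable_times_ennreal powr_measurable_haar) auto
    have midA: "mid_norm q1 (\<lambda>u. ennreal (1 / u) * a1 u) t s \<le> ?Da * (ennreal (1 / t) * head_norm q1 a1 t)" for s
    proof -
      have "mid_norm q1 (\<lambda>u. ennreal (1 / u) * a1 u) t s
          \<le> mid_norm q1 (\<lambda>u. ennreal (t powr (-1/2)) * (ennreal (u powr (-1/2)) * a1 u)) t s"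
      proof (intro mid_norm_mono q1)
        show "(\<lambda>u. ennreal (1 / u) * a1 u) \<in> borel_measurable haar"
          by (intro borel_measurable_times_ennreal a1_meas, rule borel_measurable_haar) measurable
        fix u :: real assume u: "0 < u" "t < u"
        have "1 / u = u powr (-1/2) * u powr (-1/2)"
          using u by (simp add: powr_add[symmetric] powr_minus_divide)
        also have "\<dots> \<le> t powr (-1/2) * u powr (-1/2)"
          using u t by (intro mult_right_mono powr_mono2') auto
        finally have "ennreal (1 / u) \<le> ennreal (t powr (-1/2)) * ennreal (u powr (-1/2))"
          by (simp add: ennreal_mult[symmetric] ennreal_leI)
        then show "ennreal (1 / u) * a1 u \<le> ennreal (t powr (-1/2)) * (ennreal (u powr (-1/2)) * a1 u)"
          unfolding mult.assoc[symmetric] by (rule mult_right_mono) auto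
      qed
      also have "\<dots> = ennreal (t powr (-1/2)) * mid_norm q1 (\<lambda>u. ennreal (u powr (-1/2)) * a1 u) t s"
        by (intro mid_norm_cmult q1 m1)
      also have "\<dots> \<le> ennreal (t powr (-1/2)) * tail_norm q1 (\<lambda>u. ennreal (u powr (-1/2)) * a1 u) t"
        by (intro mult_left_mono mid_norm_le_tail_norm q1 m1) auto
      also have "\<dots> \<le> ennreal (t powr (-1/2)) * (Ma * tail_const q1 * ennreal (t powr (-1/2)) * a1 t)"
        by (intro mult_left_mono tail_norm_power_weight_le[OF a1 q1 t]) auto
      also have "\<dots> \<le> ennreal (t powr (-1/2)) * (Ma * tail_const q1 * ennreal (t powr (-1/2)) * (Ma / head_const q1 * head_norm q1 a1 t))"
        by (intro mult_left_mono weight_le_head_norm[OF a1 q1 t]) auto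
      also have "\<dots> = ?Da * ((ennreal (t powr (-1/2)) * ennreal (t powr (-1/2))) * head_norm q1 a1 t)"
        by (simp only: mult_ac)
      also have "ennreal (t powr (-1/2)) * ennreal (t powr (-1/2)) = ennreal (1 / t)"
        using t unfolding ennreal_mult[symmetric, OF powr_ge_zero powr_ge_zero]
        by (simp add: powr_add[symmetric] powr_minus_divide)
      finally show ?thesis .
    qed
    have am: "(\<lambda>u. ennreal (1 / u) * a1 u) \<in> borel_measurable haar"
      by (intro borel_measurable_times_ennreal a1_meas, rule borel_measurable_haar) measurable
    let ?T = "\<lambda>s. ?\<kappa> * head_norm q1 a1 t + mid_norm q1 (slope k) t s"
    have mid: "mid_norm q1 (slope k1) t s \<le> Cm * (c + c * ?Da) * ?T s" for s
    proof -
      have "mid_norm q1 (slope k1) t s \<le> mid_norm q1 (\<lambda>u. c * slope k u + (c * \<kappa>) * (ennreal (1 / u) * a1 u)) t s"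
      proof (intro mid_norm_mono q1 gm)
        fix u :: real assume u: "0 < u"
        have "ennreal (1 / u) * (a1 u * k1 u) \<le> ennreal (1 / u) * (a1 u * (c * (k u + k0 u)))"
          by (intro mult_left_mono le1 u) auto
        also have "\<dots> \<le> ennreal (1 / u) * (a1 u * (c * (k u + \<kappa>)))"
          by (intro mult_left_mono add_left_mono \<kappa>0 u) auto
        finally show "slope k1 u \<le> c * slope k u + (c * \<kappa>) * (ennreal (1 / u) * a1 u)"
          by (simp add: slope_def distrib_left mult_ac)
      qed
      also have "\<dots> \<le> Cm * (c * mid_norm q1 (slope k) t s + (c * \<kappa>) * mid_norm q1 (\<lambda>u. ennreal (1 / u) * a1 u) t s)"
        unfolding mid_norm_cmult[OF q1 gm(1), symmetric] mid_norm_cmult[OF q1 am, symmetric]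
        by (intro Cm(2) borel_measurable_times_ennreal[OF _ gm(1)] borel_measurable_times_ennreal[OF _ am]) auto
      also have "\<dots> \<le> Cm * (c * ?T s + (c * ?Da) * ?T s)"
      proof (intro mult_left_mono add_mono)
        have "(c * \<kappa>) * mid_norm q1 (\<lambda>u. ennreal (1 / u) * a1 u) t s \<le> (c * \<kappa>) * (?Da * (ennreal (1 / t) * head_norm q1 a1 t))"
          by (intro mult_left_mono midA) auto
        also have "\<dots> = (c * ?Da) * (?\<kappa> * head_norm q1 a1 t)"
          by (simp only: mult_ac)
        also have "\<dots> \<le> (c * ?Da) * ?T s"
          by (intro mult_left_mono) auto
        finally show "(c * \<kappa>) * mid_norm q1 (\<lambda>u. ennreal (1 / u) * a1 u) t s \<le> (c * ?Da) * ?T s" .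
      qed auto
      finally show ?thesis by (simp only: distrib_right mult.assoc)
    qed
    have hGs: "head_norm q1 (slope k1) s \<le> ?E * ?T s" if "t < s" for s
    proof -
      have "head_norm q1 (slope k1) s \<le> Ch * (head_norm q1 (slope k1) t + mid_norm q1 (slope k1) t s)"
        using that by (intro Ch(2) gm) auto
      also have "\<dots> \<le> Ch * (1 * ?T s + Cm * (c + c * ?Da) * ?T s)"
      proof (intro mult_left_mono add_mono mid)
        show "head_norm q1 (slope k1) t \<le> 1 * ?T s"
          using hG[of t] by (simp add: add_increasing2)
      qed auto
      finally show ?thesis by (simp only: distrib_right mult.assoc)
    qed
    have ratio\<kappa>: "ratio t * (?\<kappa> * chi_mixed t) = chi_tail t * \<kappa>"
    proof -
      have "ratio t * (?\<kappa> * chi_mixed t) = (ratio t * chi_mixed t) * ?\<kappa>" by (simp only: mult_ac)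
      also have "\<dots> = (ennreal t * ennreal (1 / t)) * (chi_tail t * \<kappa>)"
        unfolding ratio_mult_chi_mixed[OF t] by (simp only: mult_ac)
      also have "ennreal t * ennreal (1 / t) = 1"
        using t by (simp add: ennreal_mult[symmetric])
      finally show ?thesis by simp
    qed
    have hm: "(\<lambda>s. b1 s * head_norm q1 (slope k1) s) \<in> borel_measurable haar"
      by (intro borel_measurable_times_ennreal b1_meas head_norm_measurable q1 gm)
    have mm: "(\<lambda>s. b1 s * mid_norm q1 (slope k) t s) \<in> borel_measurable haar"
      by (intro borel_measurable_times_ennreal b1_meas mid_norm_measurable q1 gm)
    have "head_norm r1 (\<lambda>s. b1 s * head_norm q1 (slope k1) s) t \<le> head_norm r1 (\<lambda>s. ?\<kappa> * (b1 s * head_norm q1 a1 s)) t"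
    proof (intro head_norm_mono r1 hm)
      fix s
      have "b1 s * head_norm q1 (slope k1) s \<le> b1 s * (?\<kappa> * head_norm q1 a1 s)"
        by (intro mult_left_mono hG) auto
      then show "b1 s * head_norm q1 (slope k1) s \<le> ?\<kappa> * (b1 s * head_norm q1 a1 s)"
        by (simp only: mult_ac)
    qed
    also have "\<dots> \<le> ?\<kappa> * chi_mixed t"
      unfolding head_norm_cmult[OF r1 inner_meas] chi_mixed_def by (intro mult_left_mono) auto
    finally have "ratio t * head_norm r1 (\<lambda>s. b1 s * head_norm q1 (slope k1) s) t \<le> ratio t * (?\<kappa> * chi_mixed t)"
      by (rule mult_left_mono) auto
    then have 3: "ratio t * head_norm r1 (\<lambda>s. b1 s * head_norm q1 (slope k1) s) t \<le> 1 * ?S"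
      unfolding ratio\<kappa> using SX by (rule order_trans)
    have "tail_norm r1 (\<lambda>s. b1 s * head_norm q1 (slope k1) s) t
       \<le> tail_norm r1 (\<lambda>s. ?E * ((?\<kappa> * head_norm q1 a1 t) * b1 s + b1 s * mid_norm q1 (slope k) t s)) t"
    proof (intro tail_norm_mono r1 hm)
      fix s assume "t < s"
      then have "b1 s * head_norm q1 (slope k1) s \<le> b1 s * (?E * ?T s)"
        by (intro mult_left_mono hGs) auto
      also have "\<dots> = ?E * (b1 s * ?T s)" by (simp only: mult_ac)
      also have "b1 s * ?T s = (?\<kappa> * head_norm q1 a1 t) * b1 s + b1 s * mid_norm q1 (slope k) t s"
        by (simp only: distrib_left mult_ac)
      finally show "b1 s * head_norm q1 (slope k1) s \<le> ?E * ((?\<kappa> * head_norm q1 a1 t) * b1 s + b1 s * mid_norm q1 (slope k) t s)" .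
    qed
    also have "\<dots> = ?E * tail_norm r1 (\<lambda>s. (?\<kappa> * head_norm q1 a1 t) * b1 s + b1 s * mid_norm q1 (slope k) t s) t"
      by (intro tail_norm_cmult r1 borel_measurable_add mm borel_measurable_times_ennreal[OF _ b1_meas]) auto
    also have "\<dots> \<le> ?E * (Ct * ((?\<kappa> * head_norm q1 a1 t) * tail_norm r1 b1 t + tail_part k t))"
      unfolding tail_part_def tail_norm_cmult[OF r1 b1_meas, symmetric]
      by (intro mult_left_mono Ct(2) mm borel_measurable_times_ennreal[OF _ b1_meas]) auto
    also have "\<dots> \<le> ?E * (Ct * (?\<kappa> * chi_mixed t + tail_part k t))"
      unfolding chi_mixed_def by (intro mult_left_mono add_right_mono) (auto simp: distrib_left mult_ac)
    finally have "ratio t * tail_norm r1 (\<lambda>s. b1 s * head_norm q1 (slope k1) s) t \<le> ratio t * (?E * (Ct * (?\<kappa> * chi_mixed t + tail_part k t)))"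
      by (rule mult_left_mono) auto
    also have "\<dots> = ?E * (Ct * (ratio t * (?\<kappa> * chi_mixed t + tail_part k t)))" by (simp only: mult_ac)
    also have "ratio t * (?\<kappa> * chi_mixed t + tail_part k t) = chi_tail t * \<kappa> + ratio t * tail_part k t"
      unfolding distrib_left[of "ratio t"] ratio\<kappa> ..
    also have "?E * (Ct * (chi_tail t * \<kappa> + ratio t * tail_part k t)) \<le> ?E * (Ct * (1 * ?S + 1 * ?S))"
      by (intro mult_left_mono add_mono SX SQ) auto
    finally have 4: "ratio t * tail_norm r1 (\<lambda>s. b1 s * head_norm q1 (slope k1) s) t \<le> ?E * (Ct * (1 + 1)) * ?S"
      by (simp only: distrib_right mult.assoc)
    have "ratio t * norm1 k1 \<le> ratio t * (Cr * (head_norm r1 (\<lambda>s. b1 s * head_norm q1 (slope k1) s) t + tail_norm r1 (\<lambda>s. b1 s * head_norm q1 (slope k1) s) t))"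
      unfolding norm1_def by (intro mult_left_mono Cr(2) hm) auto
    also have "\<dots> = Cr * (ratio t * head_norm r1 (\<lambda>s. b1 s * head_norm q1 (slope k1) s) t + ratio t * tail_norm r1 (\<lambda>s. b1 s * head_norm q1 (slope k1) s) t)"
      by (simp only: distrib_left mult_ac)
    also have "\<dots> \<le> Cr * (1 * ?S + ?E * (Ct * (1 + 1)) * ?S)"
      by (intro mult_left_mono add_mono 3 4) auto
    finally have bound1: "ratio t * norm1 k1 \<le> ?C1 * ?S"
      by (simp only: distrib_right mult.assoc)
    show "norm0 k0 + ratio t * norm1 k1 \<le> (?C0 + ?C1) * ?S"
      unfolding distrib_right[of ?C0] by (intro add_mono bound0 bound1)
  qed
qed

end

section \<open>Translating the norms\<close>

lemma Lq_norm_eq_haar: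
  assumes "0 < q" "I \<in> sets borel" "I \<subseteq> {0<..}" "g \<in> borel_measurable haar"
    and "\<And>u. u \<in> I \<Longrightarrow> h u = ennreal (u powr (- rcp q)) * g u"
  shows "Lq_norm q I h = Lq q haar (\<lambda>u. indicator I u * g u)"
proof -
  have "Lq_norm q I h = Lq_norm q I (\<lambda>u. ennreal (u powr (- rcp q)) * g u)"
    using Lq_cong[of "lebesgue_on I" h "\<lambda>u. ennreal (u powr (- rcp q)) * g u" q] assms(5)
    by (simp add: Lq_def Lq_norm_def space_restrict_space)
  also have "\<dots> = Lq q haar (\<lambda>u. indicator I u * g u)"
    using assms by (intro Lq_norm_eq_Lq_haar cutoff_measurable) auto
  finally show ?thesis .
qed

lemma Lq_norm_eq_head_norm:
  assumes "0 < q" "g \<in> borel_measurable haar"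
    and "\<And>u. 0 < u \<Longrightarrow> u < t \<Longrightarrow> h u = ennreal (u powr (- rcp q)) * g u"
  shows "Lq_norm q {0<..<t} h = head_norm q g t"
  unfolding head_norm_def using assms by (intro Lq_norm_eq_haar) auto

lemma Lq_norm_eq_tail_norm:
  assumes "0 < q" "g \<in> borel_measurable haar" "0 < t"
    and "\<And>u. 0 < u \<Longrightarrow> t < u \<Longrightarrow> h u = ennreal (u powr (- rcp q)) * g u"
  shows "Lq_norm q {t<..} h = tail_norm q g t"
  unfolding tail_norm_def using assms by (intro Lq_norm_eq_haar) auto

lemma Lq_norm_eq_mid_norm:
  assumes "0 < q" "g \<in> borel_measurable haar" "0 < t"
    and "\<And>u. 0 < u \<Longrightarrow> t < u \<Longrightarrow> u < s \<Longrightarrow> h u = ennreal (u powr (- rcp q)) * g u"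
  shows "Lq_norm q {t<..<s} h = mid_norm q g t s"
  unfolding mid_norm_def using assms by (intro Lq_norm_eq_haar) auto

lemma Lq_norm_eq_full_norm:
  assumes "0 < q" "g \<in> borel_measurable haar"
    and "\<And>u. 0 < u \<Longrightarrow> h u = ennreal (u powr (- rcp q)) * g u"
  shows "Lq_norm q {0<..} h = Lq q haar g"
proof -
  have "Lq_norm q {0<..} h = Lq q haar (\<lambda>u. indicator {0<..} u * g u)"
    using assms by (intro Lq_norm_eq_haar) auto
  also have "\<dots> = Lq q haar g"
    by (rule Lq_cong) simp
  finally show ?thesis .
qed

section \<open>The \<open>K\<close>-functional\<close>

text \<open>
  The facts about the infimum are stated for nonnegative functionals, because they are applied to the
  original couple and also to the couple of interpolation spaces.
\<close>

definition nonneg_norm :: "'v qspace \<Rightarrow> bool" where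
  "nonneg_norm X \<longleftrightarrow> (\<forall>x\<in>qcarrier X. 0 \<le> qnorm X x)"

lemma K_fun_le:
  assumes "nonneg_norm Y0" "nonneg_norm Y1" "0 \<le> u" "f0 \<in> qcarrier Y0" "f1 \<in> qcarrier Y1"
  shows "K_fun Y0 Y1 u (f0 + f1) \<le> qnorm Y0 f0 + u * qnorm Y1 f1"
  unfolding K_fun_def
proof (rule cInf_lower)
  show "bdd_below {qnorm Y0 g0 + u * qnorm Y1 g1 |g0 g1. g0 \<in> qcarrier Y0 \<and> g1 \<in> qcarrier Y1 \<and> f0 + f1 = g0 + g1}"
    using assms(1-3) by (intro bdd_belowI[of _ 0]) (auto simp: nonneg_norm_def)
qed (use assms in blast)

lemma K_fun_greatest:
  assumes "f \<in> sum_set Y0 Y1"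
    and "\<And>f0 f1. f0 \<in> qcarrier Y0 \<Longrightarrow> f1 \<in> qcarrier Y1 \<Longrightarrow> f = f0 + f1 \<Longrightarrow> c \<le> qnorm Y0 f0 + u * qnorm Y1 f1"
  shows "c \<le> K_fun Y0 Y1 u f"
  unfolding K_fun_def using assms by (intro cInf_greatest) (auto simp: sum_set_def)

lemma K_fun_less_decomp:
  assumes "f \<in> sum_set Y0 Y1" "K_fun Y0 Y1 u f < \<kappa>"
  obtains f0 f1 where "f0 \<in> qcarrier Y0" "f1 \<in> qcarrier Y1" "f = f0 + f1"
    "qnorm Y0 f0 + u * qnorm Y1 f1 < \<kappa>"
proof -
  have "\<exists>x\<in>{qnorm Y0 f0 + u * qnorm Y1 f1 |f0 f1. f0 \<in> qcarrier Y0 \<and> f1 \<in> qcarrier Y1 \<and> f = f0 + f1}. x < \<kappa>"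
    using assms unfolding K_fun_def by (intro cInf_lessD) (auto simp: sum_set_def)
  then show ?thesis using that by blast
qed

lemma K_fun_nonneg:
  assumes "nonneg_norm Y0" "nonneg_norm Y1" "0 \<le> u" "f \<in> sum_set Y0 Y1"
  shows "0 \<le> K_fun Y0 Y1 u f"
  using assms by (intro K_fun_greatest) (auto simp: nonneg_norm_def)

lemma quasi_normed_nonneg: "quasi_normed Y \<Longrightarrow> nonneg_norm Y"
  unfolding quasi_normed_def nonneg_norm_def by blast

lemma quasi_normed_0: "quasi_normed Y \<Longrightarrow> 0 \<in> qcarrier Y \<and> qnorm Y 0 = 0"
proof -
  assume Y: "quasi_normed Y"
  then have "0 \<in> qcarrier Y"
    unfolding quasi_normed_def by (simp add: subspace_0)
  moreover from this have "qnorm Y 0 = 0 \<longleftrightarrow> (0::'a) = 0"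
    using Y unfolding quasi_normed_def by blast
  ultimately show ?thesis by simp
qed

lemma quasi_normed_minus:
  assumes "quasi_normed Y" "x \<in> qcarrier Y" shows "- x \<in> qcarrier Y" "qnorm Y (- x) = qnorm Y x"
proof -
  show "- x \<in> qcarrier Y" using assms by (auto simp: quasi_normed_def subspace_neg)
  have "qnorm Y ((-1) *\<^sub>R x) = \<bar>-1\<bar> * qnorm Y x"
    using assms unfolding quasi_normed_def by blast
  then show "qnorm Y (- x) = qnorm Y x" by simp
qed

lemma quasi_normed_add: "quasi_normed Y \<Longrightarrow> x \<in> qcarrier Y \<Longrightarrow> y \<in> qcarrier Y \<Longrightarrow> x + y \<in> qcarrier Y"
  by (auto simp: quasi_normed_def subspace_add)

lemma quasi_normed_triangle:
  assumes "quasi_normed Y"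
  obtains C where "1 \<le> C" "\<And>x y D. x \<in> qcarrier Y \<Longrightarrow> y \<in> qcarrier Y \<Longrightarrow> C \<le> D \<Longrightarrow>
    qnorm Y (x + y) \<le> D * (qnorm Y x + qnorm Y y)"
proof -
  have "\<exists>C. \<forall>x\<in>qcarrier Y. \<forall>y\<in>qcarrier Y. qnorm Y (x + y) \<le> C * (qnorm Y x + qnorm Y y)"
    using assms unfolding quasi_normed_def by (elim conjE)
  then obtain C where C: "\<forall>x\<in>qcarrier Y. \<forall>y\<in>qcarrier Y. qnorm Y (x + y) \<le> C * (qnorm Y x + qnorm Y y)"
    by blast
  show ?thesis
  proof (rule that[of "max C 1"])
    fix x y D assume xy: "x \<in> qcarrier Y" "y \<in> qcarrier Y" and D: "max C 1 \<le> D"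
    have "qnorm Y (x + y) \<le> C * (qnorm Y x + qnorm Y y)" using C xy by blast
    also have "\<dots> \<le> D * (qnorm Y x + qnorm Y y)"
      using quasi_normed_nonneg[OF assms] xy D by (intro mult_right_mono) (auto simp: nonneg_norm_def)
    finally show "qnorm Y (x + y) \<le> D * (qnorm Y x + qnorm Y y)" .
  qed simp
qed

lemma sum_setI: "f0 \<in> qcarrier Y0 \<Longrightarrow> f1 \<in> qcarrier Y1 \<Longrightarrow> f0 + f1 \<in> sum_set Y0 Y1"
  by (auto simp: sum_set_def)

context
  fixes A0 A1 :: "'v::real_vector qspace"
  assumes A0: "quasi_normed A0" and A1: "quasi_normed A1"
begin

lemmas A_nonneg = quasi_normed_nonneg[OF A0] quasi_normed_nonneg[OF A1]

lemma K_fun_quasi_concave: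
  assumes f: "f \<in> sum_set A0 A1"
  shows "quasi_concave (\<lambda>u. ennreal (K_fun A0 A1 u f))"
proof -
  have mono: "K_fun A0 A1 u f \<le> K_fun A0 A1 v f" if "0 < u" "u \<le> v" for u v
  proof (rule K_fun_greatest[OF f])
    fix f0 f1 assume d: "f0 \<in> qcarrier A0" "f1 \<in> qcarrier A1" "f = f0 + f1"
    have "K_fun A0 A1 u f \<le> qnorm A0 f0 + u * qnorm A1 f1"
      unfolding d(3) using that d by (intro K_fun_le A_nonneg) auto
    also have "\<dots> \<le> qnorm A0 f0 + v * qnorm A1 f1"
      using that A_nonneg(2) d(2) by (intro add_left_mono mult_right_mono) (auto simp: nonneg_norm_def)
    finally show "K_fun A0 A1 u f \<le> qnorm A0 f0 + v * qnorm A1 f1" .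
  qed
  have slope: "u / v * K_fun A0 A1 v f \<le> K_fun A0 A1 u f" if "0 < u" "u \<le> v" for u v
  proof (rule K_fun_greatest[OF f])
    fix f0 f1 assume d: "f0 \<in> qcarrier A0" "f1 \<in> qcarrier A1" "f = f0 + f1"
    have "K_fun A0 A1 v f \<le> qnorm A0 f0 + v * qnorm A1 f1"
      unfolding d(3) using that d by (intro K_fun_le A_nonneg) auto
    then have "u / v * K_fun A0 A1 v f \<le> u / v * (qnorm A0 f0 + v * qnorm A1 f1)"
      using that by (intro mult_left_mono) auto
    also have "\<dots> = u / v * qnorm A0 f0 + u * qnorm A1 f1"
      using that by (simp add: field_simps)
    also have "\<dots> \<le> 1 * qnorm A0 f0 + u * qnorm A1 f1"
      using that A_nonneg(1) d(1) by (intro add_right_mono mult_right_mono) (auto simp: nonneg_norm_def)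
    finally show "u / v * K_fun A0 A1 v f \<le> qnorm A0 f0 + u * qnorm A1 f1" by simp
  qed
  show ?thesis
    unfolding quasi_concave_def
  proof (intro allI impI conjI)
    fix u v :: real assume uv: "0 < u" "u \<le> v"
    show "ennreal (K_fun A0 A1 u f) \<le> ennreal (K_fun A0 A1 v f)"
      using mono[OF uv] by (rule ennreal_leI)
    have "K_fun A0 A1 v f \<le> v / u * K_fun A0 A1 u f"
      using slope[OF uv] uv by (simp add: field_simps)
    then have "ennreal (K_fun A0 A1 v f) \<le> ennreal (v / u * K_fun A0 A1 u f)"
      by (rule ennreal_leI)
    also have "\<dots> = ennreal (v / u) * ennreal (K_fun A0 A1 u f)"
      using uv by (intro ennreal_mult K_fun_nonneg A_nonneg f) auto
    finally show "ennreal (K_fun A0 A1 v f) \<le> ennreal (v / u) * ennreal (K_fun A0 A1 u f)" .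
  qed
qed

text \<open>
  Adding decompositions of \<open>f\<close> and \<open>g\<close> gives one of \<open>f + g\<close>. The infimum is taken over one decomposition
  at a time, with the other one fixed.
\<close>

lemma K_fun_quasi_triangle:
  obtains c where "0 < c" "\<And>f g u. f \<in> sum_set A0 A1 \<Longrightarrow> g \<in> sum_set A0 A1 \<Longrightarrow> 0 < u \<Longrightarrow>
    K_fun A0 A1 u (f + g) \<le> c * (K_fun A0 A1 u f + K_fun A0 A1 u g)"
proof -
  obtain C0 where C0: "1 \<le> C0" "\<And>x y D. x \<in> qcarrier A0 \<Longrightarrow> y \<in> qcarrier A0 \<Longrightarrow> C0 \<le> D \<Longrightarrow>
    qnorm A0 (x + y) \<le> D * (qnorm A0 x + qnorm A0 y)"
    using quasi_normed_triangle[OF A0] by blast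
  obtain C1 where C1: "1 \<le> C1" "\<And>x y D. x \<in> qcarrier A1 \<Longrightarrow> y \<in> qcarrier A1 \<Longrightarrow> C1 \<le> D \<Longrightarrow>
    qnorm A1 (x + y) \<le> D * (qnorm A1 x + qnorm A1 y)"
    using quasi_normed_triangle[OF A1] by blast
  define c where "c = max C0 C1"
  have c: "0 < c" "C0 \<le> c" "C1 \<le> c" using C0(1) by (auto simp: c_def)
  show ?thesis
  proof (rule that[OF c(1)])
    fix f g u assume f: "f \<in> sum_set A0 A1" and g: "g \<in> sum_set A0 A1" and u: "0 < (u::real)"
    have "K_fun A0 A1 u (f + g) / c - K_fun A0 A1 u f \<le> K_fun A0 A1 u g"
    proof (rule K_fun_greatest[OF g])
      fix g0 g1 assume g': "g0 \<in> qcarrier A0" "g1 \<in> qcarrier A1" "g = g0 + g1"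
      have "K_fun A0 A1 u (f + g) / c - (qnorm A0 g0 + u * qnorm A1 g1) \<le> K_fun A0 A1 u f"
      proof (rule K_fun_greatest[OF f])
        fix f0 f1 assume f': "f0 \<in> qcarrier A0" "f1 \<in> qcarrier A1" "f = f0 + f1"
        have "K_fun A0 A1 u ((f0 + g0) + (f1 + g1)) \<le> qnorm A0 (f0 + g0) + u * qnorm A1 (f1 + g1)"
          using f' g' u by (intro K_fun_le A_nonneg quasi_normed_add A0 A1) auto
        also have "\<dots> \<le> c * (qnorm A0 f0 + qnorm A0 g0) + u * (c * (qnorm A1 f1 + qnorm A1 g1))"
          using f' g' u c by (intro add_mono mult_left_mono C0(2) C1(2)) auto
        finally have "K_fun A0 A1 u (f + g) \<le> c * ((qnorm A0 f0 + u * qnorm A1 f1) + (qnorm A0 g0 + u * qnorm A1 g1))"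
          unfolding f' g' by (simp add: algebra_simps)
        then have "K_fun A0 A1 u (f + g) / c \<le> (qnorm A0 f0 + u * qnorm A1 f1) + (qnorm A0 g0 + u * qnorm A1 g1)"
          using c(1) by (simp add: pos_divide_le_eq mult.commute)
        then show "K_fun A0 A1 u (f + g) / c - (qnorm A0 g0 + u * qnorm A1 g1) \<le> qnorm A0 f0 + u * qnorm A1 f1"
          by simp
      qed
      then show "K_fun A0 A1 u (f + g) / c - K_fun A0 A1 u f \<le> qnorm A0 g0 + u * qnorm A1 g1"
        by simp
    qed
    then have "K_fun A0 A1 u (f + g) / c \<le> K_fun A0 A1 u f + K_fun A0 A1 u g" by simp
    then show "K_fun A0 A1 u (f + g) \<le> c * (K_fun A0 A1 u f + K_fun A0 A1 u g)"
      using c(1) by (simp add: pos_divide_le_eq mult.commute)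
  qed
qed

lemma sum_set_minus: "f \<in> sum_set A0 A1 \<Longrightarrow> - f \<in> sum_set A0 A1"
proof -
  assume "f \<in> sum_set A0 A1"
  then obtain f0 f1 where "f0 \<in> qcarrier A0" "f1 \<in> qcarrier A1" "f = f0 + f1"
    by (auto simp: sum_set_def)
  moreover from this have "- f0 + - f1 \<in> sum_set A0 A1"
    by (intro sum_setI quasi_normed_minus A0 A1)
  ultimately show ?thesis by simp
qed

lemma sum_set_add: "f \<in> sum_set A0 A1 \<Longrightarrow> g \<in> sum_set A0 A1 \<Longrightarrow> f + g \<in> sum_set A0 A1"
proof -
  assume "f \<in> sum_set A0 A1" "g \<in> sum_set A0 A1"
  then obtain f0 f1 g0 g1 where *: "f0 \<in> qcarrier A0" "f1 \<in> qcarrier A1" "g0 \<in> qcarrier A0" "g1 \<in> qcarrier A1"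
    "f = f0 + f1" "g = g0 + g1"
    by (auto simp: sum_set_def)
  have "(f0 + g0) + (f1 + g1) \<in> sum_set A0 A1"
    using * by (intro sum_setI quasi_normed_add A0 A1)
  then show ?thesis by (simp add: * ac_simps)
qed

lemma K_fun_minus_le:
  assumes f: "f \<in> sum_set A0 A1" and u: "0 < u"
  shows "K_fun A0 A1 u (- f) \<le> K_fun A0 A1 u f"
proof (rule K_fun_greatest[OF f])
  fix f0 f1 assume d: "f0 \<in> qcarrier A0" "f1 \<in> qcarrier A1" "f = f0 + f1"
  have "K_fun A0 A1 u (- f0 + - f1) \<le> qnorm A0 (- f0) + u * qnorm A1 (- f1)"
    using u d by (intro K_fun_le A_nonneg quasi_normed_minus A0 A1) auto
  then show "K_fun A0 A1 u (- f) \<le> qnorm A0 f0 + u * qnorm A1 f1"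
    using d by (simp add: quasi_normed_minus[OF A0] quasi_normed_minus[OF A1])
qed

lemma in_sum_set:
  "f0 \<in> qcarrier A0 \<Longrightarrow> f0 \<in> sum_set A0 A1" "f1 \<in> qcarrier A1 \<Longrightarrow> f1 \<in> sum_set A0 A1"
  using sum_setI[of f0 A0 0 A1] sum_setI[of 0 A0 f1 A1] quasi_normed_0[OF A0] quasi_normed_0[OF A1] by auto

lemma K_fun_le_norm:
  assumes "0 < u"
  shows "f0 \<in> qcarrier A0 \<Longrightarrow> K_fun A0 A1 u f0 \<le> qnorm A0 f0"
    and "f1 \<in> qcarrier A1 \<Longrightarrow> K_fun A0 A1 u f1 \<le> u * qnorm A1 f1"
  using K_fun_le[OF A_nonneg, of u f0 0] K_fun_le[OF A_nonneg, of u 0 f1] assms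
    quasi_normed_0[OF A0] quasi_normed_0[OF A1] by auto

end

section \<open>The equivalence\<close>

theorem theorem26:
  fixes A0 A1 :: "'v::{real_vector, topological_group_add, t2_space} qspace"
    and q1 r1 r0 :: ennreal and a1 b1 b0 :: "real \<Rightarrow> real"
  defines "X0 \<equiv> interp_space A0 A1 0 r0 b0"
    and "X1 \<equiv> L_space A0 A1 1 r1 b1 q1 a1"
    and "\<chi>0 \<equiv> chi0 r0 b0"
    and "\<rho> \<equiv> rho r0 b0 r1 b1 q1 a1"
  assumes couple: "compatible_couple A0 A1" "quasi_Banach A0" "quasi_Banach A1"
    and inter: "qcarrier A0 \<inter> qcarrier A1 \<noteq> {0}"
    and exps: "0 < q1" "0 < r1" "0 < r0"
    and sv: "slowly_varying a1" "slowly_varying b1" "slowly_varying b0"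
    and fin1: "Lq_norm r1 {1<..} (\<lambda>s. ennreal (s powr (- rcp r1) * b1 s)) < \<infinity>"
      "Lq_norm r1 {0<..<1} (\<lambda>s. ennreal (s powr (- rcp r1) * b1 s) *
         Lq_norm q1 {0<..<s} (\<lambda>u. ennreal (u powr (- rcp q1) * a1 u))) < \<infinity>"
    and fin0: "Lq_norm r0 {1<..} (\<lambda>s. ennreal (s powr (- rcp r0) * b0 s)) < \<infinity>"
    and nontrivial: "qcarrier X0 \<noteq> {0}" "qcarrier X1 \<noteq> {0}"
  shows "approx_on (sum_set X0 X1 \<times> {0<..})
    (\<lambda>(f, t). ennreal (K_fun X0 X1 (\<rho> t) f))
    (\<lambda>(f, t).
       Lq_norm r0 {0<..<t} (\<lambda>u. ennreal (u powr (- rcp r0) * b0 u * K_fun A0 A1 u f)) +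
       ennreal (\<rho> t) * Lq_norm r1 {t<..} (\<lambda>s. ennreal (s powr (- rcp r1) * b1 s) *
         Lq_norm q1 {t<..<s} (\<lambda>u. ennreal (u powr (- 1 - rcp q1) * a1 u * K_fun A0 A1 u f))) +
       \<chi>0 t * ennreal (K_fun A0 A1 t f))"
proof -
  have A: "quasi_normed A0" "quasi_normed A1"
    using couple by (auto simp: quasi_Banach_def)
  have pos: "0 < a1 u" "0 < b1 u" "0 < b0 u" if "0 < u" for u
    using sv that by (auto simp: slowly_varying_def)
  let ?a1 = "\<lambda>u. ennreal (a1 u)" and ?b1 = "\<lambda>u. ennreal (b1 u)" and ?b0 = "\<lambda>u. ennreal (b0 u)"
  obtain M0 Ma Mb where w: "weight M0 ?b0" "weight Ma ?a1" "weight Mb ?b1"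
    using sv slowly_varying_weight by blast
  have meas: "?b0 \<in> borel_measurable haar" "?a1 \<in> borel_measurable haar" "?b1 \<in> borel_measurable haar"
    using w by (auto simp: weight_def)
  have inner: "Lq_norm q1 {0<..<s} (\<lambda>u. ennreal (u powr (- rcp q1) * a1 u)) = head_norm q1 ?a1 s" for s
    using pos by (intro Lq_norm_eq_head_norm exps meas) (auto simp: ennreal_mult less_imp_le)
  have inner_meas: "(\<lambda>s. ?b1 s * head_norm q1 ?a1 s) \<in> borel_measurable haar"
    by (intro borel_measurable_times_ennreal meas head_norm_measurable exps)
  have tail1: "Lq_norm r1 {t<..} (\<lambda>s. ennreal (s powr (- rcp r1) * b1 s)) = tail_norm r1 ?b1 t" if "0 < t" for t
    using pos that by (intro Lq_norm_eq_tail_norm exps meas) (auto simp: ennreal_mult less_imp_le)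
  have tail0: "Lq_norm r0 {t<..} (\<lambda>s. ennreal (s powr (- rcp r0) * b0 s)) = tail_norm r0 ?b0 t" if "0 < t" for t
    using pos that by (intro Lq_norm_eq_tail_norm exps meas) (auto simp: ennreal_mult less_imp_le)
  have head1: "Lq_norm r1 {0<..<t} (\<lambda>s. ennreal (s powr (- rcp r1) * b1 s) * head_norm q1 ?a1 s)
      = head_norm r1 (\<lambda>s. ?b1 s * head_norm q1 ?a1 s) t" for t
    using pos by (intro Lq_norm_eq_head_norm exps inner_meas) (auto simp: ennreal_mult less_imp_le mult.assoc)
  interpret interpolation_weights r0 q1 r1 M0 Ma Mb ?b0 ?a1 ?b1
    using fin0 fin1 w exps by unfold_locales (auto simp: tail0 tail1 head1 inner)
  have chi0: "\<chi>0 t = chi_tail t" if "0 < t" for t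
    using that by (simp add: \<chi>0_def chi0_def tail0 chi_tail_def)
  have \<rho>: "ennreal (\<rho> t) = ratio t" "0 < \<rho> t" if t: "0 < t" for t
  proof -
    have 1: "chi1 r1 b1 q1 a1 t = chi_mixed t"
      using t by (simp add: chi1_def chi_mixed_def inner head1 tail1)
    obtain x where x: "chi_tail t = ennreal x" "0 < x"
      using chi_tail_bounds[OF t] by (cases "chi_tail t") auto
    obtain y where y: "chi_mixed t = ennreal y" "0 < y"
      using chi_mixed_bounds[OF t] by (cases "chi_mixed t") auto
    have "\<rho> t = t * (x / y)"
      using t x y chi0[OF t] by (simp add: \<rho>_def \<chi>0_def rho_def 1)
    then show "ennreal (\<rho> t) = ratio t" "0 < \<rho> t"
      using t x y by (simp_all add: ratio_def ennreal_mult[symmetric] divide_ennreal)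
  qed
  let ?k = "\<lambda>f u. ennreal (K_fun A0 A1 u f)"
  let ?S = "sum_set A0 A1"
  have qc: "quasi_concave (?k f)" if "f \<in> ?S" for f
    by (rule K_fun_quasi_concave[OF A that])
  have K0: "0 \<le> K_fun A0 A1 u f" if "f \<in> ?S" "0 < u" for f u
    using that by (intro K_fun_nonneg quasi_normed_nonneg A) auto
  have bkm: "(\<lambda>u. ?b0 u * ?k f u) \<in> borel_measurable haar" if "f \<in> ?S" for f
    by (intro borel_measurable_times_ennreal meas quasi_concave_measurable qc that)
  have sm: "slope (?k f) \<in> borel_measurable haar" if "f \<in> ?S" for f
    by (intro slope_measurable quasi_concave_measurable qc that)
  have b0K: "ennreal (u powr (- rcp r0) * b0 u * K_fun A0 A1 u f) = ennreal (u powr (- rcp r0)) * (?b0 u * ?k f u)"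
    if "f \<in> ?S" "0 < u" for f u
    using pos[of u] K0[OF that] that by (simp add: ennreal_mult less_imp_le mult.assoc)
  have a1K: "ennreal (u powr (- 1 - rcp q1) * a1 u * K_fun A0 A1 u f) = ennreal (u powr (- rcp q1)) * slope (?k f) u"
    if "f \<in> ?S" "0 < u" for f u
  proof -
    have "u powr (- 1 - rcp q1) = u powr (- rcp q1) * (1 / u)"
    proof -
      have "u powr (- 1 - rcp q1) = u powr (- rcp q1 + - 1)" by (simp add: add.commute)
      also have "\<dots> = u powr (- rcp q1) * u powr (- 1)" by (rule powr_add)
      also have "u powr (- 1) = 1 / u" using that(2) by (simp add: powr_minus_divide)
      finally show ?thesis .
    qed
    then show ?thesis
      unfolding slope_def mult.assoc using pos(1)[OF that(2)] that(2)
      by (simp only: mult.assoc ennreal_mult' powr_ge_zero zero_le_divide_1_iff less_imp_le)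
  qed
  have n0: "interp_norm A0 A1 0 r0 b0 f = norm0 (?k f)" if "f \<in> ?S" for f
    unfolding interp_norm_def norm0_def using b0K[OF that]
    by (intro Lq_norm_eq_full_norm exps bkm that) auto
  have n1: "L_norm A0 A1 1 r1 b1 q1 a1 f = norm1 (?k f)" if "f \<in> ?S" for f
  proof -
    have in1: "Lq_norm q1 {0<..<s} (\<lambda>u. ennreal (u powr (- 1 - rcp q1) * a1 u * K_fun A0 A1 u f))
        = head_norm q1 (slope (?k f)) s" for s
      using a1K[OF that] by (intro Lq_norm_eq_head_norm exps sm that) auto
    show ?thesis
      unfolding L_norm_def norm1_def in1 using pos
      by (intro Lq_norm_eq_full_norm exps borel_measurable_times_ennreal meas head_norm_measurable sm that)
         (auto simp: ennreal_mult less_imp_le mult.assoc)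
  qed
  have X0: "f \<in> qcarrier X0 \<longleftrightarrow> f \<in> ?S \<and> norm0 (?k f) < top" "f \<in> ?S \<Longrightarrow> qnorm X0 f = enn2real (norm0 (?k f))" for f
    by (auto simp: X0_def interp_space_def n0)
  have X1: "f \<in> qcarrier X1 \<longleftrightarrow> f \<in> ?S \<and> norm1 (?k f) < top" "f \<in> ?S \<Longrightarrow> qnorm X1 f = enn2real (norm1 (?k f))" for f
    by (auto simp: X1_def L_space_def n1)
  have XN: "nonneg_norm X0" "nonneg_norm X1"
    using X0 X1 by (auto simp: nonneg_norm_def)
  have sum: "f \<in> ?S" if "f \<in> sum_set X0 X1" for f
    using that X0(1) X1(1) by (auto simp: sum_set_def[of X0] intro: sum_set_add[OF A])
  let ?F = "\<lambda>f t. head_part (?k f) t + ratio t * tail_part (?k f) t + chi_tail t * ?k f t"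
  have rhs: "Lq_norm r0 {0<..<t} (\<lambda>u. ennreal (u powr (- rcp r0) * b0 u * K_fun A0 A1 u f)) +
       ennreal (\<rho> t) * Lq_norm r1 {t<..} (\<lambda>s. ennreal (s powr (- rcp r1) * b1 s) *
         Lq_norm q1 {t<..<s} (\<lambda>u. ennreal (u powr (- 1 - rcp q1) * a1 u * K_fun A0 A1 u f))) +
       \<chi>0 t * ennreal (K_fun A0 A1 t f) = ?F f t" if f: "f \<in> ?S" and t: "0 < t" for f t
  proof -
    have 1: "Lq_norm r0 {0<..<t} (\<lambda>u. ennreal (u powr (- rcp r0) * b0 u * K_fun A0 A1 u f)) = head_part (?k f) t"
      unfolding head_part_def using b0K[OF f] by (intro Lq_norm_eq_head_norm exps bkm f) auto
    have in2: "Lq_norm q1 {t<..<s} (\<lambda>u. ennreal (u powr (- 1 - rcp q1) * a1 u * K_fun A0 A1 u f))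
        = mid_norm q1 (slope (?k f)) t s" for s
      using a1K[OF f] t by (intro Lq_norm_eq_mid_norm exps sm f) auto
    have 2: "Lq_norm r1 {t<..} (\<lambda>s. ennreal (s powr (- rcp r1) * b1 s) * mid_norm q1 (slope (?k f)) t s) = tail_part (?k f) t"
      unfolding tail_part_def using pos t
      by (intro Lq_norm_eq_tail_norm exps borel_measurable_times_ennreal meas mid_norm_measurable sm f)
         (auto simp: ennreal_mult less_imp_le mult.assoc)
    show ?thesis unfolding in2 1 2 using t by (simp add: \<rho> chi0)
  qed
  obtain c where c: "0 < c" "\<And>f g u. f \<in> ?S \<Longrightarrow> g \<in> ?S \<Longrightarrow> 0 < u \<Longrightarrow>
    K_fun A0 A1 u (f + g) \<le> c * (K_fun A0 A1 u f + K_fun A0 A1 u g)"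
    using K_fun_quasi_triangle[OF A] by blast
  have kadd: "?k (f + g) u \<le> ennreal c * (?k f u + ?k g u)" if "f \<in> ?S" "g \<in> ?S" "0 < u" for f g u
    using ennreal_leI[OF c(2)[OF that]] c(1) K0[OF that(1,3)] K0[OF that(2,3)]
    by (simp add: ennreal_mult ennreal_plus)
  have kdiff: "?k f u \<le> ennreal c * (?k (f + g) u + ?k g u)" if "f \<in> ?S" "g \<in> ?S" "0 < u" for f g u
  proof -
    have "?k ((f + g) + - g) u \<le> ennreal c * (?k (f + g) u + ?k (- g) u)"
      using that by (intro kadd sum_set_add[OF A] sum_set_minus[OF A])
    also have "\<dots> \<le> ennreal c * (?k (f + g) u + ?k g u)"
      using that by (intro mult_left_mono add_left_mono ennreal_leI K_fun_minus_le[OF A]) auto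
    finally show ?thesis by simp
  qed
  obtain C1 where C1: "C1 < top"
    "\<And>k k0 k1 t. quasi_concave k \<Longrightarrow> quasi_concave k0 \<Longrightarrow> quasi_concave k1 \<Longrightarrow> 0 < t \<Longrightarrow>
       (\<And>u. 0 < u \<Longrightarrow> k u \<le> ennreal c * (k0 u + k1 u)) \<Longrightarrow>
       head_part k t + ratio t * tail_part k t + chi_tail t * k t \<le> C1 * (norm0 k0 + ratio t * norm1 k1)"
    using parts_le_norms[OF ennreal_less_top[of c]] by blast
  obtain C2 where C2: "C2 < top"
    "\<And>k k0 k1 t \<kappa>. quasi_concave k \<Longrightarrow> quasi_concave k0 \<Longrightarrow> quasi_concave k1 \<Longrightarrow> 0 < t \<Longrightarrow>
       (\<And>u. 0 < u \<Longrightarrow> k0 u \<le> ennreal c * (k u + k1 u)) \<Longrightarrow> (\<And>u. 0 < u \<Longrightarrow> k1 u \<le> ennreal c * (k u + k0 u)) \<Longrightarrow>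
       (\<And>u. 0 < u \<Longrightarrow> k0 u \<le> \<kappa>) \<Longrightarrow> (\<And>u. 0 < u \<Longrightarrow> k1 u \<le> ennreal (u / t) * \<kappa>) \<Longrightarrow>
       norm0 k0 + ratio t * norm1 k1 \<le> C2 * (head_part k t + ratio t * tail_part k t + chi_tail t * \<kappa>)"
    using norms_le_parts[OF ennreal_less_top[of c]] by blast
  define D where "D = enn2real C1 + enn2real C2 + 1"
  have D: "0 < D" "C1 \<le> ennreal D" "C2 \<le> ennreal D"
  proof -
    show "0 < D" by (simp add: D_def add_nonneg_pos)
    have "ennreal (enn2real C1) = C1" "ennreal (enn2real C2) = C2" using C1(1) C2(1) by auto
    then show "C1 \<le> ennreal D" "C2 \<le> ennreal D"
      unfolding D_def by (metis add_increasing2 add_increasing enn2real_nonneg ennreal_leI le_add_same_cancel1 zero_le_one add.assoc add_nonneg_nonneg)+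
  qed
  have norms: "ennreal (qnorm X0 f0 + \<rho> t * qnorm X1 f1) = norm0 (?k f0) + ratio t * norm1 (?k f1)"
    if "f0 \<in> qcarrier X0" "f1 \<in> qcarrier X1" "0 < t" for f0 f1 t
  proof -
    have "ennreal (qnorm X0 f0) = norm0 (?k f0)" "ennreal (qnorm X1 f1) = norm1 (?k f1)"
      using that X0 X1 by auto
    moreover have "0 \<le> qnorm X0 f0" "0 \<le> qnorm X1 f1" "0 < \<rho> t"
      using XN that \<rho> by (auto simp: nonneg_norm_def)
    ultimately show ?thesis
      using \<rho>(1)[OF that(3)] by (simp add: ennreal_plus ennreal_mult)
  qed

  \<comment> \<open>Since the bound holds for every decomposition, it also shows that the right-hand side is finite.\<close>
  have lower: "?F f t \<le> ennreal D * ennreal (K_fun X0 X1 (\<rho> t) f)"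
    if f: "f \<in> sum_set X0 X1" and t: "0 < t" for f t
  proof -
    have dec: "?F f t \<le> ennreal (D * (qnorm X0 f0 + \<rho> t * qnorm X1 f1))"
      if d: "f0 \<in> qcarrier X0" "f1 \<in> qcarrier X1" "f = f0 + f1" for f0 f1
    proof -
      have S: "f0 \<in> ?S" "f1 \<in> ?S" using d X0(1) X1(1) by auto
      have "?F f t \<le> C1 * (norm0 (?k f0) + ratio t * norm1 (?k f1))"
        unfolding d(3) by (intro C1(2) qc sum_set_add[OF A] kadd S t)
      also have "\<dots> \<le> ennreal D * ennreal (qnorm X0 f0 + \<rho> t * qnorm X1 f1)"
        unfolding norms[OF d(1,2) t] using D by (intro mult_right_mono) auto
      finally show ?thesis using D(1) by (simp add: ennreal_mult')
    qed
    obtain g0 g1 where "g0 \<in> qcarrier X0" "g1 \<in> qcarrier X1" "f = g0 + g1"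
      using f by (auto simp: sum_set_def)
    from dec[OF this] have "?F f t < top"
      by (rule le_less_trans) simp
    then obtain x where x: "?F f t = ennreal x" "0 \<le> x"
      by (cases "?F f t") auto
    have "x / D \<le> K_fun X0 X1 (\<rho> t) f"
    proof (rule K_fun_greatest[OF f])
      fix f0 f1 assume d: "f0 \<in> qcarrier X0" "f1 \<in> qcarrier X1" "f = f0 + f1"
      have "0 \<le> qnorm X0 f0 + \<rho> t * qnorm X1 f1"
        using XN d \<rho>(2)[OF t] by (auto simp: nonneg_norm_def)
      then have "x \<le> D * (qnorm X0 f0 + \<rho> t * qnorm X1 f1)"
        using dec[OF d] D(1) unfolding x(1) by (subst (asm) ennreal_le_iff) auto
      then show "x / D \<le> qnorm X0 f0 + \<rho> t * qnorm X1 f1"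
        using D(1) by (simp add: pos_divide_le_eq mult.commute)
    qed
    then have "x \<le> D * K_fun X0 X1 (\<rho> t) f"
      using D(1) by (simp add: pos_divide_le_eq mult.commute)
    then show ?thesis
      unfolding x(1) using D(1) by (simp add: ennreal_mult'[symmetric] ennreal_leI)
  qed

  have upper: "ennreal (K_fun X0 X1 (\<rho> t) f) \<le> ennreal D * ?F f t"
    if f: "f \<in> sum_set X0 X1" and t: "0 < t" for f t
  proof -
    have fin: "?F f t < top"
      using lower[OF f t] by (rule le_less_trans) (simp add: ennreal_mult_less_top)
    then obtain y where y: "head_part (?k f) t + ratio t * tail_part (?k f) t = ennreal y" "0 \<le> y"
      by (cases "head_part (?k f) t + ratio t * tail_part (?k f) t") auto
    obtain x where x: "chi_tail t = ennreal x" "0 < x"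
      using chi_tail_bounds[OF t] by (cases "chi_tail t") auto
    have \<kappa>: "K_fun X0 X1 (\<rho> t) f \<le> D * (y + x * \<kappa>)" if \<kappa>: "K_fun A0 A1 t f < \<kappa>" for \<kappa>
    proof -
      have \<kappa>0: "0 < \<kappa>" using K0[OF sum[OF f] t] \<kappa> by simp
      obtain f0 f1 where d: "f0 \<in> qcarrier A0" "f1 \<in> qcarrier A1" "f = f0 + f1"
        and dk: "qnorm A0 f0 + t * qnorm A1 f1 < \<kappa>"
        using K_fun_less_decomp[OF sum[OF f] \<kappa>] by blast
      have S: "f0 \<in> ?S" "f1 \<in> ?S" using in_sum_set[OF A] d by auto
      have nn: "0 \<le> qnorm A0 f0" "0 \<le> qnorm A1 f1"
        using d A[THEN quasi_normed_nonneg] by (auto simp: nonneg_norm_def)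
      have le: "norm0 (?k f0) + ratio t * norm1 (?k f1)
          \<le> C2 * (head_part (?k f) t + ratio t * tail_part (?k f) t + chi_tail t * ennreal \<kappa>)"
      proof (intro C2(2) qc sum[OF f] S t)
        fix u :: real assume u: "0 < u"
        show "?k f0 u \<le> ennreal c * (?k f u + ?k f1 u)"
          unfolding d(3) by (rule kdiff[OF S u])
        show "?k f1 u \<le> ennreal c * (?k f u + ?k f0 u)"
          unfolding d(3) using kdiff[OF S(2,1) u] by (simp add: add.commute)
        have "K_fun A0 A1 u f0 \<le> qnorm A0 f0"
          by (rule K_fun_le_norm(1)[OF A u d(1)])
        also have "\<dots> \<le> \<kappa>" using dk nn t by (smt (verit) mult_nonneg_nonneg)
        finally show "?k f0 u \<le> ennreal \<kappa>" by (rule ennreal_leI)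
        have "t * qnorm A1 f1 \<le> \<kappa>" using dk nn by simp
        then have "qnorm A1 f1 \<le> \<kappa> / t" using t by (simp add: pos_le_divide_eq mult.commute)
        then have "u * qnorm A1 f1 \<le> u * (\<kappa> / t)" using u by (intro mult_left_mono) auto
        with K_fun_le_norm(2)[OF A u d(2)] have "K_fun A0 A1 u f1 \<le> u / t * \<kappa>" by simp
        then have "?k f1 u \<le> ennreal (u / t * \<kappa>)" by (rule ennreal_leI)
        then show "?k f1 u \<le> ennreal (u / t) * ennreal \<kappa>"
          using u t \<kappa>0 by (subst ennreal_mult[symmetric]) auto
      qed
      also have "\<dots> \<le> ennreal D * (ennreal y + ennreal x * ennreal \<kappa>)"
        unfolding y x using D by (intro mult_right_mono) auto
      also have "\<dots> = ennreal (D * (y + x * \<kappa>))"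
        using D(1) x(2) y(2) \<kappa>0 by (simp add: ennreal_mult ennreal_plus)
      finally have le: "norm0 (?k f0) + ratio t * norm1 (?k f1) \<le> ennreal (D * (y + x * \<kappa>))" .
      have fin: "norm0 (?k f0) + ratio t * norm1 (?k f1) < top"
        using le by (rule le_less_trans) simp
      moreover have "ratio t \<noteq> 0" using \<rho>[OF t] by (metis ennreal_eq_0_iff not_le)
      ultimately have X: "f0 \<in> qcarrier X0" "f1 \<in> qcarrier X1"
        using S X0(1) X1(1) by (auto simp: ennreal_mult_less_top)
      have "K_fun X0 X1 (\<rho> t) f \<le> qnorm X0 f0 + \<rho> t * qnorm X1 f1"
        unfolding d(3) using \<rho>(2)[OF t] by (intro K_fun_le XN X) auto
      also have "\<dots> \<le> D * (y + x * \<kappa>)"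
        using le D(1) x(2) y(2) \<kappa>0 unfolding norms[OF X t, symmetric]
        by (subst (asm) ennreal_le_iff) auto
      finally show ?thesis .
    qed
    \<comment> \<open>The limit \<open>\<kappa> \<rightarrow> K(t, f)\<close> from above.\<close>
    have "K_fun X0 X1 (\<rho> t) f \<le> D * (y + x * K_fun A0 A1 t f)"
    proof (rule field_le_epsilon)
      fix e :: real assume "0 < e"
      then have "K_fun X0 X1 (\<rho> t) f \<le> D * (y + x * (K_fun A0 A1 t f + e / (D * x)))"
        using D(1) x(2) by (intro \<kappa>) auto
      also have "\<dots> = D * (y + x * K_fun A0 A1 t f) + e"
        using D(1) x(2) by (simp add: field_simps)
      finally show "K_fun X0 X1 (\<rho> t) f \<le> D * (y + x * K_fun A0 A1 t f) + e" .
    qed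
    then have "ennreal (K_fun X0 X1 (\<rho> t) f) \<le> ennreal (D * (y + x * K_fun A0 A1 t f))"
      by (rule ennreal_leI)
    also have "\<dots> = ennreal D * ?F f t"
      unfolding y x using D(1) x(2) y(2) K0[OF sum[OF f] t] by (simp add: ennreal_mult ennreal_plus)
    finally show ?thesis .
  qed

  show ?thesis
    unfolding approx_on_def
  proof (intro exI[of _ D] conjI D(1) ballI)
    fix p :: "'v \<times> real" assume "p \<in> sum_set X0 X1 \<times> {0<..}"
    then obtain f t where p: "p = (f, t)" and f: "f \<in> sum_set X0 X1" and t: "0 < t" by auto
    have "ennreal (1 / D) * ?F f t \<le> ennreal (1 / D) * (ennreal D * ennreal (K_fun X0 X1 (\<rho> t) f))"
      by (intro mult_left_mono lower f t) auto
    also have "\<dots> = ennreal (K_fun X0 X1 (\<rho> t) f)"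
      using D(1) by (simp add: mult.assoc[symmetric] ennreal_mult[symmetric])
    finally have 1: "ennreal (1 / D) * ?F f t \<le> ennreal (K_fun X0 X1 (\<rho> t) f)" .
    show "ennreal (1 / D) *
         (case p of (f, t) \<Rightarrow>
           Lq_norm r0 {0<..<t} (\<lambda>u. ennreal (u powr (- rcp r0) * b0 u * K_fun A0 A1 u f)) +
           ennreal (\<rho> t) * Lq_norm r1 {t<..} (\<lambda>s. ennreal (s powr (- rcp r1) * b1 s) *
             Lq_norm q1 {t<..<s} (\<lambda>u. ennreal (u powr (- 1 - rcp q1) * a1 u * K_fun A0 A1 u f))) +
           \<chi>0 t * ennreal (K_fun A0 A1 t f)) \<le> (case p of (f, t) \<Rightarrow> ennreal (K_fun X0 X1 (\<rho> t) f))"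
      unfolding p prod.case rhs[OF sum[OF f] t] by (rule 1)
    show "(case p of (f, t) \<Rightarrow> ennreal (K_fun X0 X1 (\<rho> t) f)) \<le> ennreal D *
         (case p of (f, t) \<Rightarrow>
           Lq_norm r0 {0<..<t} (\<lambda>u. ennreal (u powr (- rcp r0) * b0 u * K_fun A0 A1 u f)) +
           ennreal (\<rho> t) * Lq_norm r1 {t<..} (\<lambda>s. ennreal (s powr (- rcp r1) * b1 s) *
             Lq_norm q1 {t<..<s} (\<lambda>u. ennreal (u powr (- 1 - rcp q1) * a1 u * K_fun A0 A1 u f))) +
           \<chi>0 t * ennreal (K_fun A0 A1 t f))"
      unfolding p prod.case rhs[OF sum[OF f] t] by (rule upper[OF f t])
  qed
qed

end
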